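(* Let $\Omega\subset\mathbb{R}^d$ be open, $T>0$, and let $u\in L^\infty(\Omega\times(0,T);\mathbb{R}^d)$, $p\in L^1(\Omega\times(0,T))$, $f\in L^1(\Omega\times(0,T);\mathbb{R}^d)$ be a weak solution of the incompressible Euler equations $$\partial_t u+\operatorname{div}(u\otimes u)+\nabla p=f,\qquad \operatorname{div}u=0\qquad\text{in }\mathcal{D}'(\Omega\times(0,T)).$$ Assume that the spatial antisymmetric gradient $\Lambda u$ belongs to $L^1_t\mathcal{M}_x$ and that for almost every $t\in(0,T)$ the set $\mathcal{N}_{u_t}$ is $|\Lambda u_t|$-negligible. Then $\mathrm{D}\equiv0$, i.e. $$\partial_t\frac{|u|^2}{2}+\operatorname{div}\Big(u\Big(\frac{|u|^2}{2}+p\Big)\Big)=f\cdot u\qquad\text{in }\mathcal{D}'(\Omega\times(0,T)).$$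
   Context: The Duchon--Robert defect distribution $\mathrm{D}$ is defined by $\partial_t\frac{|u|^2}{2}+\operatorname{div}\big(u(\frac{|u|^2}{2}+p)\big)=-\mathrm{D}+f\cdot u$ in $\mathcal{D}'(\Omega\times(0,T))$. For a vector field $w$ on $\Omega$, $\Lambda w$ is the matrix-valued distribution $(\Lambda w)_{ij}=\partial_j w_i-\partial_i w_j$ (twice the antisymmetric part of the gradient). "$\Lambda u\in L^1_t\mathcal{M}_x$" means: there is a weakly measurable curve $t\mapsto\Lambda u_t$ of $\mathbb{R}^{d\times d}$-valued Radon measures on $\Omega$, with $\int_0^T\|\Lambda u_t\|_{\mathcal{M}}\,dt<\infty$, such that $\Lambda u_t$ is the spatial antisymmetric gradient of the slice $u_t=u(\cdot,t)$ for a.e. $t$. Blow-up: for $w\in L^1_{loc}(\Omega;\mathbb{R}^m)$ and $x_0\in\Omega$, $w$ admits a blow up at $x_0$ if there is $v\in L^1(B_1)$ with $\lim_{\ell\to0}\int_{B_1}|w(x_0+\ell z)-v(z)|\,dz=0$ (full limit $\ell\to0$, not along subsequences); $\mathcal{N}_w$ is the set of $x_0\in\Omega$ at which $w$ does not admit a blow up. *)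

theory Defs
  imports "HOL-Analysis.Analysis"
begin

definition dderiv :: "'a::euclidean_space \<Rightarrow> ('a \<Rightarrow> real) \<Rightarrow> 'a \<Rightarrow> real" where
  "dderiv v g = (\<lambda>x. frechet_derivative g (at x) v)"

definition smooth_fun :: "('a::euclidean_space \<Rightarrow> real) \<Rightarrow> bool" where
  "smooth_fun g \<longleftrightarrow> (\<forall>vs \<in> lists Basis. (\<lambda>x. foldr dderiv vs g x) differentiable_on UNIV)"

definition test_fun :: "'a::euclidean_space set \<Rightarrow> ('a \<Rightarrow> real) \<Rightarrow> bool" where
  "test_fun U g \<longleftrightarrow> smooth_fun g \<and> compact (closure {x. g x \<noteq> 0}) \<and> closure {x. g x \<noteq> 0} \<subseteq> U"

definition cont_cs_fun :: "'a::euclidean_space set \<Rightarrow> ('a \<Rightarrow> real) \<Rightarrow> bool" where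
  "cont_cs_fun U g \<longleftrightarrow> continuous_on UNIV g \<and> compact (closure {x. g x \<noteq> 0}) \<and> closure {x. g x \<noteq> 0} \<subseteq> U"

definition dt :: "((real^('d::finite)) \<times> real \<Rightarrow> real) \<Rightarrow> (real^'d) \<times> real \<Rightarrow> real" where
  "dt \<psi> = dderiv ((0::(real^'d)), (1::real)) \<psi>"

definition dx :: "'d::finite \<Rightarrow> ((real^'d) \<times> real \<Rightarrow> real) \<Rightarrow> (real^'d) \<times> real \<Rightarrow> real" where
  "dx j \<psi> = dderiv (axis j (1::real), (0::real)) \<psi>"

definition dsp :: "'d::finite \<Rightarrow> ((real^'d) \<Rightarrow> real) \<Rightarrow> (real^'d) \<Rightarrow> real" where
  "dsp j \<phi> = dderiv (axis j (1::real)) \<phi>"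

definition weak_euler ::
  "(real^('d::finite)) set \<Rightarrow> real \<Rightarrow> ((real^'d) \<Rightarrow> real \<Rightarrow> (real^'d)) \<Rightarrow> ((real^'d) \<Rightarrow> real \<Rightarrow> real)
   \<Rightarrow> ((real^'d) \<Rightarrow> real \<Rightarrow> (real^'d)) \<Rightarrow> bool" where
  "weak_euler \<Omega> T u p f \<longleftrightarrow>
     (\<forall>\<psi>. test_fun (\<Omega> \<times> {0<..<T}) \<psi> \<longrightarrow>
        (\<forall>k. (\<integral>z \<in> \<Omega> \<times> {0<..<T}.
               (case z of (x, t) \<Rightarrow>
                  u x t $ k * dt \<psi> (x, t)
                + (\<Sum>j\<in>UNIV. u x t $ k * u x t $ j * dx j \<psi> (x, t))
                + p x t * dx k \<psi> (x, t)
                + f x t $ k * \<psi> (x, t)) \<partial>lebesgue) = 0)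
      \<and> (\<integral>z \<in> \<Omega> \<times> {0<..<T}.
               (case z of (x, t) \<Rightarrow> (\<Sum>j\<in>UNIV. u x t $ j * dx j \<psi> (x, t))) \<partial>lebesgue) = 0)"

text \<open>Local energy balance with vanishing Duchon--Robert defect distribution (D = 0).\<close>
definition energy_equality ::
  "(real^('d::finite)) set \<Rightarrow> real \<Rightarrow> ((real^'d) \<Rightarrow> real \<Rightarrow> (real^'d)) \<Rightarrow> ((real^'d) \<Rightarrow> real \<Rightarrow> real)
   \<Rightarrow> ((real^'d) \<Rightarrow> real \<Rightarrow> (real^'d)) \<Rightarrow> bool" where
  "energy_equality \<Omega> T u p f \<longleftrightarrow>
     (\<forall>\<psi>. test_fun (\<Omega> \<times> {0<..<T}) \<psi> \<longrightarrow>
        (\<integral>z \<in> \<Omega> \<times> {0<..<T}.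
           (case z of (x, t) \<Rightarrow>
              (norm (u x t))\<^sup>2 / 2 * dt \<psi> (x, t)
            + (\<Sum>j\<in>UNIV. u x t $ j * ((norm (u x t))\<^sup>2 / 2 + p x t) * dx j \<psi> (x, t))
            + (f x t \<bullet> u x t) * \<psi> (x, t)) \<partial>lebesgue) = 0)"

text \<open>A matrix-valued finite (Radon) measure on \<Omega> is represented as G \<mu>, where \<mu> is a finite
  positive Borel measure on R^d concentrated on \<Omega> and G is a \<mu>-integrable matrix density.\<close>
definition matrix_radon :: "(real^('d::finite)) set \<Rightarrow> (real^'d) measure \<Rightarrow> ((real^'d) \<Rightarrow> real^'d^'d) \<Rightarrow> bool" where
  "matrix_radon \<Omega> \<mu> G \<longleftrightarrow> sets \<mu> = sets borel \<and> finite_measure \<mu> \<and> emeasure \<mu> (UNIV - \<Omega>) = 0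
      \<and> integrable \<mu> G"

definition tv_measure :: "(real^('d::finite)) measure \<Rightarrow> ((real^'d) \<Rightarrow> real^'d^'d) \<Rightarrow> (real^'d) set \<Rightarrow> ennreal" where
  "tv_measure \<mu> G B = (\<integral>\<^sup>+ x \<in> B. ennreal (norm (G x)) \<partial>\<mu>)"

definition tv_negligible :: "(real^('d::finite)) measure \<Rightarrow> ((real^'d) \<Rightarrow> real^'d^'d) \<Rightarrow> (real^'d) set \<Rightarrow> bool" where
  "tv_negligible \<mu> G N \<longleftrightarrow> (\<exists>B \<in> sets borel. N \<subseteq> B \<and> tv_measure \<mu> G B = 0)"

definition is_antisym_grad :: "(real^('d::finite)) set \<Rightarrow> ((real^'d) \<Rightarrow> (real^'d))
     \<Rightarrow> (real^'d) measure \<Rightarrow> ((real^'d) \<Rightarrow> real^'d^'d) \<Rightarrow> bool" where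
  "is_antisym_grad \<Omega> w \<mu> G \<longleftrightarrow>
     (\<forall>\<phi>. test_fun \<Omega> \<phi> \<longrightarrow> (\<forall>i j.
        (\<integral>x. \<phi> x * G x $ i $ j \<partial>\<mu>)
        = - (\<integral>x \<in> \<Omega>. w x $ i * dsp j \<phi> x - w x $ j * dsp i \<phi> x \<partial>lebesgue)))"

definition admits_blowup :: "('a::euclidean_space \<Rightarrow> 'b::euclidean_space) \<Rightarrow> 'a \<Rightarrow> bool" where
  "admits_blowup w x0 \<longleftrightarrow>
     (\<exists>v. set_integrable lborel (ball 0 1) v \<and>
        ((\<lambda>l. \<integral>\<^sup>+ z \<in> ball 0 1. ennreal (norm (w (x0 + l *\<^sub>R z) - v z)) \<partial>lborel) \<longlongrightarrow> 0) (at_right 0))"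

definition no_blowup_set :: "'a::euclidean_space set \<Rightarrow> ('a \<Rightarrow> 'b::euclidean_space) \<Rightarrow> 'a set" where
  "no_blowup_set \<Omega> w = {x0 \<in> \<Omega>. \<not> admits_blowup w x0}"

end

theory Submission
  imports Defs
begin

text \<open>
  For a divergence-free field the nonlinearity satisfies, formally,
  \<open>div (u \<otimes> u) = (\<Lambda>u) u + \<nabla>(|u|\<^sup>2 / 2)\<close>. Mollifying with an even kernel and moving both
  mollifications onto \<open>u\<close>, the term \<open>(\<Lambda>u) u\<close> is identified on almost every time slice as the measure
  \<open>(\<Lambda>u) V\<close>, where \<open>V\<close> is the pointwise limit of the doubly mollified velocity; this limit exists
  at every blow-up point, hence \<open>|\<Lambda>u|\<close>-almost everywhere. Testing the mollified equation with the
  mollified velocity itself, the only term that could survive in the limit is the integral of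
  \<open>\<psi> V \<cdot> (\<Lambda>u) V\<close>, built with the same double mollification \<open>V\<close>, and it vanishes because \<open>\<Lambda>u\<close> is
  antisymmetric. The passage to the limit in time is dominated by the total variation of \<open>\<Lambda>u\<close>.
\<close>

section \<open>Continuity of translations in the mean\<close>

text \<open>The obstacle is that \<open>\<Lambda>u\<close> may be singular with respect to Lebesgue
  measure, so that its product with \<open>u\<close>, a class of functions modulo Lebesgue null
  sets, has no direct meaning. A blow up supplies a value, but its profile need not be constant, and
  what a mollification sees of it depends on the kernel. The cancellation rests on both copies of
  \<open>V\<close> coming from the same kernel, the convolution of the mollifier with itself. The
  information on \<open>\<Lambda>u\<close> is given slice by slice, with no regularity in time,
  whereas the equation has to be mollified in time as well before it can be tested with the
  velocity. Hence two independent scales: the time scale tends to zero at a fixed spatial scale,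
  which leaves a defect that lives on slices, and a diagonal choice recombines the two limits. Only
  one test function is considered at a time, so the domain can be cut to a bounded one, on which the
  bounded velocity is integrable.\<close>

lemma nn_integral_lborel_affine:
  fixes c :: real and t :: "'a::euclidean_space"
  assumes "c \<noteq> 0" and [measurable]: "f \<in> borel_measurable borel"
  shows "(\<integral>\<^sup>+x. f x \<partial>lborel) = ennreal (\<bar>c\<bar> ^ DIM('a)) * (\<integral>\<^sup>+x. f (t + c *\<^sub>R x) \<partial>lborel)"
  by (subst lborel_affine[OF assms(1), of t])
     (simp add: nn_integral_density nn_integral_distr nn_integral_cmult)

lemma integrable_lborel_affine_iff:
  fixes c :: real and t :: "'a::euclidean_space" and f :: "'a \<Rightarrow> real"
  assumes "c \<noteq> 0" and [measurable]: "f \<in> borel_measurable borel"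
  shows "integrable lborel (\<lambda>x. f (t + c *\<^sub>R x)) \<longleftrightarrow> integrable lborel f"
proof -
  have "integrable lborel f \<longleftrightarrow> integrable (density (distr lborel borel (\<lambda>x. t + c *\<^sub>R x)) (\<lambda>_. ennreal (\<bar>c\<bar> ^ DIM('a)))) f"
    by (subst lborel_affine[OF assms(1), of t]) simp
  also have "\<dots> \<longleftrightarrow> integrable lborel (\<lambda>x. f (t + c *\<^sub>R x))"
    using assms(1) by (simp add: integrable_density integrable_distr_eq)
  finally show ?thesis by simp
qed

lemma integral_lborel_affine:
  fixes c :: real and t :: "'a::euclidean_space" and f :: "'a \<Rightarrow> real"
  assumes "c \<noteq> 0" and [measurable]: "f \<in> borel_measurable borel"
  shows "(\<integral>x. f x \<partial>lborel) = \<bar>c\<bar> ^ DIM('a) * (\<integral>x. f (t + c *\<^sub>R x) \<partial>lborel)"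
  by (subst lborel_affine[OF assms(1), of t])
     (simp add: integral_density integral_distr)

lemma integral_lborel_shift:
  fixes t :: "'a::euclidean_space" and f :: "'a \<Rightarrow> real"
  assumes "f \<in> borel_measurable borel"
  shows "(\<integral>x. f (x + t) \<partial>lborel) = (\<integral>x. f x \<partial>lborel)"
  using integral_lborel_affine[of 1 f t] assms by (simp add: add.commute)

lemma integral_lborel_reflect:
  fixes t :: "'a::euclidean_space" and f :: "'a \<Rightarrow> real"
  assumes "f \<in> borel_measurable borel"
  shows "(\<integral>x. f (t - x) \<partial>lborel) = (\<integral>x. f x \<partial>lborel)"
  using integral_lborel_affine[of "-1" f t] assms by simp

lemma integrable_lborel_shift:
  fixes t :: "'a::euclidean_space" and f :: "'a \<Rightarrow> real"
  assumes "integrable lborel f"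
  shows "integrable lborel (\<lambda>x. f (x + t))" "integrable lborel (\<lambda>x. f (t - x))" "integrable lborel (\<lambda>x. f (x - t))"
proof -
  have [measurable]: "f \<in> borel_measurable borel" using assms by auto
  show "integrable lborel (\<lambda>x. f (x + t))"
    using integrable_lborel_affine_iff[of 1 f t] assms by (simp add: add.commute)
  show "integrable lborel (\<lambda>x. f (t - x))"
    using integrable_lborel_affine_iff[of "-1" f t] assms by simp
  show "integrable lborel (\<lambda>x. f (x - t))"
    using integrable_lborel_affine_iff[of 1 f "-t"] assms by simp
qed

text \<open>Continuity of translations passes to L1 limits: of the three terms of the triangle
  inequality, the two outer ones are the same integral by translation invariance. It serves twice,
  from open to measurable sets and from simple to integrable functions.\<close>

lemma L1_translation_approx:
  fixes f :: "'a::euclidean_space \<Rightarrow> real"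
  assumes f: "integrable lborel f"
    and ap: "\<And>e. e > 0 \<Longrightarrow> \<exists>g. integrable lborel g \<and> (\<integral>z. \<bar>f z - g z\<bar> \<partial>lborel) \<le> e
        \<and> (\<lambda>n. \<integral>z. \<bar>g (z - h n) - g z\<bar> \<partial>lborel) \<longlonglongrightarrow> 0"
  shows "(\<lambda>n. \<integral>z. \<bar>f (z - h n) - f z\<bar> \<partial>lborel) \<longlonglongrightarrow> 0"
proof (rule LIMSEQ_I)
  fix r :: real assume "r > 0"
  then obtain g where g: "integrable lborel g" "(\<integral>z. \<bar>f z - g z\<bar> \<partial>lborel) \<le> r/4"
      and gt: "(\<lambda>n. \<integral>z. \<bar>g (z - h n) - g z\<bar> \<partial>lborel) \<longlonglongrightarrow> 0"
    using ap[of "r/4"] by auto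
  obtain N where N: "\<And>n. n \<ge> N \<Longrightarrow> \<bar>\<integral>z. \<bar>g (z - h n) - g z\<bar> \<partial>lborel\<bar> < r/4"
    using LIMSEQ_D[OF gt, of "r/4"] \<open>r > 0\<close> by auto
  have [measurable]: "f \<in> borel_measurable borel" "g \<in> borel_measurable borel" using f g by auto
  have "\<bar>\<integral>z. \<bar>f (z - h n) - f z\<bar> \<partial>lborel\<bar> < r" if "n \<ge> N" for n
  proof -
    have i: "integrable lborel (\<lambda>z. f (z - h n))" "integrable lborel (\<lambda>z. g (z - h n))"
      using integrable_lborel_shift f g by auto
    have "(\<integral>z. \<bar>f (z - h n) - f z\<bar> \<partial>lborel) \<le>
       (\<integral>z. \<bar>f (z - h n) - g (z - h n)\<bar> + \<bar>g (z - h n) - g z\<bar> + \<bar>f z - g z\<bar> \<partial>lborel)"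
      by (intro integral_mono Bochner_Integration.integrable_add integrable_abs Bochner_Integration.integrable_diff i f g) auto
    also have "\<dots> = (\<integral>z. \<bar>f (z - h n) - g (z - h n)\<bar> \<partial>lborel) + (\<integral>z. \<bar>g (z - h n) - g z\<bar> \<partial>lborel) + (\<integral>z. \<bar>f z - g z\<bar> \<partial>lborel)"
      using i f g by simp
    also have "(\<integral>z. \<bar>f (z - h n) - g (z - h n)\<bar> \<partial>lborel) = (\<integral>z. \<bar>f z - g z\<bar> \<partial>lborel)"
      using integral_lborel_shift[of "\<lambda>z. \<bar>f z - g z\<bar>" "- h n"] by simp
    finally have le: "(\<integral>z. \<bar>f (z - h n) - f z\<bar> \<partial>lborel) \<le> (\<integral>z. \<bar>f z - g z\<bar> \<partial>lborel) + (\<integral>z. \<bar>g (z - h n) - g z\<bar> \<partial>lborel) + (\<integral>z. \<bar>f z - g z\<bar> \<partial>lborel)" .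
    have "0 \<le> (\<integral>z. \<bar>f (z - h n) - f z\<bar> \<partial>lborel)" by (rule Bochner_Integration.integral_nonneg) simp
    with le g(2) N[OF that] \<open>r > 0\<close> show ?thesis by linarith
  qed
  then show "\<exists>no. \<forall>n\<ge>no. norm ((\<integral>z. \<bar>f (z - h n) - f z\<bar> \<partial>lborel) - 0) < r"
    by auto
qed

text \<open>Translation invariance makes the two one-sided differences of \<open>U\<close> and its
  translate equally large, so only the points of \<open>U\<close> missing from the translate have to
  be measured. As \<open>U\<close> is open, each of its points belongs to the translate once the
  shift is small.\<close>

lemma L1_translation_open:
  fixes U :: "'a::euclidean_space set"
  assumes U: "open U" "emeasure lborel U < \<infinity>" and h: "h \<longlonglongrightarrow> 0"
  shows "(\<lambda>n. \<integral>z. \<bar>indicator U (z - h n) - indicator U z\<bar> \<partial>lborel) \<longlonglongrightarrow> (0::real)"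
proof -
  let ?I = "indicator U :: 'a \<Rightarrow> real"
  have [measurable]: "U \<in> sets borel" using U by auto
  have iU: "integrable lborel ?I" using U by (simp add: integrable_indicator_iff)
  have iUs: "integrable lborel (\<lambda>z. ?I (z - a))" for a using integrable_lborel_shift[OF iU] by auto
  have ip: "integrable lborel (\<lambda>z. ?I z * ?I (z - a))" for a
    by (rule Bochner_Integration.integrable_bound[OF iU]) (auto simp: indicator_def)
  have eq: "(\<integral>z. \<bar>?I (z - a) - ?I z\<bar> \<partial>lborel) = 2 * (\<integral>z. ?I z * (1 - ?I (z - a)) \<partial>lborel)" for a
  proof -
    have "(\<integral>z. \<bar>?I (z - a) - ?I z\<bar> \<partial>lborel) = (\<integral>z. ?I (z - a) + ?I z - 2 * (?I z * ?I (z - a)) \<partial>lborel)"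
      by (rule Bochner_Integration.integral_cong) (auto simp: indicator_def)
    also have "\<dots> = (\<integral>z. ?I (z - a) \<partial>lborel) + (\<integral>z. ?I z \<partial>lborel) - 2 * (\<integral>z. ?I z * ?I (z - a) \<partial>lborel)"
      using iU iUs ip by simp
    also have "(\<integral>z. ?I (z - a) \<partial>lborel) = (\<integral>z. ?I z \<partial>lborel)"
      using integral_lborel_shift[of ?I "-a"] by simp
    finally have "(\<integral>z. \<bar>?I (z - a) - ?I z\<bar> \<partial>lborel) = 2 * ((\<integral>z. ?I z \<partial>lborel) - (\<integral>z. ?I z * ?I (z - a) \<partial>lborel))"
      by simp
    also have "(\<integral>z. ?I z \<partial>lborel) - (\<integral>z. ?I z * ?I (z - a) \<partial>lborel) = (\<integral>z. ?I z - ?I z * ?I (z - a) \<partial>lborel)"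
      using iU ip by simp
    finally show ?thesis by (simp add: algebra_simps)
  qed
  have "(\<lambda>n. \<integral>z. ?I z * (1 - ?I (z - h n)) \<partial>lborel) \<longlonglongrightarrow> (\<integral>z. 0 \<partial>(lborel :: 'a measure))"
  proof (rule integral_dominated_convergence[where w="?I"])
    show "AE z in lborel. (\<lambda>n. ?I z * (1 - ?I (z - h n))) \<longlonglongrightarrow> 0"
    proof (rule AE_I2)
      fix z :: 'a
      show "(\<lambda>n. ?I z * (1 - ?I (z - h n))) \<longlonglongrightarrow> 0"
      proof (cases "z \<in> U")
        case True
        have "(\<lambda>n. z - h n) \<longlonglongrightarrow> z - 0" by (intro tendsto_intros h)
        then have "eventually (\<lambda>n. z - h n \<in> U) sequentially"
          using U(1) True by (metis diff_zero topological_tendstoD)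
        then have "eventually (\<lambda>n. ?I z * (1 - ?I (z - h n)) = 0) sequentially"
          by eventually_elim simp
        then show ?thesis by (simp add: tendsto_eventually)
      qed simp
    qed
  qed (auto simp: iU indicator_def)
  then show ?thesis unfolding eq by (simp add: tendsto_mult_right_zero)
qed

lemma L1_translation:
  fixes f :: "'a::euclidean_space \<Rightarrow> real"
  assumes f: "integrable lborel f" and h: "h \<longlonglongrightarrow> 0"
  shows "(\<lambda>n. \<integral>z. \<bar>f (z - h n) - f z\<bar> \<partial>lborel) \<longlonglongrightarrow> 0"
  using f
proof (induction rule: integrable_induct)
  case (base A c)
  have A: "A \<in> sets borel" "emeasure lborel A < \<infinity>" using base by auto
  note [measurable] = A(1)
  have iA: "integrable lborel (indicator A :: 'a \<Rightarrow> real)"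
    using A by (simp add: integrable_indicator_iff)
  have "(\<lambda>n. \<integral>z. \<bar>indicator A (z - h n) - indicator A z\<bar> \<partial>lborel) \<longlonglongrightarrow> (0::real)"
  proof (rule L1_translation_approx[OF iA])
    fix e :: real assume "e > 0"
    \<comment> \<open>Outer regularity brings in open sets, for which the pointwise argument is
      available.\<close>
    obtain U where U: "open U" "A \<subseteq> U" "emeasure lborel (U - A) < ennreal e"
      using outer_regular_lborel[OF A(1) \<open>e > 0\<close>] by auto
    note [measurable] = borel_open[OF U(1)]
    have "emeasure lborel U \<le> emeasure lborel A + emeasure lborel (U - A)"
      using U(2) A(1) emeasure_subadditive[of A lborel "U - A"] by (simp add: Un_absorb1)
    also have "\<dots> < \<infinity>" using A(2) U(3) by (simp add: ennreal_add_less_top) (meson ennreal_less_top order_less_trans)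
    finally have fU: "emeasure lborel U < \<infinity>" .
    have "(\<integral>z. \<bar>indicator A z - indicator U z\<bar> \<partial>lborel) = (\<integral>z. indicator (U - A) z \<partial>(lborel::'a measure) :: real)"
      using U(2) by (intro Bochner_Integration.integral_cong) (auto simp: indicator_def)
    also have "\<dots> = measure lborel (U - A)" by simp
    also have "\<dots> \<le> e" using U(3) \<open>e > 0\<close>
      by (metis enn2real_leI less_le measure_def)
    finally show "\<exists>g. integrable lborel g \<and> (\<integral>z. \<bar>indicator A z - g z\<bar> \<partial>lborel) \<le> e
        \<and> (\<lambda>n. \<integral>z. \<bar>g (z - h n) - g z\<bar> \<partial>lborel) \<longlonglongrightarrow> 0"
      using L1_translation_open[OF U(1) fU h] fU
      by (intro exI[of _ "indicator U"]) (auto simp: integrable_indicator_iff)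
  qed
  then have "(\<lambda>n. \<bar>c\<bar> * (\<integral>z. \<bar>indicator A (z - h n) - indicator A z\<bar> \<partial>lborel)) \<longlonglongrightarrow> \<bar>c\<bar> * 0"
    by (intro tendsto_intros)
  also have "(\<lambda>n. \<bar>c\<bar> * (\<integral>z. \<bar>indicator A (z - h n) - indicator A z\<bar> \<partial>(lborel::'a measure)))
      = (\<lambda>n. \<integral>z. \<bar>indicator A (z - h n) *\<^sub>R c - indicator A z *\<^sub>R c\<bar> \<partial>lborel)"
    by (simp flip: integral_mult_right_zero abs_mult add: algebra_simps)
  finally show ?case by simp
next
  case (add f g)
  have i: "integrable lborel (\<lambda>z. f (z - h n))" "integrable lborel (\<lambda>z. g (z - h n))" for n
    using integrable_lborel_shift(3)[OF add.hyps(1)] integrable_lborel_shift(3)[OF add.hyps(2)] by auto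
  show ?case
  proof (rule tendsto_sandwich[where f="\<lambda>_. 0"])
    show "(\<lambda>n. (\<integral>z. \<bar>f (z - h n) - f z\<bar> \<partial>lborel) + (\<integral>z. \<bar>g (z - h n) - g z\<bar> \<partial>lborel)) \<longlonglongrightarrow> 0"
      using tendsto_add[OF add.IH] by simp
    show "\<forall>\<^sub>F n in sequentially. (\<integral>z. \<bar>f (z - h n) + g (z - h n) - (f z + g z)\<bar> \<partial>lborel) \<le> (\<integral>z. \<bar>f (z - h n) - f z\<bar> \<partial>lborel) + (\<integral>z. \<bar>g (z - h n) - g z\<bar> \<partial>lborel)"
    proof (rule always_eventually, rule allI)
      fix n
      have "(\<integral>z. \<bar>f (z - h n) + g (z - h n) - (f z + g z)\<bar> \<partial>lborel) \<le> (\<integral>z. \<bar>f (z - h n) - f z\<bar> + \<bar>g (z - h n) - g z\<bar> \<partial>lborel)"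
        using i add.hyps by (intro integral_mono) auto
      then show "(\<integral>z. \<bar>f (z - h n) + g (z - h n) - (f z + g z)\<bar> \<partial>lborel) \<le> (\<integral>z. \<bar>f (z - h n) - f z\<bar> \<partial>lborel) + (\<integral>z. \<bar>g (z - h n) - g z\<bar> \<partial>lborel)"
        using i add.hyps by simp
    qed
  qed auto
next
  case (lim f s)
  have [measurable]: "f \<in> borel_measurable borel" "\<And>i. s i \<in> borel_measurable borel" using lim.hyps by auto
  show ?case
  proof (rule L1_translation_approx)
    show "integrable lborel f" by fact
    fix e :: real assume "e > 0"
    have "(\<lambda>i. \<integral>z. \<bar>f z - s i z\<bar> \<partial>lborel) \<longlonglongrightarrow> (\<integral>z. 0 \<partial>(lborel::'a measure))"
    proof (rule integral_dominated_convergence[where w="\<lambda>z. 3 * \<bar>f z\<bar>"])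
      show "AE z in lborel. (\<lambda>i. \<bar>f z - s i z\<bar>) \<longlonglongrightarrow> 0"
      proof (rule AE_I2)
        fix z :: 'a
        have "(\<lambda>i. \<bar>f z - s i z\<bar>) \<longlonglongrightarrow> \<bar>f z - f z\<bar>"
          using lim.hyps(2)[of z] by (intro tendsto_intros) auto
        then show "(\<lambda>i. \<bar>f z - s i z\<bar>) \<longlonglongrightarrow> 0" by simp
      qed
      show "AE z in lborel. norm \<bar>f z - s i z\<bar> \<le> 3 * \<bar>f z\<bar>" for i
      proof (rule AE_I2)
        fix z :: 'a
        show "norm \<bar>f z - s i z\<bar> \<le> 3 * \<bar>f z\<bar>" using lim.hyps(3)[of z i] by simp
      qed
    qed (use lim.hyps in auto)
    then obtain i where "\<bar>\<integral>z. \<bar>f z - s i z\<bar> \<partial>lborel\<bar> < e"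
      using LIMSEQ_D[of _ 0 e] \<open>e > 0\<close> by fastforce
    then show "\<exists>g. integrable lborel g \<and> (\<integral>z. \<bar>f z - g z\<bar> \<partial>lborel) \<le> e
        \<and> (\<lambda>n. \<integral>z. \<bar>g (z - h n) - g z\<bar> \<partial>lborel) \<longlonglongrightarrow> 0"
      using lim.hyps(1) lim.IH by (intro exI[of _ "s i"]) auto
  qed
qed

text \<open>The sequential statement is turned into a modulus of continuity by contradiction: an
  average over shifts needs one bound for all shifts of a given size.\<close>

lemma L1_translation_uniform:
  fixes f :: "'a::euclidean_space \<Rightarrow> real"
  assumes f: "integrable lborel f" and "e > 0"
  obtains d where "d > 0" "\<And>h. norm h \<le> d \<Longrightarrow> (\<integral>z. \<bar>f (z - h) - f z\<bar> \<partial>lborel) \<le> e"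
proof -
  have "\<exists>d>0. \<forall>h. norm h \<le> d \<longrightarrow> (\<integral>z. \<bar>f (z - h) - f z\<bar> \<partial>lborel) \<le> e"
  proof (rule ccontr)
    assume a: "\<not> ?thesis"
    have "\<exists>h. norm h \<le> inverse (real (Suc n)) \<and> \<not> (\<integral>z. \<bar>f (z - h) - f z\<bar> \<partial>lborel) \<le> e" for n
    proof -
      have "0 < inverse (real (Suc n))" by simp
      then show ?thesis using a by blast
    qed
    then obtain h where h: "\<And>n. norm (h n) \<le> inverse (real (Suc n))"
        "\<And>n. \<not> (\<integral>z. \<bar>f (z - h n) - f z\<bar> \<partial>lborel) \<le> e" by metis
    have "h \<longlonglongrightarrow> 0"
      by (rule Lim_null_comparison[OF _ LIMSEQ_inverse_real_of_nat]) (use h(1) in auto)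
    from L1_translation[OF f this] obtain n where "\<bar>\<integral>z. \<bar>f (z - h n) - f z\<bar> \<partial>lborel\<bar> < e"
      using LIMSEQ_D[of _ 0 e] \<open>e > 0\<close> by fastforce
    then show False using h(2)[of n] by simp
  qed
  then show ?thesis using that by blast
qed

section \<open>Convolution and directional derivatives\<close>

text \<open>Integrability is part of the notion because the Bochner integral of a non-integrable
  function is 0, so small integrals alone would say nothing.\<close>

definition L1_tendsto :: "'a measure \<Rightarrow> (nat \<Rightarrow> 'a \<Rightarrow> real) \<Rightarrow> ('a \<Rightarrow> real) \<Rightarrow> bool" where
  "L1_tendsto M f g \<longleftrightarrow> (\<forall>n. integrable M (f n)) \<and> integrable M g \<and> (\<lambda>n. \<integral>z. \<bar>f n z - g z\<bar> \<partial>M) \<longlonglongrightarrow> 0"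

lemma integral_abs_le:
  fixes f g :: "'a \<Rightarrow> real"
  assumes "integrable M f" "integrable M g" "\<And>x. \<bar>f x\<bar> \<le> g x"
  shows "\<bar>\<integral>x. f x \<partial>M\<bar> \<le> (\<integral>x. g x \<partial>M)"
  by (rule order.trans[OF integral_abs_bound integral_mono[OF integrable_abs[OF assms(1)] assms(2,3)]])

text \<open>\<open>b\<close> converges only in mean, so there is no pointwise limit to dominate.
  Below the level \<open>m\<close> the factor \<open>\<bar>a z\<bar>\<close> is bounded and
  convergence in mean suffices; above it the difference is at most \<open>2 * C\<close> and the tail
  of \<open>a\<close> is small uniformly in \<open>n\<close>.\<close>

lemma L1_tendsto_mult_bounded_zero:
  fixes a :: "'a \<Rightarrow> real"
  assumes a: "integrable M a" and b: "L1_tendsto M b b0"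
    and C: "\<And>n z. \<bar>b n z\<bar> \<le> C" "\<And>z. \<bar>b0 z\<bar> \<le> C"
  shows "(\<lambda>n. \<integral>z. \<bar>a z\<bar> * \<bar>b n z - b0 z\<bar> \<partial>M) \<longlonglongrightarrow> 0"
proof -
  have bi: "integrable M (\<lambda>z. \<bar>b n z - b0 z\<bar>)" for n
    using b by (auto simp: L1_tendsto_def)
  have [measurable]: "a \<in> borel_measurable M" "\<And>n. b n \<in> borel_measurable M" "b0 \<in> borel_measurable M"
    using a b by (auto simp: L1_tendsto_def)
  have diff: "\<bar>b n z - b0 z\<bar> \<le> 2 * C" for n z
    using C(1)[of n z] C(2)[of z] by linarith
  define tail where "tail m = (\<integral>z. \<bar>a z\<bar> - min \<bar>a z\<bar> (real m) \<partial>M)" for m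
  have tail_int: "integrable M (\<lambda>z. \<bar>a z\<bar> - min \<bar>a z\<bar> (real m))" for m
    by (rule Bochner_Integration.integrable_bound[OF integrable_abs[OF a]]) auto
  have "tail \<longlonglongrightarrow> (\<integral>z. 0 \<partial>M)"
    unfolding tail_def
  proof (rule integral_dominated_convergence[where w="\<lambda>z. \<bar>a z\<bar>"])
    show "AE z in M. (\<lambda>m. \<bar>a z\<bar> - min \<bar>a z\<bar> (real m)) \<longlonglongrightarrow> 0"
    proof (rule AE_I2)
      fix z
      obtain m0 where "\<bar>a z\<bar> \<le> real m0" using real_arch_simple by blast
      then have "eventually (\<lambda>m. \<bar>a z\<bar> - min \<bar>a z\<bar> (real m) = 0) sequentially"
        by (intro eventually_sequentiallyI[of m0]) auto
      then show "(\<lambda>m. \<bar>a z\<bar> - min \<bar>a z\<bar> (real m)) \<longlonglongrightarrow> 0" by (rule tendsto_eventually)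
    qed
  qed (use a in auto)
  then have tail0: "tail \<longlonglongrightarrow> 0" by simp
  have bound: "(\<integral>z. \<bar>a z\<bar> * \<bar>b n z - b0 z\<bar> \<partial>M) \<le> real m * (\<integral>z. \<bar>b n z - b0 z\<bar> \<partial>M) + 2 * C * tail m" for n m
  proof -
    have "(\<integral>z. \<bar>a z\<bar> * \<bar>b n z - b0 z\<bar> \<partial>M) \<le>
       (\<integral>z. real m * \<bar>b n z - b0 z\<bar> + 2 * C * (\<bar>a z\<bar> - min \<bar>a z\<bar> (real m)) \<partial>M)"
    proof (rule integral_mono)
      show "integrable M (\<lambda>z. \<bar>a z\<bar> * \<bar>b n z - b0 z\<bar>)"
      proof (rule Bochner_Integration.integrable_bound[of _ "\<lambda>z. \<bar>a z\<bar> * (2 * C)"])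
        show "integrable M (\<lambda>z. \<bar>a z\<bar> * (2 * C))" using a by simp
        show "AE z in M. norm (\<bar>a z\<bar> * \<bar>b n z - b0 z\<bar>) \<le> norm (\<bar>a z\<bar> * (2 * C))"
          using diff by (intro AE_I2) (auto simp: abs_mult intro!: mult_left_mono order.trans[OF diff])
      qed measurable
      show "integrable M (\<lambda>z. real m * \<bar>b n z - b0 z\<bar> + 2 * C * (\<bar>a z\<bar> - min \<bar>a z\<bar> (real m)))"
        using bi tail_int by simp
      fix z
      have "\<bar>a z\<bar> * \<bar>b n z - b0 z\<bar> = min \<bar>a z\<bar> (real m) * \<bar>b n z - b0 z\<bar> + (\<bar>a z\<bar> - min \<bar>a z\<bar> (real m)) * \<bar>b n z - b0 z\<bar>"
        by (simp add: algebra_simps)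
      also have "\<dots> \<le> real m * \<bar>b n z - b0 z\<bar> + (\<bar>a z\<bar> - min \<bar>a z\<bar> (real m)) * (2 * C)"
        using diff[of n z] by (intro add_mono mult_right_mono mult_left_mono) auto
      finally show "\<bar>a z\<bar> * \<bar>b n z - b0 z\<bar> \<le> real m * \<bar>b n z - b0 z\<bar> + 2 * C * (\<bar>a z\<bar> - min \<bar>a z\<bar> (real m))"
        by (simp add: mult.commute)
    qed
    also have "\<dots> = real m * (\<integral>z. \<bar>b n z - b0 z\<bar> \<partial>M) + 2 * C * tail m"
      unfolding tail_def using bi tail_int by simp
    finally show ?thesis .
  qed
  show ?thesis
  proof (rule LIMSEQ_I)
    fix r :: real assume "r > 0"
    have "(\<lambda>m. 2 * C * tail m) \<longlonglongrightarrow> 2 * C * 0" by (intro tendsto_intros tail0)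
    then obtain m where m: "\<bar>2 * C * tail m\<bar> < r / 2"
      using LIMSEQ_D[of "\<lambda>m. 2 * C * tail m" 0 "r/2"] \<open>r > 0\<close> by fastforce
    have "(\<lambda>n. real m * (\<integral>z. \<bar>b n z - b0 z\<bar> \<partial>M)) \<longlonglongrightarrow> real m * 0"
      using b by (intro tendsto_intros) (auto simp: L1_tendsto_def)
    then obtain N where N: "\<And>n. n \<ge> N \<Longrightarrow> \<bar>real m * (\<integral>z. \<bar>b n z - b0 z\<bar> \<partial>M)\<bar> < r / 2"
      using LIMSEQ_D[of "\<lambda>n. real m * (\<integral>z. \<bar>b n z - b0 z\<bar> \<partial>M)" 0 "r/2"] \<open>r > 0\<close> by fastforce
    have "\<bar>\<integral>z. \<bar>a z\<bar> * \<bar>b n z - b0 z\<bar> \<partial>M\<bar> < r" if "n \<ge> N" for n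
    proof -
      have "0 \<le> (\<integral>z. \<bar>a z\<bar> * \<bar>b n z - b0 z\<bar> \<partial>M)" by (rule Bochner_Integration.integral_nonneg) simp
      then show ?thesis using bound[of n m] N[OF that] m by linarith
    qed
    then show "\<exists>no. \<forall>n\<ge>no. norm ((\<integral>z. \<bar>a z\<bar> * \<bar>b n z - b0 z\<bar> \<partial>M) - 0) < r" by auto
  qed
qed

lemma integrable_mult_bounded:
  fixes a b :: "'a \<Rightarrow> real"
  assumes "integrable M a" "b \<in> borel_measurable M" "\<And>z. \<bar>b z\<bar> \<le> C"
  shows "integrable M (\<lambda>z. a z * b z)" "integrable M (\<lambda>z. b z * a z)"
proof -
  have [measurable]: "a \<in> borel_measurable M" "b \<in> borel_measurable M" using assms by auto
  show 1: "integrable M (\<lambda>z. a z * b z)"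
  proof (rule Bochner_Integration.integrable_bound[of _ "\<lambda>z. \<bar>a z\<bar> * C"])
    show "integrable M (\<lambda>z. \<bar>a z\<bar> * C)" using assms by simp
    show "AE z in M. norm (a z * b z) \<le> norm (\<bar>a z\<bar> * C)"
      using assms(3) by (intro AE_I2) (auto simp: abs_mult intro!: mult_left_mono order.trans[OF assms(3)])
  qed measurable
  then show "integrable M (\<lambda>z. b z * a z)" by (simp add: mult.commute)
qed

text \<open>The difference splits into \<open>b n\<close> times the error of \<open>a n\<close>,
  plus \<open>a0\<close> times the error of \<open>b n\<close>. The limits of quadratic terms below
  all have this form, with a bounded velocity component as the second factor.\<close>

lemma L1_tendsto_integral_mult:
  assumes a: "L1_tendsto M a a0" and b: "L1_tendsto M b b0"
    and C: "\<And>n z. \<bar>b n z\<bar> \<le> C" "\<And>z. \<bar>b0 z\<bar> \<le> C"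
    and [measurable]: "\<phi> \<in> borel_measurable M" and B: "\<And>z. \<bar>\<phi> z\<bar> \<le> B"
  shows "(\<lambda>n. \<integral>z. \<phi> z * (a n z * b n z) \<partial>M) \<longlonglongrightarrow> (\<integral>z. \<phi> z * (a0 z * b0 z) \<partial>M)"
proof -
  have ai: "integrable M (a n)" "integrable M a0" for n using a by (auto simp: L1_tendsto_def)
  have bm[measurable]: "b n \<in> borel_measurable M" "b0 \<in> borel_measurable M" for n
    using b by (auto simp: L1_tendsto_def)
  have p1: "integrable M (\<lambda>z. a n z * b n z)" for n by (rule integrable_mult_bounded[OF ai(1) bm(1) C(1)])
  have p2: "integrable M (\<lambda>z. a0 z * b0 z)" by (rule integrable_mult_bounded[OF ai(2) bm(2) C(2)])
  have p3: "integrable M (\<lambda>z. \<phi> z * (a n z * b n z))" for n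
    by (rule integrable_mult_bounded(2)[OF p1 _ B]) measurable
  have p4: "integrable M (\<lambda>z. \<phi> z * (a0 z * b0 z))"
    by (rule integrable_mult_bounded(2)[OF p2 _ B]) measurable
  have p5: "integrable M (\<lambda>z. \<bar>a n z - a0 z\<bar>)" for n using ai by simp
  have p6: "integrable M (\<lambda>z. \<bar>a0 z\<bar> * \<bar>b n z - b0 z\<bar>)" for n
  proof -
    have "\<bar>\<bar>b n z - b0 z\<bar>\<bar> \<le> 2 * C" for z using C(1)[of n z] C(2)[of z] by linarith
    then show ?thesis using ai by (intro integrable_mult_bounded(1)[where C="2*C"]) auto
  qed
  have key: "\<bar>(\<integral>z. \<phi> z * (a n z * b n z) \<partial>M) - (\<integral>z. \<phi> z * (a0 z * b0 z) \<partial>M)\<bar>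
     \<le> B * C * (\<integral>z. \<bar>a n z - a0 z\<bar> \<partial>M) + B * (\<integral>z. \<bar>a0 z\<bar> * \<bar>b n z - b0 z\<bar> \<partial>M)" for n
  proof -
    have "\<bar>(\<integral>z. \<phi> z * (a n z * b n z) \<partial>M) - (\<integral>z. \<phi> z * (a0 z * b0 z) \<partial>M)\<bar>
       = \<bar>\<integral>z. \<phi> z * (a n z * b n z) - \<phi> z * (a0 z * b0 z) \<partial>M\<bar>"
      using p3 p4 by simp
    also have "\<dots> \<le> (\<integral>z. B * C * \<bar>a n z - a0 z\<bar> + B * (\<bar>a0 z\<bar> * \<bar>b n z - b0 z\<bar>) \<partial>M)"
    proof (rule integral_abs_le)
      fix z
      have e: "\<phi> z * (a n z * b n z) - \<phi> z * (a0 z * b0 z) = \<phi> z * (b n z * (a n z - a0 z)) + \<phi> z * (a0 z * (b n z - b0 z))"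
        by (simp add: algebra_simps)
      have B0: "B \<ge> 0" using B[of z] by linarith
      have "\<bar>\<phi> z * (a n z * b n z) - \<phi> z * (a0 z * b0 z)\<bar> \<le> \<bar>\<phi> z\<bar> * (\<bar>b n z\<bar> * \<bar>a n z - a0 z\<bar>) + \<bar>\<phi> z\<bar> * (\<bar>a0 z\<bar> * \<bar>b n z - b0 z\<bar>)"
        unfolding e by (simp flip: abs_mult)
      also have "\<dots> \<le> B * (C * \<bar>a n z - a0 z\<bar>) + B * (\<bar>a0 z\<bar> * \<bar>b n z - b0 z\<bar>)"
        using B C(1)[of n z] B0 by (intro add_mono mult_mono mult_right_mono) auto
      finally show "\<bar>\<phi> z * (a n z * b n z) - \<phi> z * (a0 z * b0 z)\<bar> \<le> B * C * \<bar>a n z - a0 z\<bar> + B * (\<bar>a0 z\<bar> * \<bar>b n z - b0 z\<bar>)"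
        by (simp add: mult.assoc)
    qed (use p3 p4 p5 p6 in auto)
    also have "\<dots> = B * C * (\<integral>z. \<bar>a n z - a0 z\<bar> \<partial>M) + B * (\<integral>z. \<bar>a0 z\<bar> * \<bar>b n z - b0 z\<bar> \<partial>M)"
      using p5 p6 by simp
    finally show ?thesis .
  qed
  have "(\<lambda>n. B * C * (\<integral>z. \<bar>a n z - a0 z\<bar> \<partial>M) + B * (\<integral>z. \<bar>a0 z\<bar> * \<bar>b n z - b0 z\<bar> \<partial>M)) \<longlonglongrightarrow> B * C * 0 + B * 0"
    using a L1_tendsto_mult_bounded_zero[OF ai(2) b C] by (intro tendsto_intros) (auto simp: L1_tendsto_def)
  then have lim: "(\<lambda>n. B * C * (\<integral>z. \<bar>a n z - a0 z\<bar> \<partial>M) + B * (\<integral>z. \<bar>a0 z\<bar> * \<bar>b n z - b0 z\<bar> \<partial>M)) \<longlonglongrightarrow> 0"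
    by (simp only: mult_zero_right add_0)
  have "\<forall>\<^sub>F n in sequentially. norm ((\<integral>z. \<phi> z * (a n z * b n z) \<partial>M) - (\<integral>z. \<phi> z * (a0 z * b0 z) \<partial>M))
      \<le> B * C * (\<integral>z. \<bar>a n z - a0 z\<bar> \<partial>M) + B * (\<integral>z. \<bar>a0 z\<bar> * \<bar>b n z - b0 z\<bar> \<partial>M)"
    unfolding real_norm_def by (intro always_eventually allI key)
  from Lim_null_comparison[OF this lim]
  have "(\<lambda>n. (\<integral>z. \<phi> z * (a n z * b n z) \<partial>M) - (\<integral>z. \<phi> z * (a0 z * b0 z) \<partial>M)) \<longlonglongrightarrow> 0" .
  then show ?thesis by (simp add: LIM_zero_iff)
qed

text \<open>The map \<open>\<iota>\<close> places the averaging variable in the space of shifts: it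
  is the identity for a full mollification, \<open>(0, \<tau>)\<close> for one in time and
  \<open>(y, 0)\<close> for one in space, so that a single Fubini argument covers all three.\<close>

lemma integrable_shift_product:
  fixes g :: "'a::euclidean_space \<Rightarrow> real" and h :: "'b::euclidean_space \<Rightarrow> real"
  assumes g: "integrable lborel g" and h: "integrable lborel h" and i[measurable]: "\<iota> \<in> borel_measurable borel"
  shows "integrable (lborel \<Otimes>\<^sub>M lborel) (\<lambda>(\<tau>, z). g (z - \<iota> \<tau>) * h \<tau>)"
proof -
  have [measurable]: "g \<in> borel_measurable borel" "h \<in> borel_measurable borel" using g h by auto
  have e: "(\<integral>z. norm (g (z - \<iota> \<tau>) * h \<tau>) \<partial>lborel) = (\<integral>z. \<bar>g z\<bar> \<partial>lborel) * \<bar>h \<tau>\<bar>" for \<tau>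
    using integral_lborel_shift[of "\<lambda>z. \<bar>g z\<bar>" "- \<iota> \<tau>"] by (simp add: abs_mult)
  show ?thesis
  proof (rule lborel_pair.Fubini_integrable)
    show "integrable lborel (\<lambda>\<tau>. \<integral>z. norm (case (\<tau>, z) of (\<tau>, z) \<Rightarrow> g (z - \<iota> \<tau>) * h \<tau>) \<partial>lborel)"
      using h unfolding prod.case e by simp
    show "AE \<tau> in lborel. integrable lborel (\<lambda>z. case (\<tau>, z) of (\<tau>, z) \<Rightarrow> g (z - \<iota> \<tau>) * h \<tau>)"
      using integrable_lborel_shift(3)[OF g] by simp
  qed measurable
qed

lemma integrable_average:
  fixes g :: "'a::euclidean_space \<Rightarrow> real" and h :: "'b::euclidean_space \<Rightarrow> real"
  assumes g: "integrable lborel g" and h: "integrable lborel h" and i[measurable]: "\<iota> \<in> borel_measurable borel"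
  shows "integrable lborel (\<lambda>z. \<integral>\<tau>. g (z - \<iota> \<tau>) * h \<tau> \<partial>lborel)"
proof -
  show ?thesis using lborel_pair.integrable_snd[OF integrable_shift_product[OF assms]] by simp
qed

text \<open>Minkowski's integral inequality: the distance in mean from an average of translates to
  \<open>g\<close> is at most the average of the distances, and only shifts with
  \<open>\<rho> \<tau> \<noteq> 0\<close> count.\<close>

lemma L1_average_diff_le:
  fixes g :: "'a::euclidean_space \<Rightarrow> real" and \<rho> :: "'b::euclidean_space \<Rightarrow> real"
  assumes g: "integrable lborel g" and i[measurable]: "\<iota> \<in> borel_measurable borel"
    and r: "\<And>\<tau>. \<rho> \<tau> \<ge> 0" "integrable lborel \<rho>" "(\<integral>\<tau>. \<rho> \<tau> \<partial>lborel) = 1"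
    and e: "\<And>\<tau>. \<rho> \<tau> \<noteq> 0 \<Longrightarrow> (\<integral>z. \<bar>g (z - \<iota> \<tau>) - g z\<bar> \<partial>lborel) \<le> e"
  shows "(\<integral>z. \<bar>(\<integral>\<tau>. g (z - \<iota> \<tau>) * \<rho> \<tau> \<partial>lborel) - g z\<bar> \<partial>lborel) \<le> e"
proof -
  have [measurable]: "g \<in> borel_measurable borel" "\<rho> \<in> borel_measurable borel" using g r by auto
  have p1: "integrable (lborel \<Otimes>\<^sub>M lborel) (\<lambda>(\<tau>, z). g (z - \<iota> \<tau>) * \<rho> \<tau>)"
    by (rule integrable_shift_product[OF g r(2) i])
  have p2: "integrable (lborel \<Otimes>\<^sub>M lborel) (\<lambda>(\<tau>, z). g z * \<rho> \<tau>)"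
    using integrable_shift_product[OF g r(2), of "\<lambda>_. 0"] by simp
  have p3: "integrable (lborel \<Otimes>\<^sub>M lborel) (\<lambda>(\<tau>, z). \<bar>g (z - \<iota> \<tau>) - g z\<bar> * \<rho> \<tau>)"
    using Bochner_Integration.integrable_diff[OF p1 p2, THEN integrable_abs]
    by (rule Bochner_Integration.integrable_bound) (auto simp: abs_mult r simp flip: left_diff_distrib)
  have a1: "AE z in lborel. integrable lborel (\<lambda>\<tau>. g (z - \<iota> \<tau>) * \<rho> \<tau>)"
    using lborel_pair.AE_integrable_snd[OF p1] by simp
  have "(\<integral>z. \<bar>(\<integral>\<tau>. g (z - \<iota> \<tau>) * \<rho> \<tau> \<partial>lborel) - g z\<bar> \<partial>lborel) \<le> (\<integral>z. (\<integral>\<tau>. \<bar>g (z - \<iota> \<tau>) - g z\<bar> * \<rho> \<tau> \<partial>lborel) \<partial>lborel)"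
  proof (rule integral_mono_AE)
    show "integrable lborel (\<lambda>z. \<bar>(\<integral>\<tau>. g (z - \<iota> \<tau>) * \<rho> \<tau> \<partial>lborel) - g z\<bar>)"
      using integrable_average[OF g r(2) i] g by simp
    show "integrable lborel (\<lambda>z. (\<integral>\<tau>. \<bar>g (z - \<iota> \<tau>) - g z\<bar> * \<rho> \<tau> \<partial>lborel))"
      using lborel_pair.integrable_snd[OF p3] by simp
    show "AE z in lborel. \<bar>(\<integral>\<tau>. g (z - \<iota> \<tau>) * \<rho> \<tau> \<partial>lborel) - g z\<bar> \<le> (\<integral>\<tau>. \<bar>g (z - \<iota> \<tau>) - g z\<bar> * \<rho> \<tau> \<partial>lborel)"
      using a1
    proof eventually_elim
      fix z assume z: "integrable lborel (\<lambda>\<tau>. g (z - \<iota> \<tau>) * \<rho> \<tau>)"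
      have z2: "integrable lborel (\<lambda>\<tau>. g z * \<rho> \<tau>)" using r by simp
      have "(\<integral>\<tau>. g (z - \<iota> \<tau>) * \<rho> \<tau> \<partial>lborel) - g z = (\<integral>\<tau>. g (z - \<iota> \<tau>) * \<rho> \<tau> \<partial>lborel) - (\<integral>\<tau>. g z * \<rho> \<tau> \<partial>lborel)"
        using r by simp
      also have "\<dots> = (\<integral>\<tau>. (g (z - \<iota> \<tau>) - g z) * \<rho> \<tau> \<partial>lborel)"
        using z z2 by (simp add: left_diff_distrib)
      finally have "\<bar>(\<integral>\<tau>. g (z - \<iota> \<tau>) * \<rho> \<tau> \<partial>lborel) - g z\<bar> \<le> (\<integral>\<tau>. \<bar>(g (z - \<iota> \<tau>) - g z) * \<rho> \<tau>\<bar> \<partial>lborel)"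
        by simp
      then show "\<bar>(\<integral>\<tau>. g (z - \<iota> \<tau>) * \<rho> \<tau> \<partial>lborel) - g z\<bar> \<le> (\<integral>\<tau>. \<bar>g (z - \<iota> \<tau>) - g z\<bar> * \<rho> \<tau> \<partial>lborel)"
        using r by (simp add: abs_mult)
    qed
  qed
  also have "\<dots> = (\<integral>\<tau>. (\<integral>z. \<bar>g (z - \<iota> \<tau>) - g z\<bar> * \<rho> \<tau> \<partial>lborel) \<partial>lborel)"
    using lborel_pair.Fubini_integral[OF p3] by simp
  also have "\<dots> \<le> (\<integral>\<tau>. e * \<rho> \<tau> \<partial>lborel)"
  proof (rule integral_mono)
    show "integrable lborel (\<lambda>\<tau>. \<integral>z. \<bar>g (z - \<iota> \<tau>) - g z\<bar> * \<rho> \<tau> \<partial>lborel)"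
      using lborel_pair.integrable_fst[OF p3] by simp
    show "(\<integral>z. \<bar>g (z - \<iota> \<tau>) - g z\<bar> * \<rho> \<tau> \<partial>lborel) \<le> e * \<rho> \<tau>" for \<tau>
      using e[of \<tau>] r(1)[of \<tau>] by (cases "\<rho> \<tau> = 0") (auto intro: mult_right_mono)
  qed (use r in simp)
  also have "\<dots> = e" using r by simp
  finally show ?thesis .
qed

lemma L1_tendsto_average:
  fixes g :: "'a::euclidean_space \<Rightarrow> real" and \<rho> :: "nat \<Rightarrow> 'b::euclidean_space \<Rightarrow> real"
  assumes g: "integrable lborel g" and i[measurable]: "\<iota> \<in> borel_measurable borel"
    and r: "\<And>n \<tau>. \<rho> n \<tau> \<ge> 0" "\<And>n. integrable lborel (\<rho> n)" "\<And>n. (\<integral>\<tau>. \<rho> n \<tau> \<partial>lborel) = 1"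
    and s: "\<And>n \<tau>. \<rho> n \<tau> \<noteq> 0 \<Longrightarrow> norm (\<iota> \<tau>) \<le> l n" "l \<longlonglongrightarrow> 0"
  shows "L1_tendsto lborel (\<lambda>n z. \<integral>\<tau>. g (z - \<iota> \<tau>) * \<rho> n \<tau> \<partial>lborel) g"
  unfolding L1_tendsto_def
proof (intro conjI allI)
  show "integrable lborel (\<lambda>z. \<integral>\<tau>. g (z - \<iota> \<tau>) * \<rho> n \<tau> \<partial>lborel)" for n
    by (rule integrable_average[OF g r(2) i])
  show "integrable lborel g" by fact
  show "(\<lambda>n. \<integral>z. \<bar>(\<integral>\<tau>. g (z - \<iota> \<tau>) * \<rho> n \<tau> \<partial>lborel) - g z\<bar> \<partial>lborel) \<longlonglongrightarrow> 0"
  proof (rule LIMSEQ_I)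
    fix e :: real assume "e > 0"
    obtain d where d: "d > 0" "\<And>h. norm h \<le> d \<Longrightarrow> (\<integral>z. \<bar>g (z - h) - g z\<bar> \<partial>lborel) \<le> e/2"
      using L1_translation_uniform[OF g, of "e/2"] \<open>e > 0\<close> by auto
    obtain N where N: "\<And>n. n \<ge> N \<Longrightarrow> \<bar>l n\<bar> < d" using LIMSEQ_D[OF s(2) d(1)] by auto
    have "\<bar>\<integral>z. \<bar>(\<integral>\<tau>. g (z - \<iota> \<tau>) * \<rho> n \<tau> \<partial>lborel) - g z\<bar> \<partial>lborel\<bar> < e" if "n \<ge> N" for n
    proof -
      have "(\<integral>z. \<bar>(\<integral>\<tau>. g (z - \<iota> \<tau>) * \<rho> n \<tau> \<partial>lborel) - g z\<bar> \<partial>lborel) \<le> e / 2"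
      proof (rule L1_average_diff_le[OF g i r])
        fix \<tau> assume "\<rho> n \<tau> \<noteq> 0"
        then have "norm (\<iota> \<tau>) \<le> d" using s(1)[of n \<tau>] N[OF that] by linarith
        then show "(\<integral>z. \<bar>g (z - \<iota> \<tau>) - g z\<bar> \<partial>lborel) \<le> e / 2" by (rule d)
      qed
      moreover have "0 \<le> (\<integral>z. \<bar>(\<integral>\<tau>. g (z - \<iota> \<tau>) * \<rho> n \<tau> \<partial>lborel) - g z\<bar> \<partial>lborel)"
        by (rule Bochner_Integration.integral_nonneg) simp
      ultimately show ?thesis using \<open>e > 0\<close> by linarith
    qed
    then show "\<exists>no. \<forall>n\<ge>no. norm ((\<integral>z. \<bar>(\<integral>\<tau>. g (z - \<iota> \<tau>) * \<rho> n \<tau> \<partial>lborel) - g z\<bar> \<partial>lborel) - 0) < e"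
      by auto
  qed
qed

section \<open>Convolution in all variables, and in space at a frozen time\<close>

definition conv :: "('a::euclidean_space \<Rightarrow> real) \<Rightarrow> ('a \<Rightarrow> real) \<Rightarrow> 'a \<Rightarrow> real" where
  "conv g k z = (\<integral>w. g w * k (z - w) \<partial>lborel)"

lemma conv_measurable[measurable]:
  assumes [measurable]: "g \<in> borel_measurable borel" "k \<in> borel_measurable borel"
  shows "conv g k \<in> borel_measurable borel"
proof -
  have "conv g k = (\<lambda>z. \<integral>w. g w * k (z - w) \<partial>lborel)" by (simp add: conv_def fun_eq_iff)
  then show ?thesis by simp
qed

lemma conv_commute:
  assumes [measurable]: "g \<in> borel_measurable borel" "k \<in> borel_measurable borel"
  shows "conv g k z = (\<integral>w. g (z - w) * k w \<partial>lborel)"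
  unfolding conv_def using integral_lborel_reflect[of "\<lambda>w. g w * k (z - w)" z] by simp

lemma conv_integrable:
  fixes B :: real
  assumes "integrable lborel g" "k \<in> borel_measurable borel" "\<And>x. \<bar>k x\<bar> \<le> B"
  shows "integrable lborel (\<lambda>w. g w * k (z - w))"
  using assms by (intro integrable_mult_bounded[where C=B]) auto

lemma conv_bound_L1:
  fixes B :: real
  assumes "integrable lborel g" "k \<in> borel_measurable borel" "\<And>x. \<bar>k x\<bar> \<le> B"
  shows "\<bar>conv g k z\<bar> \<le> B * (\<integral>w. \<bar>g w\<bar> \<partial>lborel)"
proof -
  have "\<bar>conv g k z\<bar> \<le> (\<integral>w. B * \<bar>g w\<bar> \<partial>lborel)"
    unfolding conv_def
    using assms conv_integrable[OF assms]
    by (intro integral_abs_le) (auto simp: abs_mult mult.commute[of B] intro!: mult_left_mono)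
  then show ?thesis by simp
qed

lemma conv_bound_sup:
  assumes [measurable]: "g \<in> borel_measurable borel" and "\<And>x. \<bar>g x\<bar> \<le> C"
    and k: "\<And>x. k x \<ge> 0" "integrable lborel k" "(\<integral>x. k x \<partial>lborel) = 1"
  shows "\<bar>conv g k z\<bar> \<le> C"
proof -
  have [measurable]: "k \<in> borel_measurable borel" using k by auto
  have "\<bar>conv g k z\<bar> \<le> (\<integral>w. C * k w \<partial>lborel)"
    unfolding conv_commute[OF assms(1) \<open>k \<in> borel_measurable borel\<close>]
    using assms by (intro integral_abs_le integrable_mult_bounded(2)) (auto simp: abs_mult intro!: mult_right_mono)
  then show ?thesis using k by simp
qed

lemma L1_tendsto_conv:
  fixes g :: "'a::euclidean_space \<Rightarrow> real"
  assumes g: "integrable lborel g"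
    and r: "\<And>n \<tau>. \<rho> n \<tau> \<ge> 0" "\<And>n. integrable lborel (\<rho> n)" "\<And>n. (\<integral>\<tau>. \<rho> n \<tau> \<partial>lborel) = 1"
    and s: "\<And>n \<tau>. \<rho> n \<tau> \<noteq> 0 \<Longrightarrow> norm \<tau> \<le> l n" "l \<longlonglongrightarrow> 0"
  shows "L1_tendsto lborel (\<lambda>n. conv g (\<rho> n)) g"
proof -
  have [measurable]: "g \<in> borel_measurable borel" "\<And>n. \<rho> n \<in> borel_measurable borel" using g r by auto
  have "(\<lambda>n. conv g (\<rho> n)) = (\<lambda>n z. \<integral>\<tau>. g (z - \<tau>) * \<rho> n \<tau> \<partial>lborel)"
    by (simp add: conv_commute fun_eq_iff)
  then show ?thesis using L1_tendsto_average[OF g _ r s, of "\<lambda>x. x"] by simp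
qed

text \<open>This is what remains of a mollification in space and time once the time scale has been
  sent to zero; it acts on each time slice separately.\<close>

definition space_conv :: "('a::euclidean_space \<times> real \<Rightarrow> real) \<Rightarrow> ('a \<Rightarrow> real) \<Rightarrow> 'a \<times> real \<Rightarrow> real" where
  "space_conv g h z = conv (\<lambda>y. g (y, snd z)) h (fst z)"

lemma space_conv_eq:
  assumes [measurable]: "g \<in> borel_measurable borel" "h \<in> borel_measurable borel"
  shows "space_conv g h z = (\<integral>y. g (z - (y, 0)) * h y \<partial>lborel)"
  unfolding space_conv_def by (subst conv_commute) (auto simp: case_prod_beta minus_prod_def)

lemma space_conv_integrable:
  fixes g :: "'a::euclidean_space \<times> real \<Rightarrow> real"
  assumes g: "integrable lborel g" and h: "integrable lborel h"
  shows "integrable lborel (space_conv g h)"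
proof -
  have m[measurable]: "g \<in> borel_measurable borel" "h \<in> borel_measurable borel" using g h by auto
  have "space_conv g h = (\<lambda>z. \<integral>y. g (z - (y, 0)) * h y \<partial>lborel)" using space_conv_eq[OF m] by (simp add: fun_eq_iff)
  then show ?thesis using integrable_average[OF g h, of "\<lambda>y. (y, 0)"] by simp
qed

text \<open>By Fubini the spatial integration is carried out before the one in time, after which the
  time kernel only averages time shifts of \<open>space_conv g h\<close>.\<close>

lemma conv_prod_eq:
  fixes g :: "'a::euclidean_space \<times> real \<Rightarrow> real"
  assumes g: "integrable lborel g"
    and [measurable]: "h \<in> borel_measurable borel" "\<rho> \<in> borel_measurable borel"
    and B: "\<And>x. \<bar>h x\<bar> \<le> (B::real)" "\<And>t. \<bar>\<rho> t\<bar> \<le> (B'::real)"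
  shows "conv g (\<lambda>(x, t). h x * \<rho> t) z = (\<integral>\<tau>. space_conv g h (z - (0, \<tau>)) * \<rho> \<tau> \<partial>lborel)"
proof -
  obtain x t where z: "z = (x, t)" by fastforce
  have [measurable]: "g \<in> borel_measurable borel" using g by auto
  have bd: "\<bar>h x * \<rho> t\<bar> \<le> B * B'" for x t
    using B(1)[of x] B(2)[of t] by (simp add: abs_mult) (meson abs_ge_zero mult_mono order_trans)
  have "integrable (lborel \<Otimes>\<^sub>M lborel) (\<lambda>w. g w * (case z - w of (x, t) \<Rightarrow> h x * \<rho> t))"
    unfolding lborel_prod using bd
    by (intro conv_integrable[OF g, where B="B * B'"]) (auto simp: case_prod_beta simp flip: borel_prod)
  then have i: "integrable (lborel \<Otimes>\<^sub>M lborel) (\<lambda>(y, s). g (y, s) * (h (x - y) * \<rho> (t - s)))"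
    by (simp add: z split_beta')
  have "conv g (\<lambda>(x, t). h x * \<rho> t) z = (\<integral>w. (case w of (y, s) \<Rightarrow> g (y, s) * (h (x - y) * \<rho> (t - s))) \<partial>(lborel \<Otimes>\<^sub>M lborel))"
    unfolding conv_def lborel_prod by (simp add: z split_beta')
  also have "\<dots> = (\<integral>s. (\<integral>y. g (y, s) * (h (x - y) * \<rho> (t - s)) \<partial>lborel) \<partial>lborel)"
    by (rule lborel_pair.integral_snd[symmetric, OF i])
  also have "\<dots> = (\<integral>s. space_conv g h (x, s) * \<rho> (t - s) \<partial>lborel)"
    by (simp add: space_conv_def conv_def mult.assoc[symmetric])
  also have "\<dots> = (\<integral>\<tau>. space_conv g h (x, t - \<tau>) * \<rho> \<tau> \<partial>lborel)"
    using integral_lborel_reflect[of "\<lambda>s. space_conv g h (x, s) * \<rho> (t - s)" t] by (simp add: space_conv_def conv_def)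
  finally show ?thesis by (simp add: z)
qed

text \<open>Only the time factor is an approximate identity. The spatial factor \<open>h\<close>
  stays fixed; it is later a mollifier or one of its derivatives, which changes sign.\<close>

lemma L1_tendsto_conv_time:
  fixes g :: "'a::euclidean_space \<times> real \<Rightarrow> real"
  assumes g: "integrable lborel g" and h: "integrable lborel h" "\<And>x. \<bar>h x\<bar> \<le> B"
    and r: "\<And>n \<tau>. \<rho> n \<tau> \<ge> 0" "\<And>n. integrable lborel (\<rho> n)" "\<And>n. (\<integral>\<tau>. \<rho> n \<tau> \<partial>lborel) = 1"
    and rb: "\<And>n \<tau>. \<bar>\<rho> n \<tau>\<bar> \<le> B' n"
    and s: "\<And>n \<tau>. \<rho> n \<tau> \<noteq> 0 \<Longrightarrow> \<bar>\<tau>\<bar> \<le> l n" "l \<longlonglongrightarrow> (0::real)"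
  shows "L1_tendsto lborel (\<lambda>n. conv g (\<lambda>(x, t). h x * \<rho> n t)) (space_conv g h)"
proof -
  have m: "h \<in> borel_measurable borel" "\<And>n. \<rho> n \<in> borel_measurable borel" using h r by auto
  have "(\<lambda>n. conv g (\<lambda>(x, t). h x * \<rho> n t)) = (\<lambda>n z. \<integral>\<tau>. space_conv g h (z - (0, \<tau>)) * \<rho> n \<tau> \<partial>lborel)"
    using conv_prod_eq[OF g m h(2) rb] by (simp add: fun_eq_iff)
  then show ?thesis
    using L1_tendsto_average[OF space_conv_integrable[OF g h(1)] _ r, where \<iota>="\<lambda>\<tau>. (0, \<tau>)" and l=l] s by simp
qed

text \<open>Convolution and integration by parts involve derivatives along one line at a time, so
  the calculus of mollified functions is done with these derivatives instead of total ones.\<close>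

definition has_dir_deriv :: "('a::real_normed_vector \<Rightarrow> real) \<Rightarrow> 'a \<Rightarrow> ('a \<Rightarrow> real) \<Rightarrow> bool" where
  "has_dir_deriv g v D \<longleftrightarrow> (\<forall>z. ((\<lambda>s. g (z + s *\<^sub>R v)) has_real_derivative D z) (at 0))"

lemma has_dir_deriv_line:
  assumes "has_dir_deriv g v D"
  shows "((\<lambda>s. g (z + s *\<^sub>R v)) has_real_derivative D (z + s *\<^sub>R v)) (at s)"
proof -
  have "((\<lambda>r. g ((z + s *\<^sub>R v) + r *\<^sub>R v)) has_real_derivative D (z + s *\<^sub>R v)) (at 0)"
    using assms by (simp add: has_dir_deriv_def)
  then show ?thesis
    using DERIV_shift[of "\<lambda>s. g (z + s *\<^sub>R v)" "D (z + s *\<^sub>R v)" 0 s]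
    by (simp add: algebra_simps)
qed

lemma has_dir_deriv_diff_bound:
  assumes "has_dir_deriv g v D" "\<And>z. \<bar>D z\<bar> \<le> B"
  shows "\<bar>g (z + s *\<^sub>R v) - g z\<bar> \<le> B * \<bar>s\<bar>"
proof -
  have "norm (g (z + s *\<^sub>R v) - g (z + 0 *\<^sub>R v)) \<le> B * norm (s - 0)"
    by (rule field_differentiable_bound[of UNIV "\<lambda>s. g (z + s *\<^sub>R v)" "\<lambda>s. D (z + s *\<^sub>R v)"])
       (use assms has_dir_deriv_line[OF assms(1)] in auto)
  then show ?thesis by simp
qed

lemma has_dir_deriv_quotient:
  assumes "has_dir_deriv g v D" "X \<longlonglongrightarrow> 0" "\<And>n. X n \<noteq> 0"
  shows "(\<lambda>n. (g (z + X n *\<^sub>R v) - g z) / X n) \<longlonglongrightarrow> D z"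
proof -
  have "((\<lambda>s. (g (z + s *\<^sub>R v) - g z) / s) \<longlongrightarrow> D z) (at 0)"
    using assms(1) by (auto simp: has_dir_deriv_def has_field_derivative_iff)
  then show ?thesis using assms(2,3) unfolding tendsto_at_iff_sequentially
    by (auto simp: comp_def)
qed

lemma has_dir_deriv_measurable:
  fixes g :: "'a::euclidean_space \<Rightarrow> real"
  assumes "has_dir_deriv g v D" and [measurable]: "g \<in> borel_measurable borel"
  shows "D \<in> borel_measurable borel"
  by (rule borel_measurable_LIMSEQ_real[OF has_dir_deriv_quotient[OF assms(1) LIMSEQ_inverse_real_of_nat]]) auto

text \<open>Difference quotients have integral zero by translation invariance, and they converge to
  \<open>D\<close> under the bound given by the mean value inequality.\<close>

lemma integral_has_dir_deriv_zero:
  fixes g :: "'a::euclidean_space \<Rightarrow> real"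
  assumes d: "has_dir_deriv g v D" and B: "\<And>z. \<bar>D z\<bar> \<le> B" and m[measurable]: "g \<in> borel_measurable borel"
    and gi: "integrable lborel g" and R: "\<And>z. norm z > R \<Longrightarrow> g z = 0"
  shows "integrable lborel D" "(\<integral>z. D z \<partial>lborel) = 0"
proof -
  let ?X = "\<lambda>n. inverse (real (Suc n))"
  let ?q = "\<lambda>n z. (g (z + ?X n *\<^sub>R v) - g z) / ?X n"
  \<comment> \<open>The increments are at most 1, so all quotients vanish outside the ball of radius
    \<open>R + norm v\<close>.\<close>
  let ?w = "\<lambda>z::'a. B * indicator (cball 0 (R + norm v)) z"
  have [measurable]: "D \<in> borel_measurable borel" by (rule has_dir_deriv_measurable[OF d m])
  have wi: "integrable lborel ?w"
    using emeasure_lborel_cball_finite[of "0::'a" "R + norm v"]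
    by (intro integrable_mult_right integrable_real_indicator) auto
  have bnd: "norm (?q n z) \<le> ?w z" for n z
  proof (cases "norm z \<le> R + norm v")
    case True
    have "\<bar>?q n z\<bar> = \<bar>g (z + ?X n *\<^sub>R v) - g z\<bar> / ?X n" by (simp add: abs_divide)
    also have "\<dots> \<le> (B * \<bar>?X n\<bar>) / ?X n"
      using has_dir_deriv_diff_bound[OF d B, of z "?X n"] by (intro divide_right_mono) auto
    also have "\<dots> = B" by simp
    finally show ?thesis using True by (simp add: indicator_def)
  next
    case False
    have "norm z \<le> norm (z + ?X n *\<^sub>R v) + norm (?X n *\<^sub>R v)"
      by (metis add_diff_cancel norm_triangle_ineq4)
    moreover have "norm (?X n *\<^sub>R v) \<le> norm v"
      using mult_right_mono[of "?X n" 1 "norm v"] by (simp add: field_simps)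
    ultimately have "norm (z + ?X n *\<^sub>R v) > R" "norm z > R" using False norm_ge_zero[of v] by linarith+
    then show ?thesis using False by (simp add: R)
  qed
  have lim: "AE z in lborel. (\<lambda>n. ?q n z) \<longlonglongrightarrow> D z"
    using has_dir_deriv_quotient[OF d LIMSEQ_inverse_real_of_nat] by simp
  show "integrable lborel D"
    by (rule integrable_dominated_convergence[where w="?w" and s="?q", OF _ _ wi lim]) (use bnd in auto)
  have "(\<lambda>n. \<integral>z. ?q n z \<partial>lborel) \<longlonglongrightarrow> (\<integral>z. D z \<partial>lborel)"
    by (rule integral_dominated_convergence[where w="?w", OF _ _ wi lim]) (use bnd in auto)
  moreover have "(\<integral>z. ?q n z \<partial>lborel) = 0" for n
    using integral_lborel_shift[OF m] gi integrable_lborel_shift(1)[OF gi] by simp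
  ultimately have "(\<lambda>n::nat. 0) \<longlonglongrightarrow> (\<integral>z. D z \<partial>lborel)" by (simp only:)
  then show "(\<integral>z. D z \<partial>lborel) = 0" by (simp add: LIMSEQ_const_iff)
qed

lemma has_dir_deriv_mult:
  assumes "has_dir_deriv f v f'" "has_dir_deriv g v g'"
  shows "has_dir_deriv (\<lambda>z. f z * g z) v (\<lambda>z. f' z * g z + f z * g' z)"
  unfolding has_dir_deriv_def
proof
  fix z
  show "((\<lambda>s. f (z + s *\<^sub>R v) * g (z + s *\<^sub>R v)) has_real_derivative (f' z * g z + f z * g' z)) (at 0)"
    using DERIV_mult[of "\<lambda>s. f (z + s *\<^sub>R v)" "f' z" 0 UNIV "\<lambda>s. g (z + s *\<^sub>R v)" "g' z"] assms
    by (simp add: has_dir_deriv_def mult.commute)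
qed

text \<open>The derivative falls on the kernel. By the mean value inequality its difference
  quotients are bounded by \<open>B'\<close>, so the integrands are dominated by
  \<open>\<bar>g w\<bar> * B'\<close>.\<close>

lemma has_dir_deriv_conv:
  assumes g: "integrable lborel g" and k: "has_dir_deriv k v k'" "k \<in> borel_measurable borel"
    and B: "\<And>x. \<bar>k x\<bar> \<le> B" "\<And>x. \<bar>k' x\<bar> \<le> B'"
  shows "has_dir_deriv (conv g k) v (conv g k')"
  unfolding has_dir_deriv_def
proof
  fix z
  note [measurable] = k(2) has_dir_deriv_measurable[OF k]
  have [measurable]: "g \<in> borel_measurable borel" using g by auto
  have "((\<lambda>s. (conv g k (z + s *\<^sub>R v) - conv g k z) / s) \<longlongrightarrow> conv g k' z) (at 0)"
    unfolding tendsto_at_iff_sequentially comp_def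
  proof (intro allI impI)
    fix X :: "nat \<Rightarrow> real" assume "\<forall>i. X i \<in> UNIV - {0}" and X: "X \<longlonglongrightarrow> 0"
    then have X0: "X n \<noteq> 0" for n by auto
    have eq: "(conv g k (z + X n *\<^sub>R v) - conv g k z) / X n = (\<integral>w. g w * ((k (z - w + X n *\<^sub>R v) - k (z - w)) / X n) \<partial>lborel)" for n
    proof -
      have "conv g k (z + X n *\<^sub>R v) - conv g k z = (\<integral>w. g w * k (z + X n *\<^sub>R v - w) - g w * k (z - w) \<partial>lborel)"
        unfolding conv_def using conv_integrable[OF g k(2) B(1)] by simp
      also have "\<dots> = (\<integral>w. (g w * ((k (z - w + X n *\<^sub>R v) - k (z - w)) / X n)) * X n \<partial>lborel)"
        using X0[of n] by (intro Bochner_Integration.integral_cong) (auto simp: algebra_simps diff_divide_distrib)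
      also have "\<dots> = (\<integral>w. g w * ((k (z - w + X n *\<^sub>R v) - k (z - w)) / X n) \<partial>lborel) * X n"
        by (rule integral_mult_left_zero)
      finally show ?thesis using X0[of n] by (simp add: field_simps)
    qed
    show "(\<lambda>n. (conv g k (z + X n *\<^sub>R v) - conv g k z) / X n) \<longlonglongrightarrow> conv g k' z"
      unfolding eq conv_def[of g k' z]
    proof (rule integral_dominated_convergence[where w="\<lambda>w. \<bar>g w\<bar> * B'"])
      show "AE w in lborel. (\<lambda>n. g w * ((k (z - w + X n *\<^sub>R v) - k (z - w)) / X n)) \<longlonglongrightarrow> g w * k' (z - w)"
        by (intro AE_I2 tendsto_intros has_dir_deriv_quotient[OF k(1) X X0])
      show "AE w in lborel. norm (g w * ((k (z - w + X n *\<^sub>R v) - k (z - w)) / X n)) \<le> \<bar>g w\<bar> * B'" for n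
      proof (rule AE_I2)
        fix w
        have "\<bar>k (z - w + X n *\<^sub>R v) - k (z - w)\<bar> / \<bar>X n\<bar> \<le> (B' * \<bar>X n\<bar>) / \<bar>X n\<bar>"
          by (intro divide_right_mono has_dir_deriv_diff_bound[OF k(1) B(2)]) auto
        then show "norm (g w * ((k (z - w + X n *\<^sub>R v) - k (z - w)) / X n)) \<le> \<bar>g w\<bar> * B'"
          using X0[of n] mult_left_mono[of "\<bar>k (z - w + X n *\<^sub>R v) - k (z - w)\<bar> / \<bar>X n\<bar>" B' "\<bar>g w\<bar>"]
          by (simp add: abs_mult abs_divide)
      qed
    qed (use g in auto)
  qed
  then show "((\<lambda>s. conv g k (z + s *\<^sub>R v)) has_real_derivative conv g k' z) (at 0)"
    by (simp add: has_field_derivative_iff)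
qed

lemma has_dir_deriv_frechet:
  assumes "g differentiable_on UNIV"
  shows "has_dir_deriv g v (dderiv v g)"
  unfolding has_dir_deriv_def
proof
  fix z
  have "(g has_derivative frechet_derivative g (at z)) (at z)"
    using assms by (simp add: differentiable_on_def frechet_derivative_works)
  then have "(g has_derivative frechet_derivative g (at z)) (at (z + 0 *\<^sub>R v))" by simp
  moreover have "((\<lambda>s. z + s *\<^sub>R v) has_derivative (\<lambda>s. s *\<^sub>R v)) (at 0)"
    by (auto intro!: derivative_eq_intros)
  ultimately have "((\<lambda>s. g (z + s *\<^sub>R v)) has_derivative (\<lambda>s. frechet_derivative g (at z) (s *\<^sub>R v))) (at 0)"
    using has_derivative_compose[of "\<lambda>s. z + s *\<^sub>R v" "\<lambda>s. s *\<^sub>R v" 0 UNIV g "frechet_derivative g (at z)"] by simp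
  moreover have "frechet_derivative g (at z) (s *\<^sub>R v) = dderiv v g z * s" for s
    using linear_frechet_derivative[of g "at z"] assms
    by (simp add: dderiv_def differentiable_on_def linear_cmul mult.commute)
  ultimately show "((\<lambda>s. g (z + s *\<^sub>R v)) has_real_derivative dderiv v g z) (at 0)"
    by (simp add: has_field_derivative_def)
qed

section \<open>Smooth functions and mollifiers\<close>

text \<open>A class of differentiable functions that is stable under derivatives along basis vectors
  contains all iterated derivatives of its members. The choice of a stable class is the content of
  each application.\<close>

lemma smooth_fun_coinduct:
  assumes "g \<in> S" "\<And>h. h \<in> S \<Longrightarrow> h differentiable_on UNIV" "\<And>h b. h \<in> S \<Longrightarrow> b \<in> Basis \<Longrightarrow> dderiv b h \<in> S"
  shows "smooth_fun g"
  unfolding smooth_fun_def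
proof
  fix vs :: "'a list" assume "vs \<in> lists Basis"
  then have "foldr dderiv vs g \<in> S"
    by (induction vs) (use assms in auto)
  then show "(\<lambda>x. foldr dderiv vs g x) differentiable_on UNIV" using assms(2) by simp
qed

lemma smooth_fun_differentiable: "smooth_fun g \<Longrightarrow> g differentiable_on UNIV"
  unfolding smooth_fun_def by (drule bspec[of _ _ "[]"]) auto

lemma smooth_fun_dderiv:
  assumes "smooth_fun g" "b \<in> Basis"
  shows "smooth_fun (dderiv b g)"
  unfolding smooth_fun_def
proof
  fix vs :: "'a list" assume "vs \<in> lists Basis"
  then have "vs @ [b] \<in> lists Basis" using assms(2) by simp
  from bspec[OF assms(1)[unfolded smooth_fun_def] this]
  show "(\<lambda>x. foldr dderiv vs (dderiv b g) x) differentiable_on UNIV" by simp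
qed

lemma smooth_fun_continuous: "smooth_fun g \<Longrightarrow> continuous_on UNIV g"
  using smooth_fun_differentiable differentiable_imp_continuous_on by blast

lemma smooth_fun_measurable: "smooth_fun g \<Longrightarrow> g \<in> borel_measurable borel"
  using smooth_fun_continuous borel_measurable_continuous_onI by blast

lemma dderiv_eqI: "(g has_derivative g') (at x) \<Longrightarrow> dderiv v g x = g' v"
  unfolding dderiv_def using frechet_derivative_at by metis

lemma smooth_fun_has_derivative:
  "smooth_fun g \<Longrightarrow> (g has_derivative (\<lambda>v. dderiv v g x)) (at x)"
  unfolding dderiv_def using smooth_fun_differentiable[of g]
  by (simp add: differentiable_on_def frechet_derivative_works)

lemma smooth_fun_has_dir_deriv: "smooth_fun g \<Longrightarrow> has_dir_deriv g v (dderiv v g)"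
  using has_dir_deriv_frechet smooth_fun_differentiable by blast

text \<open>The reflected kernel is the test function behind every mollified equation. The factor
  \<open>c\<close> is carried along because each derivative contributes a sign; with it, the class
  used for smoothness is stable.\<close>

lemma dderiv_reflect:
  assumes "smooth_fun h"
  shows "((\<lambda>y. c * h (x - y)) has_derivative (\<lambda>v. - c * dderiv v h (x - y))) (at y)"
    "dderiv v (\<lambda>y. c * h (x - y)) = (\<lambda>y. - c * dderiv v h (x - y))"
proof -
  have lin: "linear (\<lambda>v. dderiv v h z)" for z
    using smooth_fun_has_derivative[OF assms, of z] has_derivative_linear by blast
  have *: "((\<lambda>y. c * h (x - y)) has_derivative (\<lambda>v. - c * dderiv v h (x - y))) (at y)" for y
  proof -
    have "((\<lambda>y. h (x - y)) has_derivative (\<lambda>v. dderiv (0 - v) h (x - y))) (at y)"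
      by (rule has_derivative_compose[of "\<lambda>y. x - y", OF _ smooth_fun_has_derivative[OF assms]])
         (auto intro!: derivative_eq_intros)
    then have "((\<lambda>y. c * h (x - y)) has_derivative (\<lambda>v. c * dderiv (0 - v) h (x - y))) (at y)"
      by (rule has_derivative_mult_right)
    then show ?thesis using linear_neg[OF lin] by simp
  qed
  then show "((\<lambda>y. c * h (x - y)) has_derivative (\<lambda>v. - c * dderiv v h (x - y))) (at y)" .
  show "dderiv v (\<lambda>y. c * h (x - y)) = (\<lambda>y. - c * dderiv v h (x - y))"
    using dderiv_eqI[OF *] by (simp add: fun_eq_iff)
qed

lemma smooth_fun_reflect:
  assumes "smooth_fun h"
  shows "smooth_fun (\<lambda>y. h (x - y))"
proof -
  have "smooth_fun (\<lambda>y. 1 * h (x - y))"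
  proof (rule smooth_fun_coinduct[of _ "{(\<lambda>y. c * h (x - y)) | c h. smooth_fun h}"])
    show "(\<lambda>y. 1 * h (x - y)) \<in> {(\<lambda>y. c * h (x - y)) | c h. smooth_fun h}" using assms by blast
    fix k assume "k \<in> {(\<lambda>y. c * h (x - y)) | c h. smooth_fun h}"
    then obtain c h where k: "k = (\<lambda>y. c * h (x - y))" "smooth_fun h" by blast
    show "k differentiable_on UNIV"
      using dderiv_reflect(1)[OF k(2)] by (auto simp: k(1) differentiable_on_def differentiable_def)
    show "dderiv b k \<in> {(\<lambda>y. c * h (x - y)) | c h. smooth_fun h}" if "b \<in> Basis" for b
      using dderiv_reflect(2)[OF k(2)] smooth_fun_dderiv[OF k(2) that] k(1) by blast
  qed
  then show ?thesis by simp
qed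

lemma has_derivative_tensor:
  assumes "smooth_fun h" "smooth_fun g"
  shows "((\<lambda>(x, t). h x * g t) has_derivative (\<lambda>v. h x * dderiv (snd v) g t + dderiv (fst v) h x * g t)) (at (x, t))"
proof -
  have 1: "((\<lambda>z. h (fst z)) has_derivative (\<lambda>v. dderiv (fst v) h x)) (at (x, t))"
    using has_derivative_compose[OF has_derivative_fst[OF has_derivative_ident], of h "\<lambda>v. dderiv v h x" "(x, t)" UNIV]
      smooth_fun_has_derivative[OF assms(1)] by simp
  have 2: "((\<lambda>z. g (snd z)) has_derivative (\<lambda>v. dderiv (snd v) g t)) (at (x, t))"
    using has_derivative_compose[OF has_derivative_snd[OF has_derivative_ident], of g "\<lambda>v. dderiv v g t" "(x, t)" UNIV]
      smooth_fun_has_derivative[OF assms(2)] by simp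
  show ?thesis using has_derivative_mult[OF 1 2] by (simp add: split_beta')
qed

lemma dderiv_zero_vector: "smooth_fun g \<Longrightarrow> dderiv 0 g x = 0"
  using smooth_fun_has_derivative[of g x] has_derivative_linear linear_0 by blast

lemma dderiv_tensor:
  assumes "smooth_fun h" "smooth_fun g"
  shows "dderiv (b, 0) (\<lambda>(x, t). h x * g t) = (\<lambda>(x, t). dderiv b h x * g t)"
    "dderiv (0, b') (\<lambda>(x, t). h x * g t) = (\<lambda>(x, t). h x * dderiv b' g t)"
  using dderiv_eqI[OF has_derivative_tensor[OF assms]] dderiv_zero_vector[OF assms(1)] dderiv_zero_vector[OF assms(2)]
  by (auto simp: fun_eq_iff)

text \<open>A basis vector of the product has only one non-zero component, so a derivative acts on
  one factor and leaves the other: tensor products form a stable class.\<close>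

lemma smooth_fun_tensor:
  fixes h :: "'a::euclidean_space \<Rightarrow> real" and g :: "'b::euclidean_space \<Rightarrow> real"
  assumes "smooth_fun h" "smooth_fun g"
  shows "smooth_fun (\<lambda>(x, t). h x * g t)"
proof (rule smooth_fun_coinduct[of _ "{(\<lambda>(x, t). h x * g t) | h g. smooth_fun h \<and> smooth_fun g}"])
  show "(\<lambda>(x, t). h x * g t) \<in> {(\<lambda>(x, t). h x * g t) | h g. smooth_fun h \<and> smooth_fun g}"
    using assms by blast
  fix k :: "'a \<times> 'b \<Rightarrow> real" assume "k \<in> {(\<lambda>(x, t). h x * g t) | h g. smooth_fun h \<and> smooth_fun g}"
  then obtain h g where k: "k = (\<lambda>(x, t). h x * g t)" "smooth_fun h" "smooth_fun g" by blast
  show "k differentiable_on UNIV"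
    using has_derivative_tensor[OF k(2,3)] by (auto simp: k(1) differentiable_on_def differentiable_def)
  fix b :: "'a \<times> 'b" assume "b \<in> Basis"
  then consider b1 where "b = (b1, 0)" "b1 \<in> Basis" | b2 where "b = (0, b2)" "b2 \<in> Basis"
    by (auto simp: Basis_prod_def)
  then show "dderiv b k \<in> {(\<lambda>(x, t). h x * g t) | h g. smooth_fun h \<and> smooth_fun g}"
  proof cases
    case 1
    then show ?thesis using dderiv_tensor(1)[OF k(2,3)] smooth_fun_dderiv[OF k(2)] k(1,3) by blast
  next
    case 2
    then show ?thesis using dderiv_tensor(2)[OF k(2,3)] smooth_fun_dderiv[OF k(3)] k(1,2) by blast
  qed
qed

lemma dderiv_zero_outside:
  assumes "smooth_fun g" "\<And>z. norm z > r \<Longrightarrow> g z = 0" "norm z > r"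
  shows "dderiv v g z = 0"
proof -
  have o: "open {z::'a. norm z > r}" by (intro open_Collect_less continuous_intros)
  have "((\<lambda>z. 0) has_derivative (\<lambda>v. 0)) (at z)" by simp
  then have "(g has_derivative (\<lambda>v. 0)) (at z)"
    by (rule has_derivative_transform_within_open[OF _ o]) (use assms in auto)
  then show ?thesis by (rule dderiv_eqI)
qed

lemma continuous_bounded_support:
  fixes k :: "'a::euclidean_space \<Rightarrow> real"
  assumes k: "continuous_on UNIV k" "\<And>z. norm z > r \<Longrightarrow> k z = 0"
  shows "\<exists>B. \<forall>z. \<bar>k z\<bar> \<le> B" "integrable lborel k"
proof -
  have "compact (k ` cball 0 r)"
    by (rule compact_continuous_image[OF continuous_on_subset[OF k(1)]]) auto
  then obtain B where B: "\<And>z. z \<in> cball 0 r \<Longrightarrow> \<bar>k z\<bar> \<le> B"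
    by (metis bounded_iff compact_imp_bounded imageI real_norm_def)
  have "\<bar>k z\<bar> \<le> max B 0" for z
    using B[of z] k(2)[of z] by (cases "norm z \<le> r") (auto simp: le_max_iff_disj)
  then show "\<exists>B. \<forall>z. \<bar>k z\<bar> \<le> B" by blast
  have "integrable lborel (\<lambda>x. indicator (cball 0 r) x *\<^sub>R k x)"
    using k(1) by (intro borel_integrable_compact) (auto intro: continuous_on_subset)
  moreover have "(\<lambda>x. indicator (cball 0 r) x *\<^sub>R k x) = k"
  proof
    fix x show "indicator (cball 0 r) x *\<^sub>R k x = k x"
      using k(2)[of x] by (cases "norm x \<le> r") (auto simp: indicator_def)
  qed
  ultimately show "integrable lborel k" by (simp only:)
qed

section \<open>An explicit bump function and the mollifier built from it\<close>

lemma power_le_fact_exp: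
  fixes w :: real assumes "w \<ge> 0"
  shows "w ^ m \<le> fact m * exp w"
proof -
  have "(\<Sum>n\<in>{m}. w ^ n /\<^sub>R fact n) \<le> (\<Sum>n. w ^ n /\<^sub>R fact n)"
    by (rule sum_le_suminf[OF summable_exp_generic]) (use assms in auto)
  then show ?thesis by (simp add: exp_def field_simps)
qed

text \<open>The numerator \<open>p\<close> and the exponent \<open>n\<close> are parameters because
  the whole family, unlike its member with \<open>p = 1\<close> and \<open>n = 0\<close>, is closed
  under differentiation.\<close>

definition bump :: "real poly \<Rightarrow> nat \<Rightarrow> real \<Rightarrow> real" where
  "bump p n x = (if \<bar>x\<bar> < 1 then poly p x * exp (- (1 / (1 - x\<^sup>2))) / (1 - x\<^sup>2) ^ n else 0)"

text \<open>The numerator of the derivative over the exponent \<open>n + 2\<close>. With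
  \<open>d = 1 - x^2\<close> the quotient rule gives \<open>p' d^2 + 2 n x p d - 2 x p\<close>; the
  last term comes from differentiating the exponential.\<close>

definition bump_next :: "real poly \<Rightarrow> nat \<Rightarrow> real poly" where
  "bump_next p n = pderiv p * [:1, 0, -1:]^2 + smult (2 * real n) ([:0, 1:] * p * [:1, 0, -1:]) - smult 2 ([:0, 1:] * p)"

text \<open>One term of the exponential series bounds \<open>exp (- (1 / d))\<close> by a multiple
  of \<open>d ^ (n + 2)\<close>: \<open>n\<close> of these powers cancel the denominator and two
  remain. The factor 4 is the square of the 2 in \<open>d \<le> 2 * \<bar>y - x\<bar>\<close>. A
  quadratic bound at an end of the support forces derivative zero there.\<close>

lemma bump_quadratic_bound:
  assumes "\<bar>x\<bar> = 1"
  shows "\<exists>M\<ge>0. \<forall>y. \<bar>bump p n y\<bar> \<le> M * (y - x)\<^sup>2"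
proof -
  have "compact (poly p ` {-1..1})"
    by (intro compact_continuous_image continuous_intros) auto
  then obtain M where M: "\<And>y. y \<in> {-1..1} \<Longrightarrow> \<bar>poly p y\<bar> \<le> M"
    by (metis bounded_iff compact_imp_bounded imageI real_norm_def)
  have M0: "M \<ge> 0" using M[of 0] by auto
  have "\<bar>bump p n y\<bar> \<le> (M * fact (n + 2) * 4) * (y - x)\<^sup>2" for y
  proof (cases "\<bar>y\<bar> < 1")
    case True
    define d where "d = 1 - y\<^sup>2"
    have d: "d > 0" using True by (simp add: d_def abs_square_less_1)
    have e: "exp (- (1 / d)) \<le> fact (n + 2) * d ^ (n + 2)"
    proof -
      have "(1 / d) ^ (n + 2) \<le> fact (n + 2) * exp (1 / d)" by (rule power_le_fact_exp) (use d in auto)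
      then have "1 \<le> fact (n + 2) * exp (1 / d) * d ^ (n + 2)" using d by (simp add: power_divide field_simps del: fact_Suc)
      then show ?thesis using d by (simp add: exp_minus field_simps del: fact_Suc)
    qed
    have d2: "d \<le> 2 * \<bar>y - x\<bar>"
    proof -
      have "d = (1 - \<bar>y\<bar>) * (1 + \<bar>y\<bar>)" by (simp add: d_def algebra_simps power2_eq_square)
      also have "\<dots> \<le> (1 - \<bar>y\<bar>) * 2" using True by (intro mult_left_mono) auto
      also have "\<dots> \<le> 2 * \<bar>y - x\<bar>" using assms abs_triangle_ineq2_sym[of x y] by simp
      finally show ?thesis .
    qed
    have "\<bar>bump p n y\<bar> = \<bar>poly p y\<bar> * (exp (- (1 / d)) / d ^ n)"
      using True d by (simp add: bump_def d_def abs_mult)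
    also have "\<dots> \<le> M * ((fact (n + 2) * d ^ (n + 2)) / d ^ n)"
    proof (intro mult_mono divide_right_mono e)
      show "\<bar>poly p y\<bar> \<le> M" using M[of y] True by (simp add: abs_less_iff)
    qed (use d M0 in auto)
    also have "\<dots> = M * fact (n + 2) * d\<^sup>2" using d by (simp add: power_add power2_eq_square del: fact_Suc)
    also have "\<dots> \<le> M * fact (n + 2) * (2 * \<bar>y - x\<bar>)\<^sup>2"
      using d d2 M0 by (intro mult_left_mono power_mono) auto
    finally show ?thesis by (simp add: power_mult_distrib del: fact_Suc)
  next
    case False
    then show ?thesis using M0 by (simp add: bump_def del: fact_Suc)
  qed
  moreover have "M * fact (n + 2) * 4 \<ge> 0" using M0 by simp
  ultimately show ?thesis by blast
qed

text \<open>Inside the interval this is the quotient rule, outside it the function is locally zero,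
  and at the two ends the quadratic bound gives derivative zero, which is the value of the next
  member of the family.\<close>

lemma bump_deriv: "(bump p n has_real_derivative bump (bump_next p n) (n + 2) x) (at x)"
proof -
  consider "\<bar>x\<bar> < 1" | "\<bar>x\<bar> > 1" | "\<bar>x\<bar> = 1" by linarith
  then show ?thesis
  proof cases
    case 1
    have ne: "1 - x\<^sup>2 \<noteq> 0" using 1 by (metis abs_square_eq_1 less_irrefl diff_eq_diff_eq eq_iff_diff_eq_0)
    have o: "open {x::real. \<bar>x\<bar> < 1}" by (intro open_Collect_less continuous_intros)
    have "((\<lambda>x. poly p x * exp (- (1 / (1 - x\<^sup>2))) / (1 - x\<^sup>2) ^ n) has_real_derivative
        poly (bump_next p n) x * exp (- (1 / (1 - x\<^sup>2))) / (1 - x\<^sup>2) ^ (n + 2)) (at x)"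
    proof -
      define d where "d = 1 - x\<^sup>2"
      have d: "d \<noteq> 0" using ne by (simp add: d_def)
      have dd: "((\<lambda>x. 1 - x\<^sup>2) has_real_derivative - 2 * x) (at x)"
        by (auto intro!: derivative_eq_intros)
      have e1: "((\<lambda>x. exp (- (1 / (1 - x\<^sup>2)))) has_real_derivative exp (- (1 / d)) * (- (2 * x) / d\<^sup>2)) (at x)"
        unfolding d_def using ne by (auto intro!: derivative_eq_intros simp: power2_eq_square)
      have e2: "((\<lambda>x. (1 - x\<^sup>2) ^ n) has_real_derivative real n * d ^ (n - 1) * (- 2 * x)) (at x)"
        unfolding d_def by (rule derivative_eq_intros dd refl | simp)+
      have "((\<lambda>x. poly p x * exp (- (1 / (1 - x\<^sup>2))) / (1 - x\<^sup>2) ^ n) has_real_derivative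
         ((poly (pderiv p) x * exp (- (1 / d)) + exp (- (1 / d)) * (- (2 * x) / d\<^sup>2) * poly p x) * d ^ n - (poly p x * exp (- (1 / d))) * (real n * d ^ (n - 1) * (- 2 * x))) / (d ^ n * d ^ n)) (at x)"
        using DERIV_divide[OF DERIV_mult[OF poly_DERIV e1] e2] d by (simp add: d_def)
      moreover have "((poly (pderiv p) x * exp (- (1 / d)) + exp (- (1 / d)) * (- (2 * x) / d\<^sup>2) * poly p x) * d ^ n - (poly p x * exp (- (1 / d))) * (real n * d ^ (n - 1) * (- 2 * x))) / (d ^ n * d ^ n)
        = poly (bump_next p n) x * exp (- (1 / d)) / d ^ (n + 2)"
      proof -
        have p: "poly (bump_next p n) x = poly (pderiv p) x * d\<^sup>2 + 2 * real n * (x * poly p x * d) - 2 * (x * poly p x)"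
          by (simp add: bump_next_def d_def power2_eq_square algebra_simps)
        show ?thesis
        \<comment> \<open>The exponent \<open>n - 1\<close> is a truncated subtraction; for
          \<open>n = 0\<close> the term it belongs to has the factor zero.\<close>
        proof (cases n)
          case 0
          then show ?thesis unfolding p using d by (simp add: field_simps power2_eq_square)
        next
          case (Suc m)
          show ?thesis unfolding p unfolding Suc using d by (simp add: field_simps power2_eq_square)
        qed
      qed
      ultimately show ?thesis by (simp add: d_def)
    qed
    then have "(bump p n has_real_derivative poly (bump_next p n) x * exp (- (1 / (1 - x\<^sup>2))) / (1 - x\<^sup>2) ^ (n + 2)) (at x)"
      by (rule has_field_derivative_transform_within_open[OF _ o]) (use 1 in \<open>auto simp: bump_def\<close>)
    then show ?thesis using 1 by (simp add: bump_def)
  next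
    case 2
    have o: "open {x::real. \<bar>x\<bar> > 1}" by (intro open_Collect_less continuous_intros)
    have "((\<lambda>x. 0) has_real_derivative 0) (at x)" by simp
    then have "(bump p n has_real_derivative 0) (at x)"
      by (rule has_field_derivative_transform_within_open[OF _ o]) (use 2 in \<open>auto simp: bump_def\<close>)
    then show ?thesis using 2 by (simp add: bump_def)
  next
    case 3
    obtain M where M: "M \<ge> 0" "\<And>y. \<bar>bump p n y\<bar> \<le> M * (y - x)\<^sup>2" using bump_quadratic_bound[OF 3] by blast
    have "((\<lambda>h. (bump p n (x + h) - bump p n x) / h) \<longlongrightarrow> 0) (at 0)"
    proof (rule Lim_null_comparison)
      show "\<forall>\<^sub>F h in at 0. norm ((bump p n (x + h) - bump p n x) / h) \<le> M * \<bar>h\<bar>"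
      proof (rule always_eventually, rule allI)
        fix h
        have "bump p n x = 0" using 3 by (simp add: bump_def)
        moreover have "\<bar>bump p n (x + h)\<bar> \<le> M * h\<^sup>2" using M(2)[of "x + h"] by simp
        ultimately show "norm ((bump p n (x + h) - bump p n x) / h) \<le> M * \<bar>h\<bar>"
          by (cases "h = 0") (auto simp: field_simps power2_eq_square abs_mult)
      qed
      show "((\<lambda>h. M * \<bar>h\<bar>) \<longlongrightarrow> 0) (at 0)" by (auto intro!: tendsto_eq_intros)
    qed
    then show ?thesis using 3 by (simp add: DERIV_def bump_def)
  qed
qed

lemma has_derivative_prod_bump:
  fixes x :: "'a::euclidean_space"
  shows "((\<lambda>x. c * (\<Prod>b\<in>Basis. bump (p b) (n b) (a * (x \<bullet> b)))) has_derivative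
    (\<lambda>v. c * (\<Sum>b\<in>Basis. (bump (bump_next (p b) (n b)) (n b + 2) (a * (x \<bullet> b)) * (a * (v \<bullet> b))) * (\<Prod>b'\<in>Basis - {b}. bump (p b') (n b') (a * (x \<bullet> b')))))) (at x)"
proof (rule has_derivative_mult_right, rule has_derivative_prod)
  fix b :: 'a
  have "((\<lambda>x. a * (x \<bullet> b)) has_derivative (\<lambda>v. a * (v \<bullet> b))) (at x)"
    by (auto intro!: derivative_eq_intros)
  from has_derivative_compose[OF this bump_deriv[unfolded has_field_derivative_def]]
  show "((\<lambda>x. bump (p b) (n b) (a * (x \<bullet> b))) has_derivative (\<lambda>v. bump (bump_next (p b) (n b)) (n b + 2) (a * (x \<bullet> b)) * (a * (v \<bullet> b)))) (at x)" .
qed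

text \<open>The stable class consists of products with arbitrary coefficient and one pair of
  numerator and exponent per coordinate: a derivative along a basis vector changes the pair of that
  coordinate only and multiplies the coefficient by \<open>a\<close>.\<close>

lemma smooth_fun_prod_bump:
  "smooth_fun (\<lambda>x::'a::euclidean_space. c * (\<Prod>b\<in>Basis. bump (p b) (n b) (a * (x \<bullet> b))))"
proof (rule smooth_fun_coinduct[of _ "{(\<lambda>x::'a. c * (\<Prod>b\<in>Basis. bump (p b) (n b) (a * (x \<bullet> b)))) | c p n. True}"])
  show "(\<lambda>x::'a. c * (\<Prod>b\<in>Basis. bump (p b) (n b) (a * (x \<bullet> b)))) \<in> {(\<lambda>x::'a. c * (\<Prod>b\<in>Basis. bump (p b) (n b) (a * (x \<bullet> b)))) | c p n. True}"
    by blast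
  fix k :: "'a \<Rightarrow> real"
  assume "k \<in> {(\<lambda>x::'a. c * (\<Prod>b\<in>Basis. bump (p b) (n b) (a * (x \<bullet> b)))) | c p n. True}"
  then obtain c p n where k: "k = (\<lambda>x::'a. c * (\<Prod>b\<in>Basis. bump (p b) (n b) (a * (x \<bullet> b))))" by blast
  show "k differentiable_on UNIV"
    unfolding k differentiable_on_def differentiable_def using has_derivative_prod_bump by blast
  fix e :: 'a assume e: "e \<in> Basis"
  have "dderiv e k = (\<lambda>x. (c * a) * (\<Prod>b\<in>Basis. bump ((p(e := bump_next (p e) (n e))) b) ((n(e := n e + 2)) b) (a * (x \<bullet> b))))"
  proof
    fix x
    have "dderiv e k x = c * (\<Sum>b\<in>Basis. (bump (bump_next (p b) (n b)) (n b + 2) (a * (x \<bullet> b)) * (a * (e \<bullet> b))) * (\<Prod>b'\<in>Basis - {b}. bump (p b') (n b') (a * (x \<bullet> b'))))"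
      unfolding k by (rule dderiv_eqI[OF has_derivative_prod_bump])
    also have "(\<Sum>b\<in>Basis. (bump (bump_next (p b) (n b)) (n b + 2) (a * (x \<bullet> b)) * (a * (e \<bullet> b))) * (\<Prod>b'\<in>Basis - {b}. bump (p b') (n b') (a * (x \<bullet> b'))))
      = (\<Sum>b\<in>Basis. if b = e then (bump (bump_next (p b) (n b)) (n b + 2) (a * (x \<bullet> b)) * a) * (\<Prod>b'\<in>Basis - {b}. bump (p b') (n b') (a * (x \<bullet> b'))) else 0)"
      using e by (intro sum.cong) (auto simp: inner_Basis)
    also have "\<dots> = (bump (bump_next (p e) (n e)) (n e + 2) (a * (x \<bullet> e)) * a) * (\<Prod>b'\<in>Basis - {e}. bump (p b') (n b') (a * (x \<bullet> b')))"
      using e by simp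
    also have "(\<Prod>b'\<in>Basis - {e}. bump (p b') (n b') (a * (x \<bullet> b'))) = (\<Prod>b\<in>Basis - {e}. bump ((p(e := bump_next (p e) (n e))) b) ((n(e := n e + 2)) b) (a * (x \<bullet> b)))"
      by (intro prod.cong) auto
    finally show "dderiv e k x = (c * a) * (\<Prod>b\<in>Basis. bump ((p(e := bump_next (p e) (n e))) b) ((n(e := n e + 2)) b) (a * (x \<bullet> b)))"
      using prod.remove[OF finite_Basis e, of "\<lambda>b. bump ((p(e := bump_next (p e) (n e))) b) ((n(e := n e + 2)) b) (a * (x \<bullet> b))"]
      by (simp add: mult_ac)
  qed
  then show "dderiv e k \<in> {(\<lambda>x::'a. c * (\<Prod>b\<in>Basis. bump (p b) (n b) (a * (x \<bullet> b)))) | c p n. True}" by blast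
qed

text \<open>The dilation by \<open>2 * real DIM('a)\<close> confines each coordinate to absolute
  value below \<open>1 / (2 * real DIM('a))\<close> on the set where the product is non-zero; the
  sum of these values, and with it the norm, is then below \<open>1 / 2\<close>.\<close>

definition eta_raw :: "'a::euclidean_space \<Rightarrow> real" where
  "eta_raw x = (\<Prod>b\<in>Basis. bump 1 0 (2 * real DIM('a) * (x \<bullet> b)))"

text \<open>The mollifier of scale \<open>l\<close> lives in the ball of radius
  \<open>l / 2\<close>. The half makes two successive mollifications look no further than the ball
  of radius \<open>l\<close>, which is exactly where a blow up gives control.\<close>

definition eta :: "real \<Rightarrow> 'a::euclidean_space \<Rightarrow> real" where
  "eta l x = eta_raw (x /\<^sub>R l) / (l ^ DIM('a) * (\<integral>y. eta_raw y \<partial>(lborel :: 'a measure)))"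

lemma eta_raw_nonneg: "eta_raw x \<ge> 0"
  unfolding eta_raw_def by (intro prod_nonneg) (simp add: bump_def)

lemma eta_raw_support: "eta_raw (x::'a::euclidean_space) \<noteq> 0 \<Longrightarrow> norm x < 1 / 2"
proof -
  assume "eta_raw x \<noteq> 0"
  then have nz: "bump 1 0 (2 * real DIM('a) * (x \<bullet> b)) \<noteq> 0" if "b \<in> Basis" for b
    using that unfolding eta_raw_def by (metis finite_Basis prod_zero_iff)
  have "\<bar>x \<bullet> b\<bar> < 1 / (2 * real DIM('a))" if "b \<in> Basis" for b
  proof -
    have "\<bar>2 * real DIM('a) * (x \<bullet> b)\<bar> < 1" using nz[OF that] by (auto simp: bump_def split: if_splits)
    then have "2 * real DIM('a) * \<bar>x \<bullet> b\<bar> < 1" by (simp add: abs_mult)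
    then show ?thesis using DIM_positive[where 'a='a] by (simp add: field_simps)
  qed
  then have "(\<Sum>b\<in>Basis. \<bar>x \<bullet> b\<bar>) < (\<Sum>b\<in>(Basis::'a set). 1 / (2 * real DIM('a)))" by (intro sum_strict_mono) auto
  also have "\<dots> = 1 / 2" using DIM_positive[where 'a='a] by simp
  finally show ?thesis using norm_le_l1[of x] by simp
qed

lemma eta_raw_smooth: "smooth_fun (\<lambda>x. c * eta_raw (a *\<^sub>R x))"
  using smooth_fun_prod_bump[of c "\<lambda>_. 1" "\<lambda>_. 0" "2 * real DIM('a) * a"]
  by (simp add: eta_raw_def mult.assoc)

lemma eta_raw_props:
  shows "continuous_on UNIV (eta_raw :: 'a::euclidean_space \<Rightarrow> real)" "integrable lborel (eta_raw :: 'a \<Rightarrow> real)"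
    "(\<integral>y. eta_raw y \<partial>(lborel :: 'a measure)) > 0"
proof -
  have "smooth_fun (\<lambda>x::'a. 1 * eta_raw (1 *\<^sub>R x))" by (rule eta_raw_smooth)
  then show c: "continuous_on UNIV (eta_raw :: 'a \<Rightarrow> real)"
    using smooth_fun_continuous by fastforce
  show i: "integrable lborel (eta_raw :: 'a \<Rightarrow> real)"
    by (rule continuous_bounded_support[OF c, of "1/2"]) (use eta_raw_support in force)
  \<comment> \<open>If the integral were zero, continuity would turn vanishing almost everywhere
    into vanishing everywhere, against the positive value at the origin.\<close>
  have "(\<integral>y. eta_raw y \<partial>(lborel :: 'a measure)) \<noteq> 0"
  proof
    assume "(\<integral>y. eta_raw y \<partial>(lborel :: 'a measure)) = 0"
    then have ae: "AE y in (lborel :: 'a measure). eta_raw y = 0"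
      using integral_nonneg_eq_0_iff_AE[OF i] eta_raw_nonneg by auto
    have "closed {y::'a. eta_raw y = 0}"
      using continuous_closed_preimage_constant[OF c] by simp
    moreover have "AE y in (lebesgue :: 'a measure). y \<in> {y. eta_raw y = 0}"
      using ae by (simp add: AE_completion)
    ultimately have "(0::'a) \<in> {y. eta_raw y = 0}" by (rule mem_closed_if_AE_lebesgue)
    then show False by (simp add: eta_raw_def bump_def)
  qed
  moreover have "(\<integral>y. eta_raw y \<partial>(lborel :: 'a measure)) \<ge> 0"
    by (rule Bochner_Integration.integral_nonneg) (rule eta_raw_nonneg)
  ultimately show "(\<integral>y. eta_raw y \<partial>(lborel :: 'a measure)) > 0" by linarith
qed

context
  fixes l :: real assumes l: "l > 0"
begin

lemma eta_smooth: "smooth_fun (eta l :: 'a::euclidean_space \<Rightarrow> real)"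
  using eta_raw_smooth[where 'a='a, of "1 / (l ^ DIM('a) * (\<integral>y. eta_raw y \<partial>(lborel :: 'a measure)))" "inverse l"]
  by (simp add: eta_def[abs_def])

lemma eta_nonneg: "eta l (x::'a::euclidean_space) \<ge> 0"
  unfolding eta_def using l eta_raw_props(3)[where 'a='a] eta_raw_nonneg by (intro divide_nonneg_nonneg) auto

lemma eta_even: "eta l (- (x::'a::euclidean_space)) = eta l x"
proof -
  have "bump 1 0 (- y) = bump 1 0 y" for y by (simp add: bump_def)
  then have "eta_raw (- y) = eta_raw y" for y :: 'a by (simp add: eta_raw_def)
  then show ?thesis by (simp add: eta_def)
qed

lemma eta_support: "eta l (x::'a::euclidean_space) \<noteq> 0 \<Longrightarrow> norm x < l / 2"
  using l eta_raw_support[of "x /\<^sub>R l"] by (auto simp: eta_def field_simps)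

lemma eta_zero: "norm (x::'a::euclidean_space) > l / 2 \<Longrightarrow> eta l x = 0"
  using eta_support[of x] by linarith

lemma eta_scale: "eta l (x::'a::euclidean_space) = eta 1 (x /\<^sub>R l) / l ^ DIM('a)"
  by (simp add: eta_def)

lemma eta_measurable: "eta l \<in> borel_measurable (borel :: 'a::euclidean_space measure)"
  by (rule smooth_fun_measurable[OF eta_smooth])

lemma eta_integrable: "integrable lborel (eta l :: 'a::euclidean_space \<Rightarrow> real)"
  by (rule continuous_bounded_support[OF smooth_fun_continuous[OF eta_smooth] eta_zero])

lemma eta_integral: "(\<integral>x. eta l (x::'a::euclidean_space) \<partial>lborel) = 1"
proof -
  have "(\<integral>x. eta_raw x \<partial>(lborel::'a measure)) = inverse l ^ DIM('a) * (\<integral>x. eta_raw (x /\<^sub>R l) \<partial>(lborel::'a measure))"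
    using integral_lborel_affine[of "inverse l" eta_raw "0::'a"] l
      borel_measurable_continuous_onI[OF eta_raw_props(1)[where 'a='a]] by simp
  then have e: "(\<integral>x. eta_raw (x /\<^sub>R l) \<partial>(lborel::'a measure)) = l ^ DIM('a) * (\<integral>x. eta_raw x \<partial>(lborel::'a measure))"
    using l by (simp add: power_inverse)
  have "l ^ DIM('a) * (\<integral>x. eta_raw x \<partial>(lborel::'a measure)) \<noteq> 0"
    using l eta_raw_props(3)[where 'a='a] by simp
  then show ?thesis unfolding eta_def by (simp only: integral_divide_zero e) simp
qed

lemma eta_bounded: "\<exists>B. \<forall>x::'a::euclidean_space. \<bar>eta l x\<bar> \<le> B"
  by (rule continuous_bounded_support[OF smooth_fun_continuous[OF eta_smooth] eta_zero])

lemma deta_zero: "norm (x::'a::euclidean_space) > l / 2 \<Longrightarrow> dderiv b (eta l) x = 0"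
  by (rule dderiv_zero_outside[OF eta_smooth eta_zero])

lemma deta_props:
  assumes "b \<in> Basis"
  shows "continuous_on UNIV (dderiv b (eta l :: 'a::euclidean_space \<Rightarrow> real))"
    "integrable lborel (dderiv b (eta l :: 'a::euclidean_space \<Rightarrow> real))"
    "\<exists>B. \<forall>x::'a. \<bar>dderiv b (eta l) x\<bar> \<le> B"
    "dderiv b (eta l :: 'a \<Rightarrow> real) \<in> borel_measurable borel"
proof -
  have s: "smooth_fun (dderiv b (eta l :: 'a::euclidean_space \<Rightarrow> real))" by (rule smooth_fun_dderiv[OF eta_smooth assms])
  show c: "continuous_on UNIV (dderiv b (eta l :: 'a::euclidean_space \<Rightarrow> real))" by (rule smooth_fun_continuous[OF s])
  show "integrable lborel (dderiv b (eta l :: 'a::euclidean_space \<Rightarrow> real))" "\<exists>B. \<forall>x::'a. \<bar>dderiv b (eta l) x\<bar> \<le> B"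
    by (rule continuous_bounded_support[OF c deta_zero]; assumption)+
  show "dderiv b (eta l :: 'a \<Rightarrow> real) \<in> borel_measurable borel" by (rule smooth_fun_measurable[OF s])
qed

end

section \<open>Blow-ups and double mollification\<close>

text \<open>In the variables of a blow up, mollification at scale \<open>l\<close> becomes an
  average of the rescaled function against the unit mollifier; evenness absorbs the
  reflection.\<close>

lemma conv_eta:
  fixes w :: "'a::euclidean_space \<Rightarrow> real"
  assumes l: "l > 0" and [measurable]: "w \<in> borel_measurable borel"
  shows "conv w (eta l) x = (\<integral>a. w (x + l *\<^sub>R a) * eta 1 a \<partial>lborel)"
proof -
  note [measurable] = eta_measurable[OF l, where 'a='a]
  have e: "eta l (- (l *\<^sub>R a)) = eta 1 a / l ^ DIM('a)" for a :: 'a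
    using l by (simp add: eta_even[OF l] eta_scale[OF l, of "l *\<^sub>R a"])
  have "conv w (eta l) x = \<bar>l\<bar> ^ DIM('a) * (\<integral>a. w (x + l *\<^sub>R a) * eta l (x - (x + l *\<^sub>R a)) \<partial>lborel)"
    unfolding conv_def using l by (intro integral_lborel_affine) auto
  also have "\<dots> = (\<integral>a. l ^ DIM('a) * (w (x + l *\<^sub>R a) * eta l (x - (x + l *\<^sub>R a))) \<partial>lborel)"
    using l by simp
  also have "\<dots> = (\<integral>a. w (x + l *\<^sub>R a) * eta 1 a \<partial>lborel)"
    using l by (intro Bochner_Integration.integral_cong) (auto simp: e)
  finally show ?thesis .
qed

lemma conv_diff:
  fixes B :: real
  assumes "integrable lborel f" "integrable lborel g" "k \<in> borel_measurable borel" "\<And>x. \<bar>k x\<bar> \<le> B"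
  shows "conv (\<lambda>x. f x - g x) k z = conv f k z - conv g k z"
  using conv_integrable[OF assms(1,3,4)] conv_integrable[OF assms(2,3,4)] by (simp add: conv_def left_diff_distrib)

text \<open>The outer kernel selects points of norm below \<open>1 / 2\<close>, and the inner one
  averages around them within distance \<open>1 / 2\<close>. Only the unit ball enters, so cutting
  the rescaled function off outside it changes nothing.\<close>

lemma double_conv_eta_rescale:
  fixes w :: "'a::euclidean_space \<Rightarrow> real"
  assumes l: "l > 0" and [measurable]: "w \<in> borel_measurable borel"
  shows "conv (conv w (eta l)) (eta l) y =
    conv (conv (\<lambda>z. indicator (ball 0 1) z * w (y + l *\<^sub>R z)) (eta 1)) (eta 1) 0"
proof -
  note [measurable] = eta_measurable[OF l, where 'a='a] eta_measurable[of 1, OF zero_less_one, where 'a='a]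
  let ?W = "\<lambda>z. w (y + l *\<^sub>R z)" and ?W1 = "\<lambda>z. indicator (ball 0 1) z * w (y + l *\<^sub>R z)"
  have 1: "conv w (eta l) (y + l *\<^sub>R b) = conv ?W (eta 1) b" for b
    using conv_eta[OF l, of w "y + l *\<^sub>R b"] conv_eta[of 1 ?W b] by (simp add: scaleR_add_right add.assoc)
  have 2: "conv ?W (eta 1) b = conv ?W1 (eta 1) b" if "norm b < 1 / 2" for b
    unfolding conv_def
  proof (rule Bochner_Integration.integral_cong[OF refl])
    fix z :: 'a
    show "w (y + l *\<^sub>R z) * eta 1 (b - z) = indicator (ball 0 1) z * w (y + l *\<^sub>R z) * eta 1 (b - z)"
    proof (cases "eta 1 (b - z) = 0")
      case False
      then have "norm (b - z) < 1 / 2" using eta_support[of 1 "b - z"] by simp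
      then have "norm z < 1" using that norm_triangle_ineq4[of b "b - z"] by simp
      then show ?thesis by simp
    qed simp
  qed
  have "conv (conv w (eta l)) (eta l) y = (\<integral>b. conv ?W (eta 1) b * eta 1 b \<partial>lborel)"
    by (subst conv_eta[OF l]) (auto simp: 1)
  also have "\<dots> = (\<integral>b. conv ?W1 (eta 1) b * eta 1 b \<partial>lborel)"
  proof (rule Bochner_Integration.integral_cong[OF refl])
    fix b :: 'a
    show "conv ?W (eta 1) b * eta 1 b = conv ?W1 (eta 1) b * eta 1 b"
      using 2[of b] eta_support[of 1 b] by (cases "eta 1 b = 0") auto
  qed
  also have "\<dots> = conv (conv ?W1 (eta 1)) (eta 1) 0"
  proof -
    have [measurable]: "ball (0::'a) 1 \<in> sets borel" by simp
    have "?W1 \<in> borel_measurable borel" by measurable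
    then have "conv ?W1 (eta 1) \<in> borel_measurable borel"
      by (rule conv_measurable[OF _ eta_measurable[OF zero_less_one]])
    from conv_eta[OF zero_less_one this, of 0] show ?thesis by simp
  qed
  finally show ?thesis .
qed

text \<open>The limit is the double mollification, at the origin, of the profile \<open>v\<close>
  extended by zero; for a non-constant \<open>v\<close> it depends on the kernel. The error is at
  most the kernel bound \<open>M\<close> times the L1 distance \<open>E n\<close> of the rescaled
  function from the profile.\<close>

lemma blowup_imp_convergent:
  fixes w v :: "'a::euclidean_space \<Rightarrow> real"
  assumes w[measurable]: "w \<in> borel_measurable borel" and C: "\<And>x. \<bar>w x\<bar> \<le> C"
    and v: "set_integrable lborel (ball 0 1) v"
    and lim: "((\<lambda>l. \<integral>\<^sup>+ z \<in> ball 0 1. ennreal \<bar>w (y + l *\<^sub>R z) - v z\<bar> \<partial>lborel) \<longlongrightarrow> 0) (at_right 0)"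
    and ls: "ls \<longlonglongrightarrow> 0" "\<And>n. ls n > (0::real)"
  shows "convergent (\<lambda>n. conv (conv w (eta (ls n))) (eta (ls n)) y)"
proof -
  let ?v = "\<lambda>z. indicator (ball 0 1) z * v z"
  let ?W = "\<lambda>n z. indicator (ball 0 1) z * w (y + ls n *\<^sub>R z)"
  let ?g = "\<lambda>n z. ?W n z - ?v z"
  note em[measurable] = eta_measurable[of 1, OF zero_less_one, where 'a='a]
  obtain M where M: "\<And>x::'a. \<bar>eta 1 x\<bar> \<le> M" using eta_bounded[of 1] by auto
  have vi: "integrable lborel ?v" using v by (simp add: set_integrable_def)
  have [measurable]: "?v \<in> borel_measurable borel" using vi by auto
  have Wi: "integrable lborel (?W n)" for n
    using emeasure_lborel_ball_finite[of "0::'a" 1] C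
    by (intro integrable_mult_bounded(1)[where C=C]) (auto intro!: integrable_real_indicator)
  have gi: "integrable lborel (?g n)" for n using vi Wi by simp
  define E where "E n = (\<integral>z. \<bar>?g n z\<bar> \<partial>lborel)" for n
  have E: "E \<longlonglongrightarrow> 0"
  proof -
    have "filterlim ls (at_right 0) sequentially"
      using ls by (intro tendsto_imp_filterlim_at_right) auto
    from filterlim_compose[OF lim this]
    have 1: "(\<lambda>n. \<integral>\<^sup>+ z \<in> ball 0 1. ennreal \<bar>w (y + ls n *\<^sub>R z) - v z\<bar> \<partial>lborel) \<longlonglongrightarrow> ennreal 0" by simp
    have "(\<integral>\<^sup>+ z \<in> ball 0 1. ennreal \<bar>w (y + ls n *\<^sub>R z) - v z\<bar> \<partial>lborel) = ennreal (E n)" for n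
    proof -
      have "(\<integral>\<^sup>+ z \<in> ball 0 1. ennreal \<bar>w (y + ls n *\<^sub>R z) - v z\<bar> \<partial>lborel) = (\<integral>\<^sup>+ z. ennreal \<bar>?g n z\<bar> \<partial>lborel)"
        by (intro nn_integral_cong) (auto simp: indicator_def)
      also have "\<dots> = ennreal (E n)"
        unfolding E_def using gi[of n] by (intro nn_integral_eq_integral) auto
      finally show ?thesis .
    qed
    then have "(\<lambda>n. ennreal (E n)) \<longlonglongrightarrow> ennreal 0" using 1 by simp
    moreover have "E n \<ge> 0" for n unfolding E_def by (rule Bochner_Integration.integral_nonneg) simp
    ultimately show ?thesis using tendsto_ennreal_iff[of E sequentially 0] by simp
  qed
  define L where "L = conv (conv ?v (eta 1)) (eta 1) 0"
  have bnd: "\<bar>conv (conv w (eta (ls n))) (eta (ls n)) y - L\<bar> \<le> M * E n" for n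
  proof -
    have ci: "integrable lborel (\<lambda>x. conv f (eta 1) x * eta 1 (0 - x))" if "integrable lborel f" for f :: "'a \<Rightarrow> real"
    proof (rule integrable_mult_bounded(2)[where C="M * (\<integral>w. \<bar>f w\<bar> \<partial>lborel)"])
      show "integrable lborel (\<lambda>x::'a. eta 1 (0 - x))"
        using integrable_lborel_shift(2)[OF eta_integrable[of 1, OF zero_less_one]] by blast
      show "conv f (eta 1) \<in> borel_measurable lborel" using that em by auto
      show "\<bar>conv f (eta 1) z\<bar> \<le> M * (\<integral>w. \<bar>f w\<bar> \<partial>lborel)" for z by (rule conv_bound_L1[OF that em M])
    qed
    have "conv (conv w (eta (ls n))) (eta (ls n)) y - L = conv (conv (?W n) (eta 1)) (eta 1) 0 - conv (conv ?v (eta 1)) (eta 1) 0"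
      unfolding L_def by (subst double_conv_eta_rescale[OF ls(2) w]) simp
    also have "\<dots> = (\<integral>x. (conv (?W n) (eta 1) x - conv ?v (eta 1) x) * eta 1 (0 - x) \<partial>lborel)"
      unfolding conv_def[of "conv f (eta 1)" for f] left_diff_distrib using ci[OF Wi[of n]] ci[OF vi] by simp
    also have "\<dots> = conv (conv (?g n) (eta 1)) (eta 1) 0"
      unfolding conv_def[of "conv f (eta 1)" for f] conv_diff[OF Wi vi em M] by simp
    finally show ?thesis
      using conv_bound_sup[of "conv (?g n) (eta 1)" "M * E n" "eta 1" 0] conv_bound_L1[OF gi em M]
        eta_nonneg[of 1] eta_integrable[of 1] eta_integral[of 1] gi[of n] unfolding E_def
      by auto
  qed
  have "(\<lambda>n. conv (conv w (eta (ls n))) (eta (ls n)) y - L) \<longlonglongrightarrow> 0"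
  proof (rule Lim_null_comparison)
    show "\<forall>\<^sub>F n in sequentially. norm (conv (conv w (eta (ls n))) (eta (ls n)) y - L) \<le> M * E n"
      using bnd by simp
    show "(\<lambda>n. M * E n) \<longlonglongrightarrow> 0" using tendsto_mult[OF tendsto_const E, of M] by simp
  qed
  then show ?thesis unfolding convergent_def using LIM_zero_iff by blast
qed

text \<open>The scales form a sequence, so that the null sets excluded at the individual scales have
  a null union.\<close>

locale moll_seq =
  fixes ls :: "nat \<Rightarrow> real"
  assumes ls0: "ls \<longlonglongrightarrow> 0" and ls_pos: "\<And>n. ls n > 0"
begin

abbreviation en :: "nat \<Rightarrow> 'a::euclidean_space \<Rightarrow> real" where "en n \<equiv> eta (ls n)"

lemma en_L1_tendsto:
  fixes g :: "'a::euclidean_space \<Rightarrow> real"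
  assumes "integrable lborel g"
  shows "L1_tendsto lborel (\<lambda>n. conv g (en n)) g"
proof (rule L1_tendsto_conv[OF assms eta_nonneg[OF ls_pos] eta_integrable[OF ls_pos] eta_integral[OF ls_pos]])
  show "norm \<tau> \<le> ls n" if "en n \<tau> \<noteq> 0" for n and \<tau> :: 'a
    using eta_support[OF ls_pos that] ls_pos[of n] by simp
qed (rule ls0)

text \<open>The outer kernel concentrates at \<open>y\<close>, where \<open>\<phi>\<close> is
  continuous, so the weight comes out as the factor \<open>\<phi> y\<close>; the error is controlled
  by the uniform bound \<open>C\<close> on the mollified \<open>w\<close>.\<close>

lemma double_mollification_weighted:
  fixes w \<phi> :: "'a::euclidean_space \<Rightarrow> real"
  assumes w[measurable]: "w \<in> borel_measurable borel" and C: "\<And>x. \<bar>w x\<bar> \<le> C"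
    and \<phi>: "continuous_on UNIV \<phi>" "\<And>x. \<bar>\<phi> x\<bar> \<le> B"
    and lim: "(\<lambda>n. conv (conv w (en n)) (en n) y) \<longlonglongrightarrow> V"
  shows "(\<lambda>n. conv (\<lambda>x. \<phi> x * conv w (en n) x) (en n) y) \<longlonglongrightarrow> \<phi> y * V"
proof -
  note [measurable] = eta_measurable[OF ls_pos, where 'a='a] borel_measurable_continuous_onI[OF \<phi>(1)]
  have C0: "C \<ge> 0" using C[of undefined] by linarith
  have wb: "\<bar>conv w (en n) x\<bar> \<le> C" for n x
    by (rule conv_bound_sup[OF w C eta_nonneg[OF ls_pos] eta_integrable[OF ls_pos] eta_integral[OF ls_pos]])
  have ei: "integrable lborel (\<lambda>x. en n (y - x))" for n
    using integrable_lborel_shift(2)[OF eta_integrable[OF ls_pos]] by blast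
  have ei1: "(\<integral>x. en n (y - x) \<partial>lborel) = 1" for n
    using integral_lborel_reflect[of "en n" y] eta_integral[OF ls_pos, where 'a='a] by simp
  have i1: "integrable lborel (\<lambda>x. (\<phi> x * conv w (en n) x) * en n (y - x))" for n
  proof (rule integrable_mult_bounded(2)[OF ei, where C="B * C"])
    show "\<bar>\<phi> x * conv w (en n) x\<bar> \<le> B * C" for x
      unfolding abs_mult using \<phi>(2)[of x] wb[of n x] by (intro mult_mono) auto
  qed measurable
  have i2: "integrable lborel (\<lambda>x. conv w (en n) x * en n (y - x))" for n
    by (rule integrable_mult_bounded(2)[OF ei _ wb]) measurable
  let ?d = "\<lambda>n. conv (\<lambda>x. \<phi> x * conv w (en n) x) (en n) y - \<phi> y * conv (conv w (en n)) (en n) y"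
  have "?d \<longlonglongrightarrow> 0"
  proof (rule LIMSEQ_I)
    fix r :: real assume r: "r > 0"
    \<comment> \<open>Adding 1 to the denominator covers the case \<open>C = 0\<close>.\<close>
    define e where "e = r / (C + 1)"
    have e: "e > 0" "e * C < r" using r C0 by (auto simp: e_def field_simps)
    have "isCont \<phi> y" using \<phi>(1) by (simp add: continuous_on_eq_continuous_at)
    then obtain d where d: "d > 0" "\<And>x. dist x y < d \<Longrightarrow> \<bar>\<phi> x - \<phi> y\<bar> < e"
      using e(1) by (auto simp: continuous_at_eps_delta dist_real_def)
    obtain N where N: "\<And>n. n \<ge> N \<Longrightarrow> \<bar>ls n\<bar> < d" using LIMSEQ_D[OF ls0 d(1)] by auto
    have "\<bar>?d n\<bar> < r" if "n \<ge> N" for n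
    proof -
      have "?d n = (\<integral>x. ((\<phi> x - \<phi> y) * conv w (en n) x) * en n (y - x) \<partial>lborel)"
        unfolding conv_def[of _ "en n" y] using i1[of n] i2[of n]
        by (subst integral_mult_right_zero[symmetric], subst Bochner_Integration.integral_diff[symmetric])
           (auto simp: algebra_simps)
      also have "\<bar>\<dots>\<bar> \<le> (\<integral>x. (e * C) * en n (y - x) \<partial>lborel)"
      proof (rule integral_abs_le)
        have "integrable lborel (\<lambda>x. (\<phi> x * conv w (en n) x) * en n (y - x) - \<phi> y * (conv w (en n) x * en n (y - x)))"
          using i1[of n] i2[of n] by simp
        then show "integrable lborel (\<lambda>x. ((\<phi> x - \<phi> y) * conv w (en n) x) * en n (y - x))"
          by (simp add: algebra_simps)
        show "integrable lborel (\<lambda>x. (e * C) * en n (y - x))" using ei by simp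
        fix x
        show "\<bar>((\<phi> x - \<phi> y) * conv w (en n) x) * en n (y - x)\<bar> \<le> (e * C) * en n (y - x)"
        proof (cases "en n (y - x) = 0")
          case False
          then have "norm (y - x) < d" using eta_support[OF ls_pos False] N[OF that] ls_pos[of n] by linarith
          then have "\<bar>\<phi> x - \<phi> y\<bar> \<le> e" using d(2)[of x] by (simp add: dist_norm norm_minus_commute)
          then show ?thesis
            unfolding abs_mult using wb[of n x] eta_nonneg[OF ls_pos, of n "y - x"] e(1)
            by (intro mult_mono) auto
        qed simp
      qed
      also have "\<dots> = e * C" using ei1[of n] by simp
      finally show ?thesis using e by simp
    qed
    then show "\<exists>no. \<forall>n\<ge>no. norm (?d n - 0) < r" by auto
  qed
  from tendsto_add[OF this tendsto_mult[OF tendsto_const lim, of "\<phi> y"]] show ?thesis by simp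
qed

text \<open>The mollifiers are even, so both mollifications can be moved onto the weighted function,
  where the blow-up gives a pointwise limit.\<close>

lemma pairing:
  fixes w \<phi> V H :: "'a::euclidean_space \<Rightarrow> real"
  assumes \<mu>: "sets \<mu> = sets borel" "finite_measure \<mu>" and H: "integrable \<mu> H"
    and w[measurable]: "w \<in> borel_measurable borel" and C: "\<And>x. \<bar>w x\<bar> \<le> C"
    and \<phi>: "continuous_on UNIV \<phi>" "\<And>x. \<bar>\<phi> x\<bar> \<le> B" "\<And>x. norm x > R \<Longrightarrow> \<phi> x = 0"
  defines "p \<equiv> \<lambda>n x. (\<phi> x * conv w (en n) x) * (\<integral>y. en n (x - y) * H y \<partial>\<mu>)"
  shows "integrable lborel (p n)" "\<bar>\<integral>x. p n x \<partial>lborel\<bar> \<le> B * C * (\<integral>y. \<bar>H y\<bar> \<partial>\<mu>)"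
    "V \<in> borel_measurable borel \<Longrightarrow> AE y in \<mu>. H y = 0 \<or> (\<lambda>n. conv (conv w (en n)) (en n) y) \<longlonglongrightarrow> V y \<Longrightarrow>
      (\<lambda>n. \<integral>x. p n x \<partial>lborel) \<longlonglongrightarrow> (\<integral>y. \<phi> y * V y * H y \<partial>\<mu>)"
proof -
  interpret finite_measure \<mu> by fact
  interpret P: pair_sigma_finite "lborel :: 'a measure" \<mu> ..
  note [measurable_cong] = \<mu>(1)
  note em[measurable] = eta_measurable[OF ls_pos, where 'a='a] 
  note [measurable] = borel_measurable_continuous_onI[OF \<phi>(1)]
  have [measurable]: "H \<in> borel_measurable \<mu>" using H by auto
  have B0: "B \<ge> 0" using \<phi>(2)[of undefined] by linarith
  have C0: "C \<ge> 0" using C[of undefined] by linarith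
  have wb: "\<bar>conv w (en n) x\<bar> \<le> C" for n x
    by (rule conv_bound_sup[OF w C eta_nonneg[OF ls_pos] eta_integrable[OF ls_pos] eta_integral[OF ls_pos]])
  have pw: "\<bar>\<phi> x * conv w (en n) x\<bar> \<le> B * C" for n x
    unfolding abs_mult using \<phi>(2)[of x] wb[of n x] by (intro mult_mono) auto
  have \<phi>i: "integrable lborel \<phi>" by (rule continuous_bounded_support[OF \<phi>(1,3)])
  have ai: "integrable lborel (\<lambda>x. \<phi> x * conv w (en n) x)" for n
    by (rule integrable_mult_bounded(1)[OF \<phi>i _ wb]) measurable
  have fub: "integrable (lborel \<Otimes>\<^sub>M \<mu>) (\<lambda>(x, y). (\<phi> x * conv w (en n) x) * (en n (x - y) * H y))" for n
  proof -
    obtain M where M: "\<And>x::'a. \<bar>en n x\<bar> \<le> M" using eta_bounded[OF ls_pos] by auto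
    have hi: "integrable \<mu> (\<lambda>y. en n (x - y) * H y)" for x
      by (rule integrable_mult_bounded(2)[OF H _ M]) measurable
    show ?thesis
    proof (rule P.Fubini_integrable)
      show "(\<lambda>(x, y). (\<phi> x * conv w (en n) x) * (en n (x - y) * H y)) \<in> borel_measurable (lborel \<Otimes>\<^sub>M \<mu>)"
        by measurable
      show "AE x in lborel. integrable \<mu> (\<lambda>y. case (x, y) of (x, y) \<Rightarrow> (\<phi> x * conv w (en n) x) * (en n (x - y) * H y))"
        using hi by simp
      show "integrable lborel (\<lambda>x. \<integral>y. norm (case (x, y) of (x, y) \<Rightarrow> (\<phi> x * conv w (en n) x) * (en n (x - y) * H y)) \<partial>\<mu>)"
      proof (rule Bochner_Integration.integrable_bound)
        show "integrable lborel (\<lambda>x. (\<phi> x * conv w (en n) x) * (M * (\<integral>y. \<bar>H y\<bar> \<partial>\<mu>)))" using ai by simp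
        show "AE x in lborel. norm (\<integral>y. norm (case (x, y) of (x, y) \<Rightarrow> (\<phi> x * conv w (en n) x) * (en n (x - y) * H y)) \<partial>\<mu>)
           \<le> norm ((\<phi> x * conv w (en n) x) * (M * (\<integral>y. \<bar>H y\<bar> \<partial>\<mu>)))"
        proof (rule AE_I2)
          fix x :: 'a
          have M0: "M \<ge> 0" using M[of x] by linarith
          have "(\<integral>y. \<bar>en n (x - y) * H y\<bar> \<partial>\<mu>) \<le> (\<integral>y. M * \<bar>H y\<bar> \<partial>\<mu>)"
            by (rule integral_mono[OF integrable_abs[OF hi]]) (use H M in \<open>auto simp: abs_mult intro!: mult_right_mono\<close>)
          then have "(\<integral>y. \<bar>en n (x - y) * H y\<bar> \<partial>\<mu>) \<le> M * (\<integral>y. \<bar>H y\<bar> \<partial>\<mu>)" by simp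
          then have "\<bar>\<phi> x * conv w (en n) x\<bar> * (\<integral>y. \<bar>en n (x - y) * H y\<bar> \<partial>\<mu>) \<le> \<bar>\<phi> x * conv w (en n) x\<bar> * (M * (\<integral>y. \<bar>H y\<bar> \<partial>\<mu>))"
            by (rule mult_left_mono) simp
          moreover have "(\<integral>y. \<bar>en n (x - y) * H y\<bar> \<partial>\<mu>) \<ge> 0" "(\<integral>y. \<bar>H y\<bar> \<partial>\<mu>) \<ge> 0"
            by (auto intro: Bochner_Integration.integral_nonneg)
          ultimately show "norm (\<integral>y. norm (case (x, y) of (x, y) \<Rightarrow> (\<phi> x * conv w (en n) x) * (en n (x - y) * H y)) \<partial>\<mu>)
           \<le> norm ((\<phi> x * conv w (en n) x) * (M * (\<integral>y. \<bar>H y\<bar> \<partial>\<mu>)))"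
            using M0 unfolding prod.case real_norm_def abs_mult[of "\<phi> x * conv w (en n) x"] integral_mult_right_zero by simp
        qed
      qed measurable
    qed
  qed
  have pe: "p n = (\<lambda>x. \<integral>y. (\<phi> x * conv w (en n) x) * (en n (x - y) * H y) \<partial>\<mu>)" for n
    unfolding p_def by (simp add: fun_eq_iff)
  show "integrable lborel (p n)"
    unfolding pe using P.integrable_fst[OF fub[of n]] by simp
  let ?q = "\<lambda>n. conv (\<lambda>x. \<phi> x * conv w (en n) x) (en n)"
  have qm[measurable]: "?q n \<in> borel_measurable borel" for n by measurable
  have qb: "\<bar>?q n y\<bar> \<le> B * C" for n y
    by (rule conv_bound_sup[OF _ pw eta_nonneg[OF ls_pos] eta_integrable[OF ls_pos] eta_integral[OF ls_pos]]) measurable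
  have main: "(\<integral>x. p n x \<partial>lborel) = (\<integral>y. ?q n y * H y \<partial>\<mu>)" for n
  proof -
    have "(\<integral>x. p n x \<partial>lborel) = (\<integral>y. (\<integral>x. (\<phi> x * conv w (en n) x) * (en n (x - y) * H y) \<partial>lborel) \<partial>\<mu>)"
      unfolding pe using P.Fubini_integral[OF fub[of n]] by simp
    also have "\<dots> = (\<integral>y. ?q n y * H y \<partial>\<mu>)"
    proof (rule Bochner_Integration.integral_cong[OF refl])
      fix y
      have "(\<integral>x. (\<phi> x * conv w (en n) x) * (en n (x - y) * H y) \<partial>lborel) = (\<integral>x. ((\<phi> x * conv w (en n) x) * en n (y - x)) * H y \<partial>lborel)"
        using eta_even[OF ls_pos, of n "y - x" for x]
        by (intro Bochner_Integration.integral_cong) auto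
      then show "(\<integral>x. (\<phi> x * conv w (en n) x) * (en n (x - y) * H y) \<partial>lborel) = ?q n y * H y"
        by (simp add: conv_def[of _ "en n" y])
    qed
    finally show ?thesis .
  qed
  have qi: "integrable \<mu> (\<lambda>y. ?q n y * H y)" for n
    by (rule integrable_mult_bounded(2)[OF H _ qb]) measurable
  show "\<bar>\<integral>x. p n x \<partial>lborel\<bar> \<le> B * C * (\<integral>y. \<bar>H y\<bar> \<partial>\<mu>)"
  proof -
    have "\<bar>\<integral>y. ?q n y * H y \<partial>\<mu>\<bar> \<le> (\<integral>y. (B * C) * \<bar>H y\<bar> \<partial>\<mu>)"
      using qi H qb by (intro integral_abs_le) (auto simp: abs_mult intro!: mult_right_mono)
    then show ?thesis using main[of n] by simp
  qed
  assume Vm: "V \<in> borel_measurable borel"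
    and ae: "AE y in \<mu>. H y = 0 \<or> (\<lambda>n. conv (conv w (en n)) (en n) y) \<longlonglongrightarrow> V y"
  note [measurable] = Vm
  show "(\<lambda>n. \<integral>x. p n x \<partial>lborel) \<longlonglongrightarrow> (\<integral>y. \<phi> y * V y * H y \<partial>\<mu>)"
    unfolding main
  proof (rule integral_dominated_convergence[where w="\<lambda>y. B * C * \<bar>H y\<bar>"])
    \<comment> \<open>Points without convergence carry no mass: where \<open>H y = 0\<close> both
      sides vanish.\<close>
    show "AE y in \<mu>. (\<lambda>n. ?q n y * H y) \<longlonglongrightarrow> \<phi> y * V y * H y"
      using ae
    proof eventually_elim
      case (elim y)
      then show ?case
      proof
        assume "(\<lambda>n. conv (conv w (en n)) (en n) y) \<longlonglongrightarrow> V y"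
        from tendsto_mult[OF double_mollification_weighted[OF w C \<phi>(1,2) this] tendsto_const]
        show ?thesis .
      qed simp
    qed
    show "AE y in \<mu>. norm (?q n y * H y) \<le> B * C * \<bar>H y\<bar>" for n
      using qb by (intro AE_I2) (auto simp: abs_mult intro!: mult_right_mono)
  qed (use H in auto)
qed

end

section \<open>The nonlinearity on a time slice\<close>

lemma eta_test_fun:
  fixes x :: "'a::euclidean_space"
  assumes l: "l > 0" and sub: "cball x l \<subseteq> U"
  shows "test_fun U (\<lambda>y. eta l (x - y))"
proof -
  have "{y. eta l (x - y) \<noteq> 0} \<subseteq> cball x l"
    using eta_support[OF l] l by (force simp: dist_norm)
  then have c: "closure {y. eta l (x - y) \<noteq> 0} \<subseteq> cball x l" by (simp add: closure_minimal)
  then have "compact (closure {y. eta l (x - y) \<noteq> 0})"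
    by (meson bounded_cball bounded_subset closed_closure compact_eq_bounded_closed)
  then show ?thesis using c sub smooth_fun_reflect[OF eta_smooth[OF l]] by (auto simp: test_fun_def)
qed

lemma test_fun_smooth: "test_fun U \<phi> \<Longrightarrow> smooth_fun \<phi>"
  by (simp add: test_fun_def)

lemma test_fun_bounded_support:
  assumes "test_fun U \<phi>"
  obtains R where "\<And>z. norm z > R \<Longrightarrow> \<phi> z = 0"
proof -
  have "bounded (closure {x. \<phi> x \<noteq> 0})" using assms by (simp add: test_fun_def compact_imp_bounded)
  then obtain R where R: "\<And>z. z \<in> closure {x. \<phi> x \<noteq> 0} \<Longrightarrow> norm z \<le> R" by (auto simp: bounded_iff)
  have "\<phi> z = 0" if "norm z > R" for z
    using R[of z] closure_subset[of "{x. \<phi> x \<noteq> 0}"] that by force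
  then show ?thesis using that by blast
qed

text \<open>By compactness the support keeps a positive distance from the complement of
  \<open>U\<close>. Mollifications at scales below this margin only use values inside
  \<open>U\<close>.\<close>

lemma test_fun_margin:
  fixes \<phi> :: "'a::euclidean_space \<Rightarrow> real"
  assumes "test_fun U \<phi>" "open U"
  obtains e where "e > 0" "\<And>z. \<phi> z \<noteq> 0 \<Longrightarrow> cball z e \<subseteq> U"
proof -
  have "compact (closure {x. \<phi> x \<noteq> 0})" "closure {x. \<phi> x \<noteq> 0} \<subseteq> U" using assms by (auto simp: test_fun_def)
  then obtain e where e: "e > 0" "(\<Union>x\<in>closure {x. \<phi> x \<noteq> 0}. cball x e) \<subseteq> U"
    using compact_subset_open_imp_cball_epsilon_subset[OF _ assms(2)] by metis
  have "cball z e \<subseteq> U" if "\<phi> z \<noteq> 0" for z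
    using e(2) closure_subset[of "{x. \<phi> x \<noteq> 0}"] that by blast
  then show ?thesis using that e(1) by blast
qed

lemma axis_in_Basis: "axis j (1::real) \<in> Basis"
  by (simp add: axis_in_Basis_iff)

text \<open>The data of one time slice: \<open>w\<close> is a bounded Borel velocity,
  \<open>H i j\<close> the density with respect to \<open>\<mu>\<close> of the derivative of
  \<open>w i\<close> in direction \<open>j\<close> minus that of \<open>w j\<close> in direction
  \<open>i\<close>, and \<open>V\<close> the limit of the double mollification. The divergence
  condition concerns the mollified field, almost everywhere, because on a slice it is obtained as a
  limit of equations mollified in time.\<close>

locale slice = moll_seq +
  fixes \<Omega> :: "(real^'d::finite) set" and C :: real and w :: "'d \<Rightarrow> real^'d \<Rightarrow> real"
    and \<mu> :: "(real^'d) measure" and H :: "'d \<Rightarrow> 'd \<Rightarrow> real^'d \<Rightarrow> real" and V :: "'d \<Rightarrow> real^'d \<Rightarrow> real"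
  assumes \<Omega>: "open \<Omega>"
    and w_meas[measurable]: "\<And>j. w j \<in> borel_measurable borel" and w_bd: "\<And>j x. \<bar>w j x\<bar> \<le> C"
    and w_int: "\<And>j. integrable lborel (w j)"
    and mu_sets: "sets \<mu> = sets borel" and mu_fin: "finite_measure \<mu>"
    and H_int: "\<And>i j. integrable \<mu> (H i j)" and H_anti: "\<And>i j y. H i j y + H j i y = 0"
    and V_meas[measurable]: "\<And>j. V j \<in> borel_measurable borel" and V_bd: "\<And>j y. \<bar>V j y\<bar> \<le> C"
    and grad: "\<And>\<phi> i j. test_fun \<Omega> \<phi> \<Longrightarrow>
        (\<integral>x. \<phi> x * H i j x \<partial>\<mu>) = - (\<integral>x. w i x * dsp j \<phi> x - w j x * dsp i \<phi> x \<partial>lborel)"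
    and divfree: "\<And>n. AE x in lborel. cball x (ls n) \<subseteq> \<Omega> \<longrightarrow> (\<Sum>j\<in>UNIV. conv (w j) (dsp j (en n)) x) = 0"
    and conv: "AE y in \<mu>. (\<forall>i j. H i j y = 0) \<or> (\<forall>j. (\<lambda>n. conv (conv (w j) (en n)) (en n) y) \<longlonglongrightarrow> V j y)"
begin

abbreviation "wn n j \<equiv> conv (w j) (en n)"
abbreviation "Dw n i j \<equiv> conv (w j) (dsp i (en n))"

lemma den_meas[measurable]: "dsp (i::'d) (en n) \<in> borel_measurable borel"
  unfolding dsp_def by (rule deta_props(4)[OF ls_pos axis_in_Basis])

lemma den_bd: "\<exists>B. \<forall>x. \<bar>dsp (i::'d) (en n) x\<bar> \<le> B"
  unfolding dsp_def by (rule deta_props(3)[OF ls_pos axis_in_Basis])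

lemma en_meas[measurable]: "en n \<in> borel_measurable (borel :: (real^'d) measure)"
  by (rule eta_measurable[OF ls_pos])

lemma en_bd: "\<exists>B. \<forall>x::real^'d. \<bar>en n x\<bar> \<le> B"
  by (rule eta_bounded[OF ls_pos])

lemma wn_bd: "\<bar>wn n j x\<bar> \<le> C"
  by (rule conv_bound_sup[OF w_meas w_bd eta_nonneg[OF ls_pos] eta_integrable[OF ls_pos] eta_integral[OF ls_pos]])

lemma C_nonneg: "C \<ge> 0" using w_bd[of undefined undefined] by linarith

lemma Dw_bd: "\<exists>B\<ge>0. \<forall>i j x. \<bar>Dw n i j x\<bar> \<le> B"
proof -
  obtain b where b: "\<And>(i::'d) x. \<bar>dsp i (en n) x\<bar> \<le> b i"
    using choice[of "\<lambda>(i::'d) B. \<forall>x. \<bar>dsp i (en n) x\<bar> \<le> B"] den_bd by blast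
  have "\<bar>Dw n i j x\<bar> \<le> (\<Sum>i\<in>UNIV. \<Sum>j\<in>UNIV. \<bar>b i * (\<integral>x. \<bar>w j x\<bar> \<partial>lborel)\<bar>)" for i j x
  proof -
    have "\<bar>Dw n i j x\<bar> \<le> b i * (\<integral>x. \<bar>w j x\<bar> \<partial>lborel)" by (rule conv_bound_L1[OF w_int den_meas b])
    also have "\<dots> \<le> \<bar>b i * (\<integral>x. \<bar>w j x\<bar> \<partial>lborel)\<bar>" by simp
    also have "\<dots> \<le> (\<Sum>j\<in>UNIV. \<bar>b i * (\<integral>x. \<bar>w j x\<bar> \<partial>lborel)\<bar>)"
      by (rule member_le_sum) auto
    also have "\<dots> \<le> (\<Sum>i\<in>UNIV. \<Sum>j\<in>UNIV. \<bar>b i * (\<integral>x. \<bar>w j x\<bar> \<partial>lborel)\<bar>)"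
      by (rule member_le_sum) (auto intro: sum_nonneg)
    finally show ?thesis .
  qed
  then show ?thesis by (intro exI[of _ "(\<Sum>i\<in>UNIV. \<Sum>j\<in>UNIV. \<bar>b i * (\<integral>x. \<bar>w j x\<bar> \<partial>lborel)\<bar>)"])
    (auto intro!: sum_nonneg)
qed

lemma wn_dd: "has_dir_deriv (wn n j) (axis i 1) (Dw n i j)"
proof -
  obtain B where B: "\<And>x::real^'d. \<bar>en n x\<bar> \<le> B" using en_bd by blast
  obtain B' where B': "\<And>x. \<bar>dsp i (en n) x\<bar> \<le> B'" using den_bd by blast
  show ?thesis
    by (rule has_dir_deriv_conv[OF w_int _ en_meas B B'])
       (simp add: dsp_def smooth_fun_has_dir_deriv[OF eta_smooth[OF ls_pos]])
qed

text \<open>Testing the antisymmetric gradient with the reflected kernel centred at \<open>x\<close>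
  mollifies it, and the sign from the reflection cancels the one in the definition of a
  distributional derivative. In \<open>Dw n j k\<close> the direction comes before the
  component.\<close>

lemma curl_wn:
  assumes "cball x (ls n) \<subseteq> \<Omega>"
  shows "Dw n j k x - Dw n k j x = (\<integral>y. en n (x - y) * H k j y \<partial>\<mu>)"
proof -
  obtain b where b: "\<And>(i::'d) x. \<bar>dsp i (en n) x\<bar> \<le> b i"
    using choice[of "\<lambda>(i::'d) B. \<forall>x. \<bar>dsp i (en n) x\<bar> \<le> B"] den_bd by blast
  have d: "dsp i (\<lambda>y. en n (x - y)) = (\<lambda>y. - dsp i (en n) (x - y))" for i
    using dderiv_reflect(2)[OF eta_smooth[OF ls_pos], of "axis i 1" 1 n x] by (simp add: dsp_def)
  have i: "integrable lborel (\<lambda>y. w a y * dsp b (en n) (x - y))" for a b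
    by (rule conv_integrable[OF w_int den_meas]) (rule b)
  have "(\<integral>y. en n (x - y) * H k j y \<partial>\<mu>) = - (\<integral>y. w k y * - dsp j (en n) (x - y) - w j y * - dsp k (en n) (x - y) \<partial>lborel)"
    using grad[OF eta_test_fun[OF ls_pos assms], of k j] unfolding d .
  also have "\<dots> = (\<integral>y. w k y * dsp j (en n) (x - y) \<partial>lborel) - (\<integral>y. w j y * dsp k (en n) (x - y) \<partial>lborel)"
    using i by simp
  finally show ?thesis by (simp add: conv_def)
qed

lemma ls_eventually: "e > 0 \<Longrightarrow> \<exists>N. \<forall>n\<ge>N. ls n \<le> e"
  using LIMSEQ_D[OF ls0, of e] by (metis abs_le_D1 diff_zero less_imp_le real_norm_def)

text \<open>Both quadratic terms are integrated by parts for the mollified field, where the product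
  rule is legitimate. The divergence drops out, and what is left is \<open>wn n j\<close> times the
  mollified vorticity.\<close>

lemma nonlinearity_identity:
  assumes \<phi>: "test_fun \<Omega> \<phi>" and sub: "\<And>x. \<phi> x \<noteq> 0 \<Longrightarrow> cball x (ls n) \<subseteq> \<Omega>"
  shows "(\<Sum>j\<in>UNIV. \<integral>x. dsp k \<phi> x * (wn n j x * wn n j x) \<partial>lborel) / 2
       - (\<Sum>j\<in>UNIV. \<integral>x. dsp j \<phi> x * (wn n k x * wn n j x) \<partial>lborel)
     = (\<Sum>j\<in>UNIV. \<integral>x. (\<phi> x * wn n j x) * (\<integral>y. en n (x - y) * H k j y \<partial>\<mu>) \<partial>lborel)"
proof -
  note s = test_fun_smooth[OF \<phi>]
  obtain R where R: "\<And>z. norm z > R \<Longrightarrow> \<phi> z = 0" using test_fun_bounded_support[OF \<phi>] by blast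
  have c: "continuous_on UNIV \<phi>" by (rule smooth_fun_continuous[OF s])
  have cd: "continuous_on UNIV (dsp j \<phi>)" for j
    unfolding dsp_def by (rule smooth_fun_continuous[OF smooth_fun_dderiv[OF s axis_in_Basis]])
  have Rd: "dsp j \<phi> z = 0" if "norm z > R" for j z
    unfolding dsp_def by (rule dderiv_zero_outside[OF s R that])
  note [measurable] = smooth_fun_measurable[OF s] borel_measurable_continuous_onI[OF cd]
  have \<phi>i: "integrable lborel \<phi>" by (rule continuous_bounded_support[OF c R])
  have di: "integrable lborel (dsp j \<phi>)" for j by (rule continuous_bounded_support[OF cd Rd])
  obtain B where B: "\<And>z. \<bar>\<phi> z\<bar> \<le> B" using continuous_bounded_support(1)[OF c R] by blast
  have "\<exists>b. \<forall>z. \<bar>dsp j \<phi> z\<bar> \<le> b" for j by (rule continuous_bounded_support(1)[OF cd Rd])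
  then obtain Bd where Bd: "\<And>j z. \<bar>dsp j \<phi> z\<bar> \<le> Bd j" by metis
  obtain D where D: "D \<ge> 0" "\<And>i j x. \<bar>Dw n i j x\<bar> \<le> D" using Dw_bd by metis
  have ww: "\<bar>wn n i x * wn n j x\<bar> \<le> C * C" for i j x
    unfolding abs_mult using wn_bd C_nonneg by (intro mult_mono) auto
  have wD: "\<bar>wn n i x * Dw n a b x\<bar> \<le> C * D" for i x a b
    unfolding abs_mult using wn_bd C_nonneg D by (intro mult_mono) auto
  have i1: "integrable lborel (\<lambda>x. dsp a \<phi> x * (wn n i x * wn n j x))" for a i j
    by (rule integrable_mult_bounded(1)[OF di _ ww]) measurable
  have i2: "integrable lborel (\<lambda>x. \<phi> x * (wn n i x * Dw n a b x))" for i a b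
    by (rule integrable_mult_bounded(1)[OF \<phi>i _ wD]) measurable
  have ibp: "(\<integral>x. dsp a \<phi> x * (wn n i x * wn n j x) \<partial>lborel)
     = - (\<integral>x. \<phi> x * (wn n j x * Dw n a i x) \<partial>lborel) - (\<integral>x. \<phi> x * (wn n i x * Dw n a j x) \<partial>lborel)" for a i j
  proof -
    have dd: "has_dir_deriv (\<lambda>x. \<phi> x * (wn n i x * wn n j x)) (axis a 1)
       (\<lambda>x. dsp a \<phi> x * (wn n i x * wn n j x) + \<phi> x * (Dw n a i x * wn n j x + wn n i x * Dw n a j x))"
      unfolding dsp_def[of a \<phi>] by (intro has_dir_deriv_mult smooth_fun_has_dir_deriv[OF s] wn_dd)
    have "(\<integral>x. dsp a \<phi> x * (wn n i x * wn n j x) + \<phi> x * (Dw n a i x * wn n j x + wn n i x * Dw n a j x) \<partial>lborel) = 0"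
    proof (rule integral_has_dir_deriv_zero(2)[OF dd, where R=R])
      show "\<bar>dsp a \<phi> z * (wn n i z * wn n j z) + \<phi> z * (Dw n a i z * wn n j z + wn n i z * Dw n a j z)\<bar>
        \<le> Bd a * (C * C) + B * (C * D + C * D)" for z
      proof -
        have "\<bar>dsp a \<phi> z * (wn n i z * wn n j z)\<bar> \<le> Bd a * (C * C)"
          unfolding abs_mult[of "dsp a \<phi> z"] by (intro mult_mono ww Bd order_trans[OF abs_ge_zero Bd]) auto
        moreover have "\<bar>\<phi> z * (Dw n a i z * wn n j z + wn n i z * Dw n a j z)\<bar> \<le> B * (C * D + C * D)"
          unfolding abs_mult[of "\<phi> z"]
        proof (intro mult_mono B)
          show "\<bar>Dw n a i z * wn n j z + wn n i z * Dw n a j z\<bar> \<le> C * D + C * D"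
            using abs_triangle_ineq[of "wn n j z * Dw n a i z" "wn n i z * Dw n a j z"] wD[of j z i a] wD[of i z j a] by (simp add: mult.commute)
        qed (auto intro: order_trans[OF abs_ge_zero B])
        ultimately show ?thesis by linarith
      qed
      show "integrable lborel (\<lambda>x. \<phi> x * (wn n i x * wn n j x))"
        by (rule integrable_mult_bounded(1)[OF \<phi>i _ ww]) measurable
    qed (use R in auto)
    moreover have "(\<lambda>x. dsp a \<phi> x * (wn n i x * wn n j x) + \<phi> x * (Dw n a i x * wn n j x + wn n i x * Dw n a j x))
       = (\<lambda>x. dsp a \<phi> x * (wn n i x * wn n j x) + (\<phi> x * (wn n j x * Dw n a i x) + \<phi> x * (wn n i x * Dw n a j x)))"
      by (simp add: fun_eq_iff algebra_simps)
    ultimately show ?thesis using i1 i2 by simp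
  qed
  \<comment> \<open>Where \<open>\<phi>\<close> is non-zero the ball of radius \<open>ls n\<close>
    lies in \<open>\<Omega>\<close>, and there the mollified divergence vanishes almost
    everywhere.\<close>
  have div0: "(\<Sum>j\<in>UNIV. \<integral>x. \<phi> x * (wn n k x * Dw n j j x) \<partial>lborel) = 0"
  proof -
    have "(\<Sum>j\<in>UNIV. \<integral>x. \<phi> x * (wn n k x * Dw n j j x) \<partial>lborel) = (\<integral>x. (\<Sum>j\<in>UNIV. \<phi> x * (wn n k x * Dw n j j x)) \<partial>lborel)"
      using i2 by simp
    also have "\<dots> = (\<integral>x. 0 \<partial>(lborel::(real^'d) measure))"
    proof (rule integral_cong_AE)
      show "AE x in lborel. (\<Sum>j\<in>UNIV. \<phi> x * (wn n k x * Dw n j j x)) = 0"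
        using divfree[of n]
      proof eventually_elim
        case (elim x)
        have "(\<Sum>j\<in>UNIV. \<phi> x * (wn n k x * Dw n j j x)) = \<phi> x * (wn n k x * (\<Sum>j\<in>UNIV. Dw n j j x))"
          by (simp add: sum_distrib_left)
        then show ?case using elim sub[of x] by (cases "\<phi> x = 0") auto
      qed
    qed measurable
    finally show ?thesis by simp
  qed
  have "(\<Sum>j\<in>UNIV. \<integral>x. dsp k \<phi> x * (wn n j x * wn n j x) \<partial>lborel) / 2
       - (\<Sum>j\<in>UNIV. \<integral>x. dsp j \<phi> x * (wn n k x * wn n j x) \<partial>lborel)
     = (\<Sum>j\<in>UNIV. - (\<integral>x. \<phi> x * (wn n j x * Dw n k j x) \<partial>lborel)) + (\<Sum>j\<in>UNIV. \<integral>x. \<phi> x * (wn n j x * Dw n j k x) \<partial>lborel)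
       + (\<Sum>j\<in>UNIV. \<integral>x. \<phi> x * (wn n k x * Dw n j j x) \<partial>lborel)"
    unfolding ibp by (simp add: sum_subtractf sum_negf sum.distrib sum_divide_distrib[symmetric] flip: sum_distrib_left)
  also have "\<dots> = (\<Sum>j\<in>UNIV. (\<integral>x. \<phi> x * (wn n j x * Dw n j k x) \<partial>lborel) - (\<integral>x. \<phi> x * (wn n j x * Dw n k j x) \<partial>lborel))"
    unfolding div0 by (simp add: sum_subtractf sum_negf)
  also have "\<dots> = (\<Sum>j\<in>UNIV. \<integral>x. (\<phi> x * wn n j x) * (\<integral>y. en n (x - y) * H k j y \<partial>\<mu>) \<partial>lborel)"
  proof (rule sum.cong[OF refl])
    fix j
    have "(\<integral>x. \<phi> x * (wn n j x * Dw n j k x) \<partial>lborel) - (\<integral>x. \<phi> x * (wn n j x * Dw n k j x) \<partial>lborel)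
      = (\<integral>x. \<phi> x * (wn n j x * Dw n j k x) - \<phi> x * (wn n j x * Dw n k j x) \<partial>lborel)" using i2 by simp
    also have "\<dots> = (\<integral>x. (\<phi> x * wn n j x) * (\<integral>y. en n (x - y) * H k j y \<partial>\<mu>) \<partial>lborel)"
    proof (rule Bochner_Integration.integral_cong[OF refl])
      fix x
      have "\<phi> x * (wn n j x * Dw n j k x) - \<phi> x * (wn n j x * Dw n k j x) = (\<phi> x * wn n j x) * (Dw n j k x - Dw n k j x)"
        by (simp add: algebra_simps)
      then show "\<phi> x * (wn n j x * Dw n j k x) - \<phi> x * (wn n j x * Dw n k j x) = (\<phi> x * wn n j x) * (\<integral>y. en n (x - y) * H k j y \<partial>\<mu>)"
        using curl_wn[OF sub[of x]] by (cases "\<phi> x = 0") auto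
    qed
    finally show "(\<integral>x. \<phi> x * (wn n j x * Dw n j k x) \<partial>lborel) - (\<integral>x. \<phi> x * (wn n j x * Dw n k j x) \<partial>lborel)
      = (\<integral>x. (\<phi> x * wn n j x) * (\<integral>y. en n (x - y) * H k j y \<partial>\<mu>) \<partial>lborel)" .
  qed
  finally show ?thesis .
qed

text \<open>In the sense of distributions, the nonlinearity minus the gradient of the kinetic energy is the
  measure obtained by applying the vorticity to the precise representative \<open>V\<close>.\<close>

lemma nonlinearity_representation:
  assumes \<phi>: "test_fun \<Omega> \<phi>"
  shows "(\<Sum>j\<in>UNIV. \<integral>x. dsp k \<phi> x * (w j x * w j x) \<partial>lborel) / 2
       - (\<Sum>j\<in>UNIV. \<integral>x. dsp j \<phi> x * (w k x * w j x) \<partial>lborel)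
     = (\<Sum>j\<in>UNIV. \<integral>y. \<phi> y * V j y * H k j y \<partial>\<mu>)"
proof -
  note s = test_fun_smooth[OF \<phi>]
  obtain R where R: "\<And>z. norm z > R \<Longrightarrow> \<phi> z = 0" using test_fun_bounded_support[OF \<phi>] by blast
  have c: "continuous_on UNIV \<phi>" by (rule smooth_fun_continuous[OF s])
  have cd: "continuous_on UNIV (dsp j \<phi>)" for j
    unfolding dsp_def by (rule smooth_fun_continuous[OF smooth_fun_dderiv[OF s axis_in_Basis]])
  have Rd: "dsp j \<phi> z = 0" if "norm z > R" for j z
    unfolding dsp_def by (rule dderiv_zero_outside[OF s R that])
  obtain B where B: "\<And>z. \<bar>\<phi> z\<bar> \<le> B" using continuous_bounded_support(1)[OF c R] by blast
  have "\<exists>b. \<forall>z. \<bar>dsp j \<phi> z\<bar> \<le> b" for j by (rule continuous_bounded_support(1)[OF cd Rd])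
  then obtain Bd where Bd: "\<And>j z. \<bar>dsp j \<phi> z\<bar> \<le> Bd j" by metis
  obtain e where e: "e > 0" "\<And>z. \<phi> z \<noteq> 0 \<Longrightarrow> cball z e \<subseteq> \<Omega>" using test_fun_margin[OF \<phi> \<Omega>] by blast
  obtain N where N: "\<And>n. n \<ge> N \<Longrightarrow> ls n \<le> e" using ls_eventually[OF e(1)] by blast
  have lim1: "(\<lambda>n. \<integral>x. dsp a \<phi> x * (wn n i x * wn n j x) \<partial>lborel) \<longlonglongrightarrow> (\<integral>x. dsp a \<phi> x * (w i x * w j x) \<partial>lborel)" for a i j
    by (rule L1_tendsto_integral_mult[OF en_L1_tendsto[OF w_int] en_L1_tendsto[OF w_int] wn_bd w_bd _ Bd])
       (simp add: borel_measurable_continuous_onI[OF cd])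
  \<comment> \<open>The mollified vorticity has no limit in mean in general, so this limit is taken
    against \<open>\<mu>\<close> and not against Lebesgue measure.\<close>
  have lim2: "(\<lambda>n. \<integral>x. (\<phi> x * wn n j x) * (\<integral>y. en n (x - y) * H k j y \<partial>\<mu>) \<partial>lborel) \<longlonglongrightarrow> (\<integral>y. \<phi> y * V j y * H k j y \<partial>\<mu>)" for j
    by (rule pairing(3)[OF mu_sets mu_fin H_int w_meas w_bd c B R V_meas]) (use conv in \<open>auto elim!: eventually_mono\<close>)
  have L1: "(\<lambda>n. (\<Sum>j\<in>UNIV. \<integral>x. dsp k \<phi> x * (wn n j x * wn n j x) \<partial>lborel) / 2
       - (\<Sum>j\<in>UNIV. \<integral>x. dsp j \<phi> x * (wn n k x * wn n j x) \<partial>lborel)) \<longlonglongrightarrow>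
      (\<Sum>j\<in>UNIV. \<integral>x. dsp k \<phi> x * (w j x * w j x) \<partial>lborel) / 2
       - (\<Sum>j\<in>UNIV. \<integral>x. dsp j \<phi> x * (w k x * w j x) \<partial>lborel)"
    by (intro tendsto_intros lim1) simp
  have L2: "(\<lambda>n. \<Sum>j\<in>UNIV. \<integral>x. (\<phi> x * wn n j x) * (\<integral>y. en n (x - y) * H k j y \<partial>\<mu>) \<partial>lborel) \<longlonglongrightarrow>
      (\<Sum>j\<in>UNIV. \<integral>y. \<phi> y * V j y * H k j y \<partial>\<mu>)"
    by (intro tendsto_intros lim2)
  have ev: "\<forall>\<^sub>F n in sequentially. (\<Sum>j\<in>UNIV. \<integral>x. dsp k \<phi> x * (wn n j x * wn n j x) \<partial>lborel) / 2
       - (\<Sum>j\<in>UNIV. \<integral>x. dsp j \<phi> x * (wn n k x * wn n j x) \<partial>lborel)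
      = (\<Sum>j\<in>UNIV. \<integral>x. (\<phi> x * wn n j x) * (\<integral>y. en n (x - y) * H k j y \<partial>\<mu>) \<partial>lborel)"
  proof (rule eventually_sequentiallyI[of N])
    fix n assume "n \<ge> N"
    then have "cball x (ls n) \<subseteq> \<Omega>" if "\<phi> x \<noteq> 0" for x
      using e(2)[OF that] N[of n] subset_cball[of "ls n" e x] by auto
    then show "(\<Sum>j\<in>UNIV. \<integral>x. dsp k \<phi> x * (wn n j x * wn n j x) \<partial>lborel) / 2
       - (\<Sum>j\<in>UNIV. \<integral>x. dsp j \<phi> x * (wn n k x * wn n j x) \<partial>lborel)
      = (\<Sum>j\<in>UNIV. \<integral>x. (\<phi> x * wn n j x) * (\<integral>y. en n (x - y) * H k j y \<partial>\<mu>) \<partial>lborel)"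
      by (rule nonlinearity_identity[OF \<phi>])
  qed
  show ?thesis
    by (rule LIMSEQ_unique[OF L1 Lim_transform_eventually[OF L2]])
       (use ev in \<open>auto elim!: eventually_mono\<close>)
qed

text \<open>The mollification of the nonlinearity minus the energy gradient, component
  \<open>k\<close>. The products are formed before mollifying, in contrast to the identity above, in
  which they are products of mollified fields.\<close>

abbreviation "Nn n k x \<equiv> (\<Sum>j\<in>UNIV. conv (\<lambda>y. w k y * w j y) (dsp j (en n)) x)
    - conv (\<lambda>y. (\<Sum>j\<in>UNIV. (w j y)\<^sup>2) / 2) (dsp k (en n)) x"

text \<open>The representation of the nonlinearity is tested with the reflected kernel centred at
  \<open>x\<close>; each derivative of that kernel brings a minus sign, which yields the derivative
  of the convolution.\<close>

lemma Nn_representation: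
  assumes "cball x (ls n) \<subseteq> \<Omega>"
  shows "Nn n k x = (\<Sum>j\<in>UNIV. \<integral>y. en n (x - y) * (V j y * H k j y) \<partial>\<mu>)"
proof -
  obtain b where b: "\<And>(i::'d) x. \<bar>dsp i (en n) x\<bar> \<le> b i"
    using choice[of "\<lambda>(i::'d) B. \<forall>x. \<bar>dsp i (en n) x\<bar> \<le> B"] den_bd by blast
  have d: "dsp i (\<lambda>y. en n (x - y)) = (\<lambda>y. - dsp i (en n) (x - y))" for i
    using dderiv_reflect(2)[OF eta_smooth[OF ls_pos], of "axis i 1" 1 n x] by (simp add: dsp_def)
  have wwi: "integrable lborel (\<lambda>y. w i y * w j y)" for i j
    by (rule integrable_mult_bounded(1)[OF w_int _ w_bd]) simp
  have i: "integrable lborel (\<lambda>y. (w i y * w j y) * dsp a (en n) (x - y))" for i j a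
    by (rule conv_integrable[OF wwi den_meas]) (rule b)
  have c1: "(\<integral>y. - dsp a (en n) (x - y) * (w i y * w j y) \<partial>lborel) = - conv (\<lambda>y. w i y * w j y) (dsp a (en n)) x" for a i j
    by (simp add: conv_def mult.commute)
  have c2: "conv (\<lambda>y. (\<Sum>j\<in>UNIV. (w j y)\<^sup>2) / 2) (dsp k (en n)) x = (\<Sum>j\<in>UNIV. conv (\<lambda>y. w j y * w j y) (dsp k (en n)) x) / 2"
  proof -
    have "conv (\<lambda>y. (\<Sum>j\<in>UNIV. (w j y)\<^sup>2) / 2) (dsp k (en n)) x = (\<integral>y. (\<Sum>j\<in>UNIV. (w j y * w j y) * dsp k (en n) (x - y)) / 2 \<partial>lborel)"
      unfolding conv_def by (simp add: sum_distrib_right power2_eq_square sum_divide_distrib)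
    then show ?thesis using i by (simp add: conv_def)
  qed
  have "(\<Sum>j\<in>UNIV. \<integral>y. - dsp k (en n) (x - y) * (w j y * w j y) \<partial>lborel) / 2
       - (\<Sum>j\<in>UNIV. \<integral>y. - dsp j (en n) (x - y) * (w k y * w j y) \<partial>lborel)
     = (\<Sum>j\<in>UNIV. \<integral>y. en n (x - y) * V j y * H k j y \<partial>\<mu>)"
    using nonlinearity_representation[OF eta_test_fun[OF ls_pos assms], of k] unfolding d .
  then show ?thesis unfolding c1 c2 by (simp add: sum_negf mult.assoc)
qed

text \<open>The pairing is used a second time, with the density \<open>V j y * H k j y\<close>
  against the mollified component \<open>wn n k\<close>, and this supplies the other factor
  \<open>V k\<close>. The bound by the total mass of \<open>H\<close>, uniform in \<open>n\<close>,
  is what later dominates the limit in time.\<close>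

lemma defect_slice:
  assumes \<phi>: "continuous_on UNIV \<phi>" "\<And>x. \<bar>\<phi> x\<bar> \<le> B" "\<And>x. norm x > R \<Longrightarrow> \<phi> x = 0"
    and e: "e > 0" "\<And>x. \<phi> x \<noteq> 0 \<Longrightarrow> cball x e \<subseteq> \<Omega>"
  defines "r \<equiv> \<lambda>n. \<integral>x. \<phi> x * (\<Sum>k\<in>UNIV. wn n k x * Nn n k x) \<partial>lborel"
  shows "ls n \<le> e \<Longrightarrow> \<bar>r n\<bar> \<le> B * C * C * (\<Sum>k\<in>UNIV. \<Sum>j\<in>UNIV. \<integral>y. \<bar>H k j y\<bar> \<partial>\<mu>)"
    and "r \<longlonglongrightarrow> 0"
proof -
  interpret finite_measure \<mu> by (rule mu_fin)
  note [measurable_cong] = mu_sets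
  have B0: "B \<ge> 0" using \<phi>(2)[of undefined] by linarith
  have VHi: "integrable \<mu> (\<lambda>y. V j y * H k j y)" for k j
    by (rule integrable_mult_bounded(2)[OF H_int _ V_bd]) measurable
  let ?p = "\<lambda>n k j x. (\<phi> x * wn n k x) * (\<integral>y. en n (x - y) * (V j y * H k j y) \<partial>\<mu>)"
  note pr = pairing[OF mu_sets mu_fin VHi w_meas w_bd \<phi>]
  have rn: "r n = (\<Sum>k\<in>UNIV. \<Sum>j\<in>UNIV. \<integral>x. ?p n k j x \<partial>lborel)" if "ls n \<le> e" for n
  proof -
    have "r n = (\<integral>x. (\<Sum>k\<in>UNIV. \<Sum>j\<in>UNIV. ?p n k j x) \<partial>lborel)"
      unfolding r_def
    proof (rule Bochner_Integration.integral_cong[OF refl])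
      fix x
      show "\<phi> x * (\<Sum>k\<in>UNIV. wn n k x * Nn n k x) = (\<Sum>k\<in>UNIV. \<Sum>j\<in>UNIV. ?p n k j x)"
      proof (cases "\<phi> x = 0")
        case False
        then have "cball x (ls n) \<subseteq> \<Omega>" using e(2)[OF False] that subset_cball[of "ls n" e x] by auto
        then show ?thesis unfolding Nn_representation[OF \<open>cball x (ls n) \<subseteq> \<Omega>\<close>]
          by (simp add: sum_distrib_left mult.assoc)
      qed simp
    qed
    also have "\<dots> = (\<Sum>k\<in>UNIV. \<Sum>j\<in>UNIV. \<integral>x. ?p n k j x \<partial>lborel)"
      using pr(1) by simp
    finally show ?thesis .
  qed
  show "\<bar>r n\<bar> \<le> B * C * C * (\<Sum>k\<in>UNIV. \<Sum>j\<in>UNIV. \<integral>y. \<bar>H k j y\<bar> \<partial>\<mu>)" if "ls n \<le> e"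
  proof -
    have "\<bar>\<integral>x. ?p n k j x \<partial>lborel\<bar> \<le> B * C * C * (\<integral>y. \<bar>H k j y\<bar> \<partial>\<mu>)" for k j
    proof -
      have "\<bar>\<integral>x. ?p n k j x \<partial>lborel\<bar> \<le> B * C * (\<integral>y. \<bar>V j y * H k j y\<bar> \<partial>\<mu>)" by (rule pr(2))
      also have "\<dots> \<le> B * C * (\<integral>y. C * \<bar>H k j y\<bar> \<partial>\<mu>)"
      proof (rule mult_left_mono[OF integral_mono[OF integrable_abs[OF VHi]]])
        show "integrable \<mu> (\<lambda>y. C * \<bar>H k j y\<bar>)" using H_int by simp
        show "\<bar>V j y * H k j y\<bar> \<le> C * \<bar>H k j y\<bar>" for y
          unfolding abs_mult using V_bd by (intro mult_right_mono) auto
      qed (use B0 C_nonneg in auto)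
      finally show ?thesis by simp
    qed
    then have "(\<Sum>k\<in>UNIV. \<Sum>j\<in>UNIV. \<bar>\<integral>x. ?p n k j x \<partial>lborel\<bar>) \<le> (\<Sum>k\<in>UNIV. \<Sum>j\<in>UNIV. B * C * C * (\<integral>y. \<bar>H k j y\<bar> \<partial>\<mu>))"
      by (intro sum_mono)
    moreover have "\<bar>r n\<bar> \<le> (\<Sum>k\<in>UNIV. \<Sum>j\<in>UNIV. \<bar>\<integral>x. ?p n k j x \<partial>lborel\<bar>)"
      unfolding rn[OF that] by (rule order_trans[OF sum_abs sum_mono[OF sum_abs]])
    ultimately show ?thesis by (simp add: sum_distrib_left)
  qed
  have lim: "(\<lambda>n. \<Sum>k\<in>UNIV. \<Sum>j\<in>UNIV. \<integral>x. ?p n k j x \<partial>lborel) \<longlonglongrightarrow> (\<Sum>k\<in>UNIV. \<Sum>j\<in>UNIV. \<integral>y. \<phi> y * V k y * (V j y * H k j y) \<partial>\<mu>)"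
    by (intro tendsto_intros pr(3) V_meas) (use conv in \<open>auto elim!: eventually_mono\<close>)
  have "(\<Sum>k\<in>UNIV. \<Sum>j\<in>UNIV. \<integral>y. \<phi> y * V k y * (V j y * H k j y) \<partial>\<mu>) = 0" (is "?S = 0")
  proof -
    \<comment> \<open>Renaming the indices and using antisymmetry, the sum equals its own
      negative.\<close>
    have "?S = (\<Sum>k\<in>UNIV. \<Sum>j\<in>UNIV. \<integral>y. \<phi> y * V j y * (V k y * H j k y) \<partial>\<mu>)"
      by (rule sum.swap)
    also have "\<dots> = (\<Sum>k\<in>UNIV. \<Sum>j\<in>UNIV. - (\<integral>y. \<phi> y * V k y * (V j y * H k j y) \<partial>\<mu>))"
    proof (intro sum.cong refl)
      fix k j
      have "\<phi> y * V j y * (V k y * H j k y) = - (\<phi> y * V k y * (V j y * H k j y))" for y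
        using H_anti[of j k y] by (simp add: eq_neg_iff_add_eq_0[symmetric])
      then show "(\<integral>y. \<phi> y * V j y * (V k y * H j k y) \<partial>\<mu>) = - (\<integral>y. \<phi> y * V k y * (V j y * H k j y) \<partial>\<mu>)"
        by simp
    qed
    also have "\<dots> = - ?S" by (simp add: sum_negf)
    finally show ?thesis by simp
  qed
  then have lim0: "(\<lambda>n. \<Sum>k\<in>UNIV. \<Sum>j\<in>UNIV. \<integral>x. ?p n k j x \<partial>lborel) \<longlonglongrightarrow> 0" using lim by simp
  obtain N where N: "\<And>n. n \<ge> N \<Longrightarrow> ls n \<le> e" using ls_eventually[OF e(1)] by blast
  show "r \<longlonglongrightarrow> 0"
    by (rule Lim_transform_eventually[OF lim0 eventually_sequentiallyI[of N]]) (use N rn in auto)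
qed

end

section \<open>Mollification in space and time\<close>

lemma L1_tendsto_sum:
  assumes "\<And>i. i \<in> I \<Longrightarrow> L1_tendsto M (f i) (g i)" "finite I"
  shows "L1_tendsto M (\<lambda>n z. \<Sum>i\<in>I. f i n z) (\<lambda>z. \<Sum>i\<in>I. g i z)"
  unfolding L1_tendsto_def
proof (intro conjI allI)
  have fi: "integrable M (f i n)" "integrable M (g i)" if "i \<in> I" for i n
    using assms(1)[OF that] by (auto simp: L1_tendsto_def)
  show "integrable M (\<lambda>z. \<Sum>i\<in>I. f i n z)" for n using fi by simp
  show "integrable M (\<lambda>z. \<Sum>i\<in>I. g i z)" using fi by simp
  have lim: "(\<lambda>n. \<Sum>i\<in>I. \<integral>z. \<bar>f i n z - g i z\<bar> \<partial>M) \<longlonglongrightarrow> (\<Sum>i\<in>I. 0)"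
    using assms(1) by (intro tendsto_intros) (auto simp: L1_tendsto_def)
  show "(\<lambda>n. \<integral>z. \<bar>(\<Sum>i\<in>I. f i n z) - (\<Sum>i\<in>I. g i z)\<bar> \<partial>M) \<longlonglongrightarrow> 0"
  proof (rule Lim_null_comparison)
    show "(\<lambda>n. \<Sum>i\<in>I. \<integral>z. \<bar>f i n z - g i z\<bar> \<partial>M) \<longlonglongrightarrow> 0" using lim by simp
    have "(\<integral>z. \<bar>(\<Sum>i\<in>I. f i n z) - (\<Sum>i\<in>I. g i z)\<bar> \<partial>M) \<le> (\<Sum>i\<in>I. \<integral>z. \<bar>f i n z - g i z\<bar> \<partial>M)" for n
    proof -
      have "(\<integral>z. \<bar>(\<Sum>i\<in>I. f i n z) - (\<Sum>i\<in>I. g i z)\<bar> \<partial>M) \<le> (\<integral>z. (\<Sum>i\<in>I. \<bar>f i n z - g i z\<bar>) \<partial>M)"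
        using fi by (intro integral_mono) (auto simp flip: sum_subtractf)
      then show ?thesis using fi by simp
    qed
    moreover have "0 \<le> (\<integral>z. \<bar>(\<Sum>i\<in>I. f i n z) - (\<Sum>i\<in>I. g i z)\<bar> \<partial>M)" for n
      by (rule Bochner_Integration.integral_nonneg) simp
    ultimately show "\<forall>\<^sub>F n in sequentially. norm (\<integral>z. \<bar>(\<Sum>i\<in>I. f i n z) - (\<Sum>i\<in>I. g i z)\<bar> \<partial>M) \<le> (\<Sum>i\<in>I. \<integral>z. \<bar>f i n z - g i z\<bar> \<partial>M)"
      by (intro always_eventually) (simp add: abs_of_nonneg)
  qed
qed

lemma L1_tendsto_diff:
  assumes "L1_tendsto M f g" "L1_tendsto M f' g'"
  shows "L1_tendsto M (\<lambda>n z. f n z - f' n z) (\<lambda>z. g z - g' z)"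
proof -
  have "L1_tendsto M (\<lambda>n z. - f' n z) (\<lambda>z. - g' z)"
    using assms(2) by (simp add: L1_tendsto_def abs_minus_commute)
  \<comment> \<open>The difference is written as a sum over the two elements of \<open>bool\<close>,
    to which the result on finite sums applies.\<close>
  then have "L1_tendsto M (\<lambda>n z. \<Sum>b\<in>(UNIV::bool set). (if b then f n z else - f' n z)) (\<lambda>z. \<Sum>b\<in>(UNIV::bool set). (if b then g z else - g' z))"
  proof (intro L1_tendsto_sum)
    fix b
    show "L1_tendsto M (\<lambda>n z. if b then f n z else - f' n z) (\<lambda>z. if b then g z else - g' z)"
      using assms(1) \<open>L1_tendsto M (\<lambda>n z. - f' n z) (\<lambda>z. - g' z)\<close> by (cases b) auto
  qed simp
  then show ?thesis by (simp add: UNIV_bool)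
qed

text \<open>The exceptional set of \<open>Q\<close> need not be measurable, so it is enlarged to a
  measurable null set before the variables are exchanged. Time has to be the outer variable because
  the blow-up assumption is made on slices.\<close>

lemma AE_lborel_swap:
  assumes "AE z in (lborel :: ('a::euclidean_space \<times> 'b::euclidean_space) measure). Q z"
  shows "AE t in lborel. AE x in lborel. Q (x, t)"
proof -
  obtain N where N: "N \<in> null_sets (lborel :: ('a \<times> 'b) measure)" "{z. \<not> Q z} \<subseteq> N"
    using assms by (auto simp: eventually_ae_filter)
  have Ns: "N \<in> sets (lborel \<Otimes>\<^sub>M lborel)" using null_setsD2[OF N(1)] by (simp only: lborel_prod)
  have "AE z in (lborel \<Otimes>\<^sub>M lborel). z \<notin> N" using N(1) by (simp add: lborel_prod AE_not_in)
  from lborel_pair.AE_pair[OF this] have 1: "AE x in lborel. AE t in lborel. (x, t) \<notin> N" by simp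
  have "{z \<in> space (lborel \<Otimes>\<^sub>M lborel). (fst z, snd z) \<notin> N} = space (lborel \<Otimes>\<^sub>M lborel) - N" by auto
  then have "{z \<in> space (lborel \<Otimes>\<^sub>M lborel). (fst z, snd z) \<notin> N} \<in> sets (lborel \<Otimes>\<^sub>M lborel)"
    using Ns by (simp only: sets.compl_sets)
  from lborel_pair.AE_commute[OF this] 1 have "AE t in lborel. AE x in lborel. (x, t) \<notin> N" by simp
  then show ?thesis
  proof eventually_elim
    case (elim t)
    then show ?case by eventually_elim (use N(2) in auto)
  qed
qed

lemma integrable_tensor:
  fixes h :: "'a::euclidean_space \<Rightarrow> real" and g :: "'b::euclidean_space \<Rightarrow> real"
  assumes h: "integrable lborel h" and g: "integrable lborel g"
  shows "integrable lborel (\<lambda>(x, t). h x * g t)"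
    "(\<integral>z. (case z of (x, t) \<Rightarrow> h x * g t) \<partial>lborel) = (\<integral>x. h x \<partial>lborel) * (\<integral>t. g t \<partial>lborel)"
proof -
  have [measurable]: "h \<in> borel_measurable borel" "g \<in> borel_measurable borel" using h g by auto
  have i: "integrable (lborel \<Otimes>\<^sub>M lborel) (\<lambda>(x, t). h x * g t)"
  proof (rule lborel_pair.Fubini_integrable)
    have "(\<integral>t. norm (h x * g t) \<partial>lborel) = \<bar>h x\<bar> * (\<integral>t. \<bar>g t\<bar> \<partial>lborel)" for x by (simp add: abs_mult)
    then show "integrable lborel (\<lambda>x. \<integral>t. norm (case (x, t) of (x, t) \<Rightarrow> h x * g t) \<partial>lborel)"
      unfolding prod.case using h by simp
  qed (use g in auto)
  then show "integrable lborel (\<lambda>(x, t). h x * g t)" by (simp add: lborel_prod)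
  show "(\<integral>z. (case z of (x, t) \<Rightarrow> h x * g t) \<partial>lborel) = (\<integral>x. h x \<partial>lborel) * (\<integral>t. g t \<partial>lborel)"
    using lborel_pair.integral_fst[OF i] by (simp add: lborel_prod)
qed

lemma cball_times_subset:
  assumes "cball (x, t) e \<subseteq> A \<times> B" "e \<ge> 0"
  shows "cball x e \<subseteq> A" "cball t e \<subseteq> B"
proof -
  have "(y, t) \<in> A \<times> B" if "y \<in> cball x e" for y
    by (rule subsetD[OF assms(1)]) (use that in \<open>auto simp: dist_prod_def\<close>)
  then show "cball x e \<subseteq> A" by auto
  have "(x, s) \<in> A \<times> B" if "s \<in> cball t e" for s
    by (rule subsetD[OF assms(1)]) (use that in \<open>auto simp: dist_prod_def\<close>)
  then show "cball t e \<subseteq> B" by auto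
qed

lemma integral_momentum_split:
  fixes a c d :: "'a \<Rightarrow> real" and b :: "'i::finite \<Rightarrow> 'a \<Rightarrow> real"
  assumes "integrable M a" "\<And>j. integrable M (b j)" "integrable M c" "integrable M d"
  shows "(\<integral>w. - a w - (\<Sum>j\<in>UNIV. b j w) - c w + d w \<partial>M) =
    - (\<integral>w. a w \<partial>M) - (\<Sum>j\<in>UNIV. \<integral>w. b j w \<partial>M) - (\<integral>w. c w \<partial>M) + (\<integral>w. d w \<partial>M)"
  using assms by simp

text \<open>The fields are integrable over the whole space, so convolutions make sense everywhere;
  the equations hold on \<open>\<Omega> \<times> {0<..<T}\<close> only and are used at points whose
  kernel stays inside.\<close>

locale spacetime = moll_seq +
  fixes \<Omega> :: "(real^'d::finite) set" and T C :: real and U :: "'d \<Rightarrow> (real^'d) \<times> real \<Rightarrow> real"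
    and P :: "(real^'d) \<times> real \<Rightarrow> real" and F :: "'d \<Rightarrow> (real^'d) \<times> real \<Rightarrow> real"
  assumes \<Omega>: "open \<Omega>"
    and U_bd: "\<And>k z. \<bar>U k z\<bar> \<le> C" and U_int: "\<And>k. integrable lborel (U k)"
    and P_int: "integrable lborel P" and F_int: "\<And>k. integrable lborel (F k)"
    and momentum: "\<And>\<psi> k. test_fun (\<Omega> \<times> {0<..<T}) \<psi> \<Longrightarrow>
        (\<integral>z. U k z * dt \<psi> z + (\<Sum>j\<in>UNIV. U k z * U j z * dx j \<psi> z) + P z * dx k \<psi> z + F k z * \<psi> z \<partial>lborel) = 0"
    and divergence: "\<And>\<psi>. test_fun (\<Omega> \<times> {0<..<T}) \<psi> \<Longrightarrow> (\<integral>z. (\<Sum>j\<in>UNIV. U j z * dx j \<psi> z) \<partial>lborel) = 0"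
begin

text \<open>The scales in space and time are independent, so that the mollification in time can be
  removed on its own.\<close>

abbreviation K :: "nat \<Rightarrow> real \<Rightarrow> (real^'d) \<times> real \<Rightarrow> real" where
  "K n \<delta> \<equiv> (\<lambda>(x, t). en n x * eta \<delta> t)"
abbreviation Kt :: "nat \<Rightarrow> real \<Rightarrow> (real^'d) \<times> real \<Rightarrow> real" where
  "Kt n \<delta> \<equiv> (\<lambda>(x, t). en n x * dderiv 1 (eta \<delta>) t)"
abbreviation Kx :: "'d \<Rightarrow> nat \<Rightarrow> real \<Rightarrow> (real^'d) \<times> real \<Rightarrow> real" where
  "Kx j n \<delta> \<equiv> (\<lambda>(x, t). dsp j (en n) x * eta \<delta> t)"
abbreviation E :: "(real^'d) \<times> real \<Rightarrow> real" where
  "E \<equiv> (\<lambda>z. (\<Sum>j\<in>UNIV. (U j z)\<^sup>2) / 2)"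
abbreviation UU :: "'d \<Rightarrow> 'd \<Rightarrow> (real^'d) \<times> real \<Rightarrow> real" where
  "UU k j \<equiv> (\<lambda>z. U k z * U j z)"

lemma U_meas[measurable]: "U k \<in> borel_measurable borel" using U_int[of k] by auto
lemma C_nonneg: "C \<ge> 0" using U_bd[of undefined undefined] by linarith

lemma UU_int: "integrable lborel (UU k j)"
  by (rule integrable_mult_bounded(1)[OF U_int _ U_bd]) measurable

lemma E_int: "integrable lborel E"
  using UU_int by (simp add: power2_eq_square)

lemma K_smooth: "\<delta> > 0 \<Longrightarrow> smooth_fun (K n \<delta>)"
  by (intro smooth_fun_tensor eta_smooth ls_pos)

lemma dt_K: "\<delta> > 0 \<Longrightarrow> dderiv (0, 1) (K n \<delta>) = Kt n \<delta>"
  by (intro dderiv_tensor eta_smooth ls_pos)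

lemma dx_K: "\<delta> > 0 \<Longrightarrow> dderiv (axis j 1, 0) (K n \<delta>) = Kx j n \<delta>"
  unfolding dsp_def by (intro dderiv_tensor eta_smooth ls_pos)

lemma K_zero:
  assumes "\<delta> > 0" "norm z > ls n + \<delta>"
  shows "K n \<delta> z = 0"
proof (rule ccontr)
  assume nz: "K n \<delta> z \<noteq> 0"
  obtain x t where z: "z = (x, t)" by fastforce
  have "en n x \<noteq> 0" "eta \<delta> t \<noteq> 0" using nz z by auto
  then have "norm x < ls n / 2" "norm t < \<delta> / 2"
    using eta_support[OF ls_pos, of n x] eta_support[OF assms(1), of t] by blast+
  moreover have "norm z \<le> norm x + norm t" unfolding z by (rule norm_Pair_le)
  ultimately show False using assms ls_pos[of n] by linarith
qed

lemma basis_mem: "((0::real^'d), (1::real)) \<in> Basis" "(axis (j::'d) (1::real), (0::real)) \<in> Basis"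
  using axis_in_Basis[of j] by (auto simp: Basis_prod_def)

lemma kernels:
  assumes d: "\<delta> > 0"
  shows "K n \<delta> \<in> borel_measurable borel" "Kt n \<delta> \<in> borel_measurable borel" "Kx j n \<delta> \<in> borel_measurable borel"
    "\<exists>B. \<forall>z. \<bar>K n \<delta> z\<bar> \<le> B" "\<exists>B. \<forall>z. \<bar>Kt n \<delta> z\<bar> \<le> B" "\<exists>B. \<forall>z. \<bar>Kx j n \<delta> z\<bar> \<le> B"
    "has_dir_deriv (K n \<delta>) (0, 1) (Kt n \<delta>)" "has_dir_deriv (K n \<delta>) (axis j 1, 0) (Kx j n \<delta>)"
proof -
  note s = K_smooth[OF d, of n]
  have st: "smooth_fun (Kt n \<delta>)" using smooth_fun_dderiv[OF s basis_mem(1)] dt_K[OF d] by simp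
  have sx: "smooth_fun (Kx j n \<delta>)" using smooth_fun_dderiv[OF s basis_mem(2)] dx_K[OF d] by simp
  show "K n \<delta> \<in> borel_measurable borel" "Kt n \<delta> \<in> borel_measurable borel" "Kx j n \<delta> \<in> borel_measurable borel"
    by (rule smooth_fun_measurable[OF s] smooth_fun_measurable[OF st] smooth_fun_measurable[OF sx])+
  have z1: "Kt n \<delta> z = 0" if "norm z > ls n + \<delta>" for z
    using dderiv_zero_outside[OF s K_zero[OF d] that, of "(0,1)"] dt_K[OF d] by simp
  have z2: "Kx j n \<delta> z = 0" if "norm z > ls n + \<delta>" for z
    using dderiv_zero_outside[OF s K_zero[OF d] that, of "(axis j 1,0)"] dx_K[OF d] by simp
  show "\<exists>B. \<forall>z. \<bar>K n \<delta> z\<bar> \<le> B" by (rule continuous_bounded_support[OF smooth_fun_continuous[OF s] K_zero[OF d]])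
  show "\<exists>B. \<forall>z. \<bar>Kt n \<delta> z\<bar> \<le> B" by (rule continuous_bounded_support[OF smooth_fun_continuous[OF st] z1])
  show "\<exists>B. \<forall>z. \<bar>Kx j n \<delta> z\<bar> \<le> B" by (rule continuous_bounded_support[OF smooth_fun_continuous[OF sx] z2])
  show "has_dir_deriv (K n \<delta>) (0, 1) (Kt n \<delta>)" using smooth_fun_has_dir_deriv[OF s, of "(0,1)"] dt_K[OF d] by simp
  show "has_dir_deriv (K n \<delta>) (axis j 1, 0) (Kx j n \<delta>)" using smooth_fun_has_dir_deriv[OF s, of "(axis j 1,0)"] dx_K[OF d] by simp
qed

lemma K_test_fun:
  assumes d: "\<delta> > 0" and x: "cball x (ls n) \<subseteq> \<Omega>" and t: "cball t \<delta> \<subseteq> {0<..<T}"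
  shows "test_fun (\<Omega> \<times> {0<..<T}) (\<lambda>w. K n \<delta> ((x, t) - w))"
proof -
  let ?k = "\<lambda>w. K n \<delta> ((x, t) - w)"
  have "{w. ?k w \<noteq> 0} \<subseteq> cball x (ls n) \<times> cball t \<delta>"
  proof
    fix w assume "w \<in> {w. ?k w \<noteq> 0}"
    then obtain y s where w: "w = (y, s)" and nz: "en n (x - y) \<noteq> 0" "eta \<delta> (t - s) \<noteq> 0"
      by (cases w) auto
    show "w \<in> cball x (ls n) \<times> cball t \<delta>"
      using eta_support[OF ls_pos nz(1)] eta_support[OF d nz(2)] ls_pos[of n] d by (simp add: w dist_norm)
  qed
  moreover have cc: "compact (cball x (ls n) \<times> cball t \<delta>)" by (intro compact_Times compact_cball)
  ultimately have c: "closure {w. ?k w \<noteq> 0} \<subseteq> cball x (ls n) \<times> cball t \<delta>"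
    by (simp add: closure_minimal compact_imp_closed)
  then have "compact (closure {w. ?k w \<noteq> 0})"
    using bounded_subset[OF compact_imp_bounded[OF cc] c] by (simp only: compact_eq_bounded_closed closed_closure simp_thms)
  moreover have "closure {w. ?k w \<noteq> 0} \<subseteq> \<Omega> \<times> {0<..<T}" using c x t by blast
  ultimately show ?thesis using smooth_fun_reflect[OF K_smooth[OF d]] by (simp add: test_fun_def)
qed

lemma conv_int_Kx:
  assumes "\<delta> > 0" "integrable lborel g"
  shows "integrable lborel (\<lambda>w. g w * K n \<delta> (z - w))" "integrable lborel (\<lambda>w. g w * Kt n \<delta> (z - w))"
    "integrable lborel (\<lambda>w. g w * Kx j n \<delta> (z - w))"
proof -
  obtain B1 B2 B3 where B: "\<And>z. \<bar>K n \<delta> z\<bar> \<le> B1" "\<And>z. \<bar>Kt n \<delta> z\<bar> \<le> B2" "\<And>z. \<bar>Kx j n \<delta> z\<bar> \<le> B3"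
    using kernels(4,5)[OF assms(1), of n] kernels(6)[OF assms(1), of j n] by meson
  show "integrable lborel (\<lambda>w. g w * K n \<delta> (z - w))" by (rule conv_integrable[OF assms(2) kernels(1)[OF assms(1)] B(1)])
  show "integrable lborel (\<lambda>w. g w * Kt n \<delta> (z - w))" by (rule conv_integrable[OF assms(2) kernels(2)[OF assms(1)] B(2)])
  show "integrable lborel (\<lambda>w. g w * Kx j n \<delta> (z - w))" by (rule conv_integrable[OF assms(2) kernels(3)[OF assms(1)] B(3)])
qed

text \<open>The weak equations are tested with the reflected kernel centred at the point. Its
  derivatives are minus those of the kernel, so the distributional equations become pointwise ones
  for the convolutions.\<close>

lemma mollified_equations:
  assumes d: "\<delta> > 0" and x: "cball x (ls n) \<subseteq> \<Omega>" and t: "cball t \<delta> \<subseteq> {0<..<T}"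
  shows "conv (U k) (Kt n \<delta>) (x, t) + (\<Sum>j\<in>UNIV. conv (UU k j) (Kx j n \<delta>) (x, t)) + conv P (Kx k n \<delta>) (x, t)
      = conv (F k) (K n \<delta>) (x, t)"
    "(\<Sum>j\<in>UNIV. conv (U j) (Kx j n \<delta>) (x, t)) = 0"
proof -
  let ?z = "(x, t)"
  let ?k = "\<lambda>w. K n \<delta> (?z - w)"
  note tf = K_test_fun[OF assms]
  have dtk: "dt ?k = (\<lambda>w. - Kt n \<delta> (?z - w))"
    using dderiv_reflect(2)[OF K_smooth[OF d], of "(0,1)" 1 n ?z] dt_K[OF d] by (simp add: dt_def)
  have dxk: "dx j ?k = (\<lambda>w. - Kx j n \<delta> (?z - w))" for j
    using dderiv_reflect(2)[OF K_smooth[OF d], of "(axis j 1,0)" 1 n ?z] dx_K[OF d] by (simp add: dx_def)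
  note i = conv_int_Kx[OF d]
  have "0 = (\<integral>w. U k w * dt ?k w + (\<Sum>j\<in>UNIV. U k w * U j w * dx j ?k w) + P w * dx k ?k w + F k w * ?k w \<partial>lborel)"
    using momentum[OF tf, of k] by simp
  also have "\<dots> = (\<integral>w. - (U k w * Kt n \<delta> (?z - w)) - (\<Sum>j\<in>UNIV. UU k j w * Kx j n \<delta> (?z - w)) - P w * Kx k n \<delta> (?z - w) + F k w * K n \<delta> (?z - w) \<partial>lborel)"
    unfolding dtk dxk by (simp add: sum_negf)
  also have "\<dots> = - conv (U k) (Kt n \<delta>) ?z - (\<Sum>j\<in>UNIV. conv (UU k j) (Kx j n \<delta>) ?z) - conv P (Kx k n \<delta>) ?z + conv (F k) (K n \<delta>) ?z"
    unfolding conv_def by (rule integral_momentum_split[OF i(2)[OF U_int] i(3)[OF UU_int] i(3)[OF P_int] i(1)[OF F_int]])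
  finally show "conv (U k) (Kt n \<delta>) (x, t) + (\<Sum>j\<in>UNIV. conv (UU k j) (Kx j n \<delta>) (x, t)) + conv P (Kx k n \<delta>) (x, t)
      = conv (F k) (K n \<delta>) (x, t)" by simp
  have "0 = (\<integral>w. (\<Sum>j\<in>UNIV. U j w * dx j ?k w) \<partial>lborel)" using divergence[OF tf] by simp
  also have "\<dots> = (\<integral>w. - (\<Sum>j\<in>UNIV. U j w * Kx j n \<delta> (?z - w)) \<partial>lborel)"
    unfolding dxk by (simp add: sum_negf)
  also have "\<dots> = - (\<Sum>j\<in>UNIV. conv (U j) (Kx j n \<delta>) ?z)"
    unfolding conv_def Bochner_Integration.integral_minus
    by (subst Bochner_Integration.integral_sum) (auto intro!: i(3)[OF U_int])
  finally show "(\<Sum>j\<in>UNIV. conv (U j) (Kx j n \<delta>) (x, t)) = 0" by simp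
qed

end

text \<open>These functions multiply integrable ones into integrable ones, and they are closed under
  the algebraic operations, so integrability of long products reduces to that of one factor.\<close>

definition bounded_borel :: "('a::euclidean_space \<Rightarrow> real) \<Rightarrow> bool" where
  "bounded_borel f \<longleftrightarrow> f \<in> borel_measurable borel \<and> (\<exists>B. \<forall>z. \<bar>f z\<bar> \<le> B)"

lemma bounded_borel_mult:
  assumes "bounded_borel f" "bounded_borel g"
  shows "bounded_borel (\<lambda>z. f z * g z)"
proof -
  obtain B B' where "\<And>z. \<bar>f z\<bar> \<le> B" "\<And>z. \<bar>g z\<bar> \<le> B'" using assms by (auto simp: bounded_borel_def)
  then have "\<bar>f z * g z\<bar> \<le> B * B'" for z
    unfolding abs_mult by (intro mult_mono) (auto intro: order_trans[OF abs_ge_zero])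
  then show ?thesis using assms by (auto simp: bounded_borel_def)
qed

lemma bounded_borel_add:
  assumes "bounded_borel f" "bounded_borel g"
  shows "bounded_borel (\<lambda>z. f z + g z)"
proof -
  obtain B B' where B: "\<And>z. \<bar>f z\<bar> \<le> B" "\<And>z. \<bar>g z\<bar> \<le> B'" using assms by (auto simp: bounded_borel_def)
  have "\<bar>f z + g z\<bar> \<le> B + B'" for z using B(1)[of z] B(2)[of z] by linarith
  then show ?thesis using assms by (auto simp: bounded_borel_def)
qed

lemma bounded_borel_cmult: "bounded_borel f \<Longrightarrow> bounded_borel (\<lambda>z. c * f z)"
  by (rule bounded_borel_mult) (auto simp: bounded_borel_def)

lemma bounded_borel_diff:
  assumes "bounded_borel f" "bounded_borel g"
  shows "bounded_borel (\<lambda>z. f z - g z)"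
  using bounded_borel_add[OF assms(1) bounded_borel_cmult[OF assms(2), of "-1"]] by simp

lemma bounded_borel_sum:
  assumes "\<And>i. i \<in> I \<Longrightarrow> bounded_borel (f i)" "finite I"
  shows "bounded_borel (\<lambda>z. \<Sum>i\<in>I. f i z)"
  using assms(2,1)
proof (induction I rule: finite_induct)
  case empty
  then show ?case by (auto simp: bounded_borel_def)
next
  case (insert i I)
  then show ?case using bounded_borel_add[of "f i" "\<lambda>z. \<Sum>i\<in>I. f i z"] by simp
qed

lemma integrable_bounded_borel:
  assumes "integrable lborel g" "bounded_borel f"
  shows "integrable lborel (\<lambda>z. g z * f z)"
proof -
  obtain B where "\<And>z. \<bar>f z\<bar> \<le> B" using assms by (auto simp: bounded_borel_def)
  then show ?thesis using assms by (intro integrable_mult_bounded(1)[where C=B]) (auto simp: bounded_borel_def)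
qed

lemma test_fun_facts:
  fixes \<psi> :: "'a::euclidean_space \<Rightarrow> real"
  assumes \<psi>: "test_fun W \<psi>" and v: "v \<in> Basis"
  shows "integrable lborel \<psi>" "bounded_borel \<psi>" "integrable lborel (dderiv v \<psi>)" "bounded_borel (dderiv v \<psi>)"
proof -
  note s = test_fun_smooth[OF \<psi>]
  obtain R where R: "\<And>z. norm z > R \<Longrightarrow> \<psi> z = 0" using test_fun_bounded_support[OF \<psi>] by blast
  have c: "continuous_on UNIV \<psi>" by (rule smooth_fun_continuous[OF s])
  have sd: "smooth_fun (dderiv v \<psi>)" by (rule smooth_fun_dderiv[OF s v])
  have cd: "continuous_on UNIV (dderiv v \<psi>)" by (rule smooth_fun_continuous[OF sd])
  have Rd: "dderiv v \<psi> z = 0" if "norm z > R" for z by (rule dderiv_zero_outside[OF s R that])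
  show "integrable lborel \<psi>" by (rule continuous_bounded_support[OF c R])
  show "integrable lborel (dderiv v \<psi>)" by (rule continuous_bounded_support[OF cd Rd])
  show "bounded_borel \<psi>" using continuous_bounded_support(1)[OF c R] smooth_fun_measurable[OF s] by (simp add: bounded_borel_def)
  show "bounded_borel (dderiv v \<psi>)" using continuous_bounded_support(1)[OF cd Rd] smooth_fun_measurable[OF sd] by (simp add: bounded_borel_def)
qed

lemma integration_by_parts:
  fixes \<psi> :: "'a::euclidean_space \<Rightarrow> real"
  assumes \<psi>: "test_fun W \<psi>" and v: "v \<in> Basis" and f: "has_dir_deriv f v f'" "bounded_borel f" "bounded_borel f'"
  shows "(\<integral>z. dderiv v \<psi> z * f z \<partial>lborel) = - (\<integral>z. \<psi> z * f' z \<partial>lborel)"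
proof -
  note t = test_fun_facts[OF \<psi> v]
  obtain R where R: "\<And>z. norm z > R \<Longrightarrow> \<psi> z = 0" using test_fun_bounded_support[OF \<psi>] by blast
  have dd: "has_dir_deriv (\<lambda>z. \<psi> z * f z) v (\<lambda>z. dderiv v \<psi> z * f z + \<psi> z * f' z)"
    by (intro has_dir_deriv_mult smooth_fun_has_dir_deriv[OF test_fun_smooth[OF \<psi>]] f(1))
  have "bounded_borel (\<lambda>z. dderiv v \<psi> z * f z + \<psi> z * f' z)"
    by (intro bounded_borel_add bounded_borel_mult t f)
  then obtain B where B: "\<And>z. \<bar>dderiv v \<psi> z * f z + \<psi> z * f' z\<bar> \<le> B" by (auto simp: bounded_borel_def)
  have "(\<integral>z. dderiv v \<psi> z * f z + \<psi> z * f' z \<partial>lborel) = 0"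
  proof (rule integral_has_dir_deriv_zero(2)[OF dd B])
    show "(\<lambda>z. \<psi> z * f z) \<in> borel_measurable borel"
      using bounded_borel_mult[OF t(2) f(2)] by (simp add: bounded_borel_def)
    show "integrable lborel (\<lambda>z. \<psi> z * f z)" by (rule integrable_bounded_borel[OF t(1) f(2)])
  qed (use R in auto)
  moreover have "(\<integral>z. dderiv v \<psi> z * f z + \<psi> z * f' z \<partial>lborel) = (\<integral>z. dderiv v \<psi> z * f z \<partial>lborel) + (\<integral>z. \<psi> z * f' z \<partial>lborel)"
    by (intro Bochner_Integration.integral_add integrable_bounded_borel t f)
  ultimately show ?thesis by simp
qed

section \<open>The energy balance of the mollified equations and its defect\<close>

context spacetime
begin

text \<open>\<open>Q\<close> is the Bernoulli pressure, which is the one transported in the energy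
  flux. Moving the energy gradient from the nonlinearity into the pressure leaves \<open>S\<close>,
  the part governed by the vorticity; \<open>Sx\<close> is its counterpart with mollification in
  space only.\<close>

abbreviation Q :: "(real^'d) \<times> real \<Rightarrow> real" where "Q \<equiv> (\<lambda>z. P z + E z)"
abbreviation S :: "nat \<Rightarrow> real \<Rightarrow> 'd \<Rightarrow> (real^'d) \<times> real \<Rightarrow> real" where
  "S n \<delta> k \<equiv> (\<lambda>z. (\<Sum>j\<in>UNIV. conv (UU k j) (Kx j n \<delta>) z) - conv E (Kx k n \<delta>) z)"
abbreviation Sx :: "nat \<Rightarrow> 'd \<Rightarrow> (real^'d) \<times> real \<Rightarrow> real" where
  "Sx n k \<equiv> (\<lambda>z. (\<Sum>j\<in>UNIV. space_conv (UU k j) (dsp j (en n)) z) - space_conv E (dsp k (en n)) z)"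

lemma Q_int: "integrable lborel Q" using P_int E_int by simp

lemma conv_bounded_borel:
  assumes "\<delta> > 0" "integrable lborel g"
  shows "bounded_borel (conv g (K n \<delta>))" "bounded_borel (conv g (Kt n \<delta>))" "bounded_borel (conv g (Kx j n \<delta>))"
proof -
  have *: "bounded_borel (conv g k)" if k: "k \<in> borel_measurable borel" "\<exists>B. \<forall>z. \<bar>k z\<bar> \<le> B" for k
  proof -
    obtain B where "\<And>z. \<bar>k z\<bar> \<le> B" using k by blast
    from conv_bound_L1[OF assms(2) k(1) this] show ?thesis
      using conv_measurable[of g k] assms(2) k(1) by (auto simp: bounded_borel_def)
  qed
  show "bounded_borel (conv g (K n \<delta>))" "bounded_borel (conv g (Kt n \<delta>))" "bounded_borel (conv g (Kx j n \<delta>))"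
    by (rule * kernels[OF assms(1)])+
qed

lemma conv_has_dir_deriv:
  assumes "\<delta> > 0" "integrable lborel g"
  shows "has_dir_deriv (conv g (K n \<delta>)) (0, 1) (conv g (Kt n \<delta>))" "has_dir_deriv (conv g (K n \<delta>)) (axis j 1, 0) (conv g (Kx j n \<delta>))"
proof -
  obtain B1 B2 B3 where B: "\<And>z. \<bar>K n \<delta> z\<bar> \<le> B1" "\<And>z. \<bar>Kt n \<delta> z\<bar> \<le> B2" "\<And>z. \<bar>Kx j n \<delta> z\<bar> \<le> B3"
    using kernels(4,5)[OF assms(1), of n] kernels(6)[OF assms(1), of j n] by meson
  show "has_dir_deriv (conv g (K n \<delta>)) (0, 1) (conv g (Kt n \<delta>))"
    by (rule has_dir_deriv_conv[OF assms(2) kernels(7)[OF assms(1)] kernels(1)[OF assms(1)] B(1,2)])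
  show "has_dir_deriv (conv g (K n \<delta>)) (axis j 1, 0) (conv g (Kx j n \<delta>))"
    by (rule has_dir_deriv_conv[OF assms(2) kernels(8)[OF assms(1)] kernels(1)[OF assms(1)] B(1,3)])
qed

text \<open>The mollified momentum equation, written with \<open>S\<close> and the gradient of
  \<open>Q\<close>, is multiplied by the mollified velocity and by \<open>\<psi>\<close>.
  Derivatives in time and of \<open>Q\<close> are moved onto \<open>\<psi>\<close>, and the
  divergence of the mollified velocity vanishes. The identity is exact, so the right-hand side is
  the whole defect at positive scales.\<close>

lemma mollified_energy:
  assumes \<psi>: "test_fun (\<Omega> \<times> {0<..<T}) \<psi>" and e: "\<And>z. \<psi> z \<noteq> 0 \<Longrightarrow> cball z e \<subseteq> \<Omega> \<times> {0<..<T}"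
    and d: "\<delta> > 0" "\<delta> \<le> e" and n: "ls n \<le> e"
  shows "(\<Sum>k\<in>UNIV. \<integral>z. dt \<psi> z * (conv (U k) (K n \<delta>) z * conv (U k) (K n \<delta>) z) \<partial>lborel) / 2
      + (\<Sum>k\<in>UNIV. \<integral>z. dx k \<psi> z * (conv Q (K n \<delta>) z * conv (U k) (K n \<delta>) z) \<partial>lborel)
      + (\<Sum>k\<in>UNIV. \<integral>z. \<psi> z * (conv (F k) (K n \<delta>) z * conv (U k) (K n \<delta>) z) \<partial>lborel)
    = (\<Sum>k\<in>UNIV. \<integral>z. \<psi> z * (S n \<delta> k z * conv (U k) (K n \<delta>) z) \<partial>lborel)"
proof -
  let ?a = "\<lambda>k. conv (U k) (K n \<delta>)" and ?at = "\<lambda>k. conv (U k) (Kt n \<delta>)" and ?ax = "\<lambda>j k. conv (U k) (Kx j n \<delta>)"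
  let ?q = "conv Q (K n \<delta>)" and ?qx = "\<lambda>k. conv Q (Kx k n \<delta>)" and ?f = "\<lambda>k. conv (F k) (K n \<delta>)"
  note bb = conv_bounded_borel[OF d(1)] and hd = conv_has_dir_deriv[OF d(1)]
  note t = test_fun_facts[OF \<psi> basis_mem(1)]
  have S: "bounded_borel (S n \<delta> k)" for k
    by (intro bounded_borel_diff bounded_borel_sum bb UU_int E_int) simp
  have A: "(\<integral>z. dt \<psi> z * (?a k z * ?a k z) \<partial>lborel) = - 2 * (\<integral>z. \<psi> z * (?at k z * ?a k z) \<partial>lborel)" for k
  proof -
    have "(\<integral>z. dt \<psi> z * (?a k z * ?a k z) \<partial>lborel) = - (\<integral>z. \<psi> z * (?at k z * ?a k z + ?a k z * ?at k z) \<partial>lborel)"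
      unfolding dt_def
      by (intro integration_by_parts[OF \<psi> basis_mem(1)] has_dir_deriv_mult hd bounded_borel_mult bounded_borel_add bb U_int)
    also have "(\<lambda>z. \<psi> z * (?at k z * ?a k z + ?a k z * ?at k z)) = (\<lambda>z. 2 * (\<psi> z * (?at k z * ?a k z)))"
      by (simp add: fun_eq_iff)
    finally show ?thesis by simp
  qed
  have B: "(\<integral>z. dx k \<psi> z * (?q z * ?a k z) \<partial>lborel) = - (\<integral>z. \<psi> z * (?qx k z * ?a k z) \<partial>lborel) - (\<integral>z. \<psi> z * (?q z * ?ax k k z) \<partial>lborel)" for k
  proof -
    have "(\<integral>z. dx k \<psi> z * (?q z * ?a k z) \<partial>lborel) = - (\<integral>z. \<psi> z * (?qx k z * ?a k z + ?q z * ?ax k k z) \<partial>lborel)"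
      unfolding dx_def
      by (intro integration_by_parts[OF \<psi> basis_mem(2)] has_dir_deriv_mult hd bounded_borel_mult bounded_borel_add bb U_int Q_int)
    also have "(\<integral>z. \<psi> z * (?qx k z * ?a k z + ?q z * ?ax k k z) \<partial>lborel) = (\<integral>z. \<psi> z * (?qx k z * ?a k z) \<partial>lborel) + (\<integral>z. \<psi> z * (?q z * ?ax k k z) \<partial>lborel)"
      unfolding distrib_left
      by (intro Bochner_Integration.integral_add integrable_bounded_borel[OF t(1)] bounded_borel_mult bb U_int Q_int)
    finally show ?thesis by simp
  qed
  \<comment> \<open>Both scales are at most \<open>e\<close>, so wherever \<open>\<psi>\<close> is
    non-zero the kernel stays inside the domain and the mollified equations hold.\<close>
  have nb: "cball x (ls n) \<subseteq> \<Omega>" "cball s \<delta> \<subseteq> {0<..<T}" if "\<psi> (x, s) \<noteq> 0" for x s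
    using cball_times_subset[OF e[OF that]] n d subset_cball[of "ls n" e x] subset_cball[of \<delta> e s] by auto
  have div0: "(\<Sum>k\<in>UNIV. \<integral>z. \<psi> z * (?q z * ?ax k k z) \<partial>lborel) = 0"
  proof -
    have "(\<Sum>k\<in>UNIV. \<integral>z. \<psi> z * (?q z * ?ax k k z) \<partial>lborel) = (\<integral>z. (\<Sum>k\<in>UNIV. \<psi> z * (?q z * ?ax k k z)) \<partial>lborel)"
      by (intro Bochner_Integration.integral_sum[symmetric] integrable_bounded_borel[OF t(1)] bounded_borel_mult bb U_int Q_int)
    also have "(\<lambda>z. \<Sum>k\<in>UNIV. \<psi> z * (?q z * ?ax k k z)) = (\<lambda>z. 0)"
    proof
      fix z :: "(real^'d) \<times> real"
      obtain x s where z: "z = (x, s)" by fastforce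
      have "(\<Sum>k\<in>UNIV. \<psi> z * (?q z * ?ax k k z)) = \<psi> z * ?q z * (\<Sum>k\<in>UNIV. ?ax k k z)"
        by (simp only: sum_distrib_left mult.assoc)
      then show "(\<Sum>k\<in>UNIV. \<psi> z * (?q z * ?ax k k z)) = 0"
        using mollified_equations(2)[OF d(1) nb, of x s] z by (cases "\<psi> z = 0") auto
    qed
    finally show ?thesis by simp
  qed
  have M: "(\<integral>z. \<psi> z * (?f k z * ?a k z) \<partial>lborel) = (\<integral>z. \<psi> z * (?at k z * ?a k z) \<partial>lborel) + (\<integral>z. \<psi> z * (S n \<delta> k z * ?a k z) \<partial>lborel) + (\<integral>z. \<psi> z * (?qx k z * ?a k z) \<partial>lborel)" for k
  proof -
    have "(\<integral>z. \<psi> z * (?at k z * ?a k z) \<partial>lborel) + (\<integral>z. \<psi> z * (S n \<delta> k z * ?a k z) \<partial>lborel) + (\<integral>z. \<psi> z * (?qx k z * ?a k z) \<partial>lborel)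
      = (\<integral>z. \<psi> z * (?at k z * ?a k z) + \<psi> z * (S n \<delta> k z * ?a k z) + \<psi> z * (?qx k z * ?a k z) \<partial>lborel)"
    proof -
      have 1: "integrable lborel (\<lambda>z. \<psi> z * (?at k z * ?a k z))" "integrable lborel (\<lambda>z. \<psi> z * (S n \<delta> k z * ?a k z))"
        "integrable lborel (\<lambda>z. \<psi> z * (?qx k z * ?a k z))"
        by (intro integrable_bounded_borel[OF t(1)] bounded_borel_mult bb U_int Q_int S)+
      show ?thesis
        by (simp only: Bochner_Integration.integral_add[OF Bochner_Integration.integrable_add[OF 1(1,2)] 1(3)] Bochner_Integration.integral_add[OF 1(1,2)])
    qed
    also have "\<dots> = (\<integral>z. \<psi> z * (?f k z * ?a k z) \<partial>lborel)"
    proof (rule Bochner_Integration.integral_cong[OF refl])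
      fix z :: "(real^'d) \<times> real"
      obtain x s where z: "z = (x, s)" by fastforce
      have q: "?qx k z = conv P (Kx k n \<delta>) z + conv E (Kx k n \<delta>) z"
        unfolding conv_def distrib_right
        by (intro Bochner_Integration.integral_add conv_int_Kx[OF d(1)] P_int E_int)
      have eq: "?at k z + S n \<delta> k z + ?qx k z = ?f k z" if "\<psi> z \<noteq> 0"
        using mollified_equations(1)[OF d(1) nb[OF that[unfolded z]], where k=k] unfolding q unfolding z by linarith
      have "\<psi> z * (?at k z * ?a k z) + \<psi> z * (S n \<delta> k z * ?a k z) + \<psi> z * (?qx k z * ?a k z) = \<psi> z * ((?at k z + S n \<delta> k z + ?qx k z) * ?a k z)"
        by (simp only: distrib_left distrib_right)
      also have "\<dots> = \<psi> z * (?f k z * ?a k z)"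
      proof (cases "\<psi> z = 0")
        case False
        show ?thesis unfolding eq[OF False] ..
      qed simp
      finally show "\<psi> z * (?at k z * ?a k z) + \<psi> z * (S n \<delta> k z * ?a k z) + \<psi> z * (?qx k z * ?a k z) = \<psi> z * (?f k z * ?a k z)" .
    qed
    finally show ?thesis by simp
  qed
  have A': "(\<Sum>k\<in>UNIV. \<integral>z. dt \<psi> z * (?a k z * ?a k z) \<partial>lborel) / 2 = - (\<Sum>k\<in>UNIV. \<integral>z. \<psi> z * (?at k z * ?a k z) \<partial>lborel)"
    unfolding A by (simp only: sum_distrib_left[symmetric])
  have B': "(\<Sum>k\<in>UNIV. \<integral>z. dx k \<psi> z * (?q z * ?a k z) \<partial>lborel) = - (\<Sum>k\<in>UNIV. \<integral>z. \<psi> z * (?qx k z * ?a k z) \<partial>lborel)"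
    unfolding B sum_subtractf div0 sum_negf by simp
  show ?thesis unfolding A' B' M sum.distrib by simp
qed

lemma K_L1_tendsto:
  assumes "integrable lborel g" "\<And>n. \<delta> n > 0" "\<delta> \<longlonglongrightarrow> 0"
  shows "L1_tendsto lborel (\<lambda>n. conv g (K n (\<delta> n))) g"
proof (rule L1_tendsto_conv[OF assms(1)])
  show "0 \<le> K n (\<delta> n) z" for n z
    by (cases z) (simp add: eta_nonneg[OF ls_pos] eta_nonneg[OF assms(2)])
  show "integrable lborel (K n (\<delta> n))" for n
    by (intro integrable_tensor eta_integrable ls_pos assms)
  show "(\<integral>z. K n (\<delta> n) z \<partial>lborel) = 1" for n
    unfolding integrable_tensor(2)[OF eta_integrable[OF ls_pos] eta_integrable[OF assms(2)]]
      eta_integral[OF ls_pos] eta_integral[OF assms(2)] by simp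
  show "norm z \<le> ls n + \<delta> n" if "K n (\<delta> n) z \<noteq> 0" for n z
    using K_zero[OF assms(2)[of n], of n z] that by (meson not_le)
  show "(\<lambda>n. ls n + \<delta> n) \<longlonglongrightarrow> 0" using tendsto_add[OF ls0 assms(3)] by simp
qed

lemma K_bd: "\<delta> > 0 \<Longrightarrow> \<bar>conv (U k) (K n \<delta>) z\<bar> \<le> C"
proof (rule conv_bound_sup[OF U_meas U_bd])
  assume d: "\<delta> > 0"
  show "0 \<le> K n \<delta> z" for z
    by (cases z) (simp add: eta_nonneg[OF ls_pos] eta_nonneg[OF d])
  show "integrable lborel (K n \<delta>)" by (intro integrable_tensor eta_integrable ls_pos d)
  show "(\<integral>z. K n \<delta> z \<partial>lborel) = 1"
    unfolding integrable_tensor(2)[OF eta_integrable[OF ls_pos] eta_integrable[OF d]]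
      eta_integral[OF ls_pos] eta_integral[OF d] by simp
qed

lemma time_L1_tendsto:
  assumes g: "integrable lborel g" and h: "integrable lborel h" "\<exists>B. \<forall>x. \<bar>h x\<bar> \<le> B"
    and d: "\<And>n. \<delta> n > 0" "\<delta> \<longlonglongrightarrow> 0"
  shows "L1_tendsto lborel (\<lambda>m. conv g (\<lambda>(x, t). h x * eta (\<delta> m) t)) (space_conv g h)"
proof -
  obtain B where B: "\<And>x. \<bar>h x\<bar> \<le> B" using h(2) by blast
  have "\<exists>b. \<forall>t::real. \<bar>eta (\<delta> n) t\<bar> \<le> b" for n by (rule eta_bounded[OF d(1)])
  then obtain B' where B': "\<And>n (t::real). \<bar>eta (\<delta> n) t\<bar> \<le> B' n" by metis
  show ?thesis
  proof (rule L1_tendsto_conv_time[OF g h(1) B eta_nonneg[OF d(1)] eta_integrable[OF d(1)] eta_integral[OF d(1)] B' _ d(2)])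
    show "\<bar>\<tau>\<bar> \<le> \<delta> n" if "eta (\<delta> n) \<tau> \<noteq> 0" for n and \<tau> :: real
      using eta_support[OF d(1) that] d(1)[of n] by simp
  qed
qed

lemma den_facts: "integrable lborel (dsp (j::'d) (en n))" "\<exists>B. \<forall>x. \<bar>dsp (j::'d) (en n) x\<bar> \<le> B"
  unfolding dsp_def by (rule deta_props[OF ls_pos axis_in_Basis])+

lemma S_L1_tendsto:
  assumes "\<And>n. \<delta> n > 0" "\<delta> \<longlonglongrightarrow> 0"
  shows "L1_tendsto lborel (\<lambda>m. S n (\<delta> m) k) (Sx n k)"
  by (intro L1_tendsto_diff L1_tendsto_sum time_L1_tendsto UU_int E_int den_facts assms) simp

lemma xU_bd: "\<bar>space_conv (U k) (en n) z\<bar> \<le> C"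
  unfolding space_conv_def
  by (rule conv_bound_sup[OF _ U_bd eta_nonneg[OF ls_pos] eta_integrable[OF ls_pos] eta_integral[OF ls_pos]]) measurable

text \<open>The spatial scale is frozen: the derivatives in \<open>S\<close> fall on a fixed smooth
  kernel, so \<open>S\<close> converges in mean and not only as a distribution.\<close>

lemma defect_time_limit:
  assumes \<psi>: "test_fun (\<Omega> \<times> {0<..<T}) \<psi>" and d: "\<And>n. \<delta> n > 0" "\<delta> \<longlonglongrightarrow> 0"
  shows "(\<lambda>m. \<Sum>k\<in>UNIV. \<integral>z. \<psi> z * (S n (\<delta> m) k z * conv (U k) (K n (\<delta> m)) z) \<partial>lborel)
    \<longlonglongrightarrow> (\<Sum>k\<in>UNIV. \<integral>z. \<psi> z * (Sx n k z * space_conv (U k) (en n) z) \<partial>lborel)"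
proof (intro tendsto_sum)
  fix k
  obtain B where B: "\<And>z. \<bar>\<psi> z\<bar> \<le> B" and [measurable]: "\<psi> \<in> borel_measurable borel"
    using test_fun_facts(2)[OF \<psi> basis_mem(1)] by (auto simp: bounded_borel_def)
  show "(\<lambda>m. \<integral>z. \<psi> z * (S n (\<delta> m) k z * conv (U k) (K n (\<delta> m)) z) \<partial>lborel)
    \<longlonglongrightarrow> (\<integral>z. \<psi> z * (Sx n k z * space_conv (U k) (en n) z) \<partial>lborel)"
    by (rule L1_tendsto_integral_mult[OF S_L1_tendsto[OF d] time_L1_tendsto[OF U_int eta_integrable[OF ls_pos] eta_bounded[OF ls_pos] d] K_bd[OF d(1)] xU_bd _ B]) simp
qed

text \<open>With mollification in time, the mollified divergence is exactly zero as soon as the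
  kernel fits into the domain. A subsequence converging almost everywhere passes this on to the
  mollification in space alone, and Fubini to almost every slice.\<close>

lemma slice_divfree: "AE t in lborel. t \<in> {0<..<T} \<longrightarrow>
  (\<forall>n. AE x in lborel. cball x (ls n) \<subseteq> \<Omega> \<longrightarrow> (\<Sum>j\<in>UNIV. conv (\<lambda>y. U j (y, t)) (dsp j (en n)) x) = 0)"
proof -
  have "AE t in lborel. \<forall>n. AE x in lborel. t \<in> {0<..<T} \<longrightarrow> cball x (ls n) \<subseteq> \<Omega> \<longrightarrow> (\<Sum>j\<in>UNIV. conv (\<lambda>y. U j (y, t)) (dsp j (en n)) x) = 0"
    unfolding AE_all_countable
  proof
    fix n
    let ?g = "\<lambda>m z. \<Sum>j\<in>UNIV. conv (U j) (Kx j n (ls m)) z" and ?h = "\<lambda>z. \<Sum>j\<in>UNIV. space_conv (U j) (dsp j (en n)) z"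
    have L: "L1_tendsto lborel ?g ?h"
      by (intro L1_tendsto_sum time_L1_tendsto U_int den_facts ls_pos ls0) simp
    have "\<exists>r. strict_mono r \<and> (AE z in lborel. (\<lambda>m. ?g (r m) z - ?h z) \<longlonglongrightarrow> 0)"
      by (rule tendsto_L1_AE_subseq) (use L in \<open>auto simp: L1_tendsto_def\<close>)
    then obtain r where r: "strict_mono r" "AE z in lborel. (\<lambda>m. ?g (r m) z - ?h z) \<longlonglongrightarrow> 0" by blast
    have "AE z in lborel. snd z \<in> {0<..<T} \<longrightarrow> cball (fst z) (ls n) \<subseteq> \<Omega> \<longrightarrow> ?h z = 0"
      using r(2)
    proof eventually_elim
      case (elim z)
      show ?case
      proof (intro impI)
        assume a: "snd z \<in> {0<..<T}" "cball (fst z) (ls n) \<subseteq> \<Omega>"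
        \<comment> \<open>The time lies at a positive distance from the ends of the interval, so
          only finitely many time scales are too large.\<close>
        obtain e where e: "e > 0" "cball (snd z) e \<subseteq> {0<..<T}"
          using a(1) open_contains_cball[of "{0<..<T}"] open_greaterThanLessThan by blast
        obtain N where N: "\<And>m. m \<ge> N \<Longrightarrow> \<bar>ls m\<bar> < e" using LIMSEQ_D[OF ls0 e(1)] by auto
        have "?g (r m) z = 0" if "m \<ge> N" for m
        proof -
          have "r m \<ge> N" using that seq_suble[OF r(1), of m] by simp
          then have "cball (snd z) (ls (r m)) \<subseteq> {0<..<T}"
            using N[of "r m"] e(2) subset_cball[of "ls (r m)" e "snd z"] by (auto dest: less_imp_le)
          from mollified_equations(2)[OF ls_pos a(2) this] show ?thesis by simp
        qed
        then have "\<forall>\<^sub>F m in sequentially. ?g (r m) z - ?h z = - ?h z"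
          by (intro eventually_sequentiallyI[of N]) (simp only: diff_0)
        then have "(\<lambda>m. - ?h z) \<longlonglongrightarrow> 0" by (rule Lim_transform_eventually[OF elim])
        then show "?h z = 0" by (simp add: LIMSEQ_const_iff)
      qed
    qed
    from AE_lborel_swap[OF this]
    show "AE t in lborel. AE x in lborel. t \<in> {0<..<T} \<longrightarrow> cball x (ls n) \<subseteq> \<Omega> \<longrightarrow> (\<Sum>j\<in>UNIV. conv (\<lambda>y. U j (y, t)) (dsp j (en n)) x) = 0"
      by (simp add: space_conv_def)
  qed
  then show ?thesis by eventually_elim (auto elim!: eventually_mono)
qed

end

text \<open>The measure, its density and the limit \<open>V\<close> are hidden behind quantifiers
  because they are chosen for each time separately. Only the bound \<open>m\<close> on the mass
  links the slices.\<close>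

definition vorticity_slice :: "(nat \<Rightarrow> real) \<Rightarrow> (real^'d::finite) set \<Rightarrow> real \<Rightarrow> ('d \<Rightarrow> real^'d \<Rightarrow> real) \<Rightarrow> ennreal \<Rightarrow> bool" where
  "vorticity_slice ls \<Omega> C w m \<longleftrightarrow> (\<exists>\<mu> H V. sets \<mu> = sets borel \<and> finite_measure \<mu> \<and>
     (\<forall>i j. integrable \<mu> (H i j)) \<and> (\<forall>i j y. H i j y + H j i y = 0) \<and>
     (\<forall>j. V j \<in> borel_measurable borel) \<and> (\<forall>j y. \<bar>V j y\<bar> \<le> C) \<and>
     (\<forall>\<phi> i j. test_fun \<Omega> \<phi> \<longrightarrow>
        (\<integral>x. \<phi> x * H i j x \<partial>\<mu>) = - (\<integral>x. w i x * dsp j \<phi> x - w j x * dsp i \<phi> x \<partial>lborel)) \<and>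
     (AE y in \<mu>. (\<forall>i j. H i j y = 0) \<or> (\<forall>j. (\<lambda>n. conv (conv (w j) (eta (ls n))) (eta (ls n)) y) \<longlonglongrightarrow> V j y)) \<and>
     ennreal (\<Sum>k\<in>UNIV. \<Sum>j\<in>UNIV. \<integral>y. \<bar>H k j y\<bar> \<partial>\<mu>) \<le> m)"

section \<open>Vanishing of the defect as the spatial scale tends to zero\<close>

locale spacetime_vorticity = spacetime ls \<Omega> T C U P F
  for ls and \<Omega> :: "(real^'d::finite) set" and T C U P F +
  fixes m :: "real \<Rightarrow> ennreal" and c :: real
  assumes m: "(\<integral>\<^sup>+ t \<in> {0<..<T}. m t \<partial>lborel) < \<infinity>" and c: "c \<ge> 0"
    and vorticity: "AE t in lborel. t \<in> {0<..<T} \<longrightarrow> vorticity_slice ls \<Omega> C (\<lambda>j x. U j (x, t)) (ennreal c * m t)"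
begin

text \<open>By Fubini the defect is the time integral of the slice defects \<open>r n t\<close>. For
  almost every time these tend to zero, and they are bounded by a multiple of \<open>m t\<close>,
  which has finite integral; dominated convergence in time concludes.\<close>

lemma defect_vanishes:
  assumes \<psi>: "test_fun (\<Omega> \<times> {0<..<T}) \<psi>"
  shows "(\<lambda>n. \<Sum>k\<in>UNIV. \<integral>z. \<psi> z * (Sx n k z * space_conv (U k) (en n) z) \<partial>lborel) \<longlonglongrightarrow> 0" (is "?R \<longlonglongrightarrow> 0")
proof -
  define r where "r n t = (\<integral>x. \<psi> (x, t) * (\<Sum>k\<in>UNIV. space_conv (U k) (en n) (x, t) * Sx n k (x, t)) \<partial>lborel)" for n t
  obtain B where B: "\<And>z. \<bar>\<psi> z\<bar> \<le> B" and \<psi>m[measurable]: "\<psi> \<in> borel_measurable borel"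
    using test_fun_facts(2)[OF \<psi> basis_mem(1)] by (auto simp: bounded_borel_def)
  obtain R where R: "\<And>z. norm z > R \<Longrightarrow> \<psi> z = 0" using test_fun_bounded_support[OF \<psi>] by blast
  have "open (\<Omega> \<times> {0<..<T})" using \<Omega> by (intro open_Times) auto
  then obtain e where e: "e > 0" "\<And>z. \<psi> z \<noteq> 0 \<Longrightarrow> cball z e \<subseteq> \<Omega> \<times> {0<..<T}" using test_fun_margin[OF \<psi>] by blast
  obtain N where N: "\<And>n. n \<ge> N \<Longrightarrow> ls n \<le> e"
    using LIMSEQ_D[OF ls0 e(1)] by (metis abs_le_D1 diff_zero less_imp_le real_norm_def)
  have B0: "B \<ge> 0" using B[of undefined] by linarith
  have Sx_int: "integrable lborel (Sx n k)" for n k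
    by (intro Bochner_Integration.integrable_diff Bochner_Integration.integrable_sum space_conv_integrable UU_int E_int den_facts)
  have xU_m: "space_conv (U k) (en n) \<in> borel_measurable borel" for n k
    using space_conv_integrable[OF U_int eta_integrable[OF ls_pos]] by auto
  have int1: "integrable lborel (\<lambda>z. \<psi> z * (Sx n k z * space_conv (U k) (en n) z))" for n k
    by (rule integrable_mult_bounded(2)[OF integrable_mult_bounded(1)[OF Sx_int _ xU_bd] _ B]) (use xU_m in auto)
  have Req: "?R n = (\<integral>z. \<psi> z * (\<Sum>k\<in>UNIV. space_conv (U k) (en n) z * Sx n k z) \<partial>lborel)" for n
  proof -
    have "?R n = (\<integral>z. (\<Sum>k\<in>UNIV. \<psi> z * (Sx n k z * space_conv (U k) (en n) z)) \<partial>lborel)"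
      by (intro Bochner_Integration.integral_sum[symmetric] int1)
    also have "(\<lambda>z. \<Sum>k\<in>UNIV. \<psi> z * (Sx n k z * space_conv (U k) (en n) z)) = (\<lambda>z. \<psi> z * (\<Sum>k\<in>UNIV. space_conv (U k) (en n) z * Sx n k z))"
      by (simp only: sum_distrib_left mult.commute[of "space_conv (U k) (en n) z" for k n z])
    finally show ?thesis .
  qed
  have int2: "integrable (lborel \<Otimes>\<^sub>M lborel) (\<lambda>(x, t). \<psi> (x, t) * (\<Sum>k\<in>UNIV. space_conv (U k) (en n) (x, t) * Sx n k (x, t)))" for n
  proof -
    have "integrable lborel (\<lambda>z. \<Sum>k\<in>UNIV. \<psi> z * (Sx n k z * space_conv (U k) (en n) z))"
      by (intro Bochner_Integration.integrable_sum int1)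
    also have "(\<lambda>z. \<Sum>k\<in>UNIV. \<psi> z * (Sx n k z * space_conv (U k) (en n) z)) = (\<lambda>(x, t). \<psi> (x, t) * (\<Sum>k\<in>UNIV. space_conv (U k) (en n) (x, t) * Sx n k (x, t)))"
    proof
      fix z :: "(real^'d) \<times> real"
      obtain x t where "z = (x, t)" by fastforce
      then show "(\<Sum>k\<in>UNIV. \<psi> z * (Sx n k z * space_conv (U k) (en n) z)) = (case z of (x, t) \<Rightarrow> \<psi> (x, t) * (\<Sum>k\<in>UNIV. space_conv (U k) (en n) (x, t) * Sx n k (x, t)))"
        by (simp only: prod.case sum_distrib_left mult.commute[of "space_conv (U k) (en n) z" for k n z])
    qed
    finally show ?thesis by (simp only: lborel_prod)
  qed
  have r_int: "integrable lborel (r n)" for n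
    unfolding r_def by (rule lborel_pair.integrable_snd[OF int2])
  have Rr: "?R n = (\<integral>t. r n t \<partial>lborel)" for n
    unfolding Req r_def lborel_pair.integral_snd[OF int2] by (simp add: lborel_prod split_beta')
  have [measurable]: "r n \<in> borel_measurable borel" for n using r_int[of n] by auto
  have U_slice: "AE t in lborel. \<forall>j. integrable lborel (\<lambda>x. U j (x, t))"
    unfolding AE_all_countable
  proof
    fix j
    have "integrable (lborel \<Otimes>\<^sub>M lborel) (\<lambda>(x, t). U j (x, t))" using U_int[of j] by (simp add: lborel_prod)
    from lborel_pair.AE_integrable_snd[OF this] show "AE t in lborel. integrable lborel (\<lambda>x. U j (x, t))" .
  qed
  have key: "AE t in lborel. (\<lambda>n. r n t) \<longlonglongrightarrow> 0 \<and> (\<forall>n\<ge>N. ennreal \<bar>r n t\<bar> \<le> ennreal (B * C * C * c) * (m t * indicator {0<..<T} t))"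
    using vorticity slice_divfree U_slice
  proof eventually_elim
    case (elim t)
    show ?case
    proof (cases "t \<in> {0<..<T}")
      case False
      have "\<psi> (x, t) = 0" for x
      proof (rule ccontr)
        assume "\<psi> (x, t) \<noteq> 0"
        from subsetD[OF e(2)[OF this], of "(x, t)"] e(1) have "(x, t) \<in> \<Omega> \<times> {0<..<T}" by simp
        then show False using False by simp
      qed
      then have "r n t = 0" for n by (simp add: r_def)
      then show ?thesis by simp
    next
      case True
      \<comment> \<open>The choice is made for this \<open>t\<close> alone and nothing is asserted
        about its dependence on \<open>t\<close>: only the numbers \<open>r n t\<close>, measurable
        by Fubini, are used outside this case.\<close>
      obtain \<mu> H V where v: "sets \<mu> = sets borel" "finite_measure \<mu>"
        "\<And>i j. integrable \<mu> (H i j)" "\<And>i j y. H i j y + H j i y = 0"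
        "\<And>j. V j \<in> borel_measurable borel" "\<And>j y. \<bar>V j y\<bar> \<le> C"
        "\<And>\<phi> i j. test_fun \<Omega> \<phi> \<Longrightarrow>
          (\<integral>x. \<phi> x * H i j x \<partial>\<mu>) = - (\<integral>x. U i (x, t) * dsp j \<phi> x - U j (x, t) * dsp i \<phi> x \<partial>lborel)"
        "AE y in \<mu>. (\<forall>i j. H i j y = 0) \<or> (\<forall>j. (\<lambda>n. conv (conv (\<lambda>x. U j (x, t)) (en n)) (en n) y) \<longlonglongrightarrow> V j y)"
        "ennreal (\<Sum>k\<in>UNIV. \<Sum>j\<in>UNIV. \<integral>y. \<bar>H k j y\<bar> \<partial>\<mu>) \<le> ennreal c * m t"
        using mp[OF elim(1) True] unfolding vorticity_slice_def
        by (elim exE conjE) (rule that; (assumption | (erule spec) | blast))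
      interpret sl: slice ls \<Omega> C "\<lambda>j x. U j (x, t)" \<mu> H V
      proof (intro slice.intro slice_axioms.intro)
        show "\<And>n. AE x in lborel. cball x (ls n) \<subseteq> \<Omega> \<longrightarrow> (\<Sum>j\<in>UNIV. conv (\<lambda>x. U j (x, t)) (dsp j (en n)) x) = 0"
          using mp[OF elim(2) True] by blast
        show "\<And>j. (\<lambda>x. U j (x, t)) \<in> borel_measurable borel" by measurable
        show "\<And>j. integrable lborel (\<lambda>x. U j (x, t))" using elim(3) by blast
      qed (rule moll_seq_axioms \<Omega> U_bd v; assumption?)+
      have ph: "continuous_on UNIV (\<lambda>x. \<psi> (x, t))"
        by (rule continuous_on_compose2[OF smooth_fun_continuous[OF test_fun_smooth[OF \<psi>]]]) (auto intro!: continuous_intros)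
      have Rt: "\<psi> (x, t) = 0" if "norm x > R" for x
        using R[of "(x, t)"] that norm_fst_le[of x t] by simp
      have et: "cball x e \<subseteq> \<Omega>" if "\<psi> (x, t) \<noteq> 0" for x
        using cball_times_subset(1)[OF e(2)[OF that]] e(1) by simp
      note ds = sl.defect_slice[OF ph B Rt e(1) et]
      have re: "r = (\<lambda>n t. \<integral>x. \<psi> (x, t) * (\<Sum>k\<in>UNIV. conv (\<lambda>y. U k (y, t)) (en n) x *
           ((\<Sum>j\<in>UNIV. conv (\<lambda>y. U k (y, t) * U j (y, t)) (dsp j (en n)) x) - conv (\<lambda>y. (\<Sum>j\<in>UNIV. (U j (y, t))\<^sup>2) / 2) (dsp k (en n)) x)) \<partial>lborel)"
        by (simp only: r_def fun_eq_iff space_conv_def fst_conv snd_conv simp_thms)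
      have "(\<lambda>n. r n t) \<longlonglongrightarrow> 0" unfolding re by (rule ds(2))
      moreover have "ennreal \<bar>r n t\<bar> \<le> ennreal (B * C * C * c) * (m t * indicator {0<..<T} t)" if "n \<ge> N" for n
      proof -
        have "\<bar>r n t\<bar> \<le> B * C * C * (\<Sum>k\<in>UNIV. \<Sum>j\<in>UNIV. \<integral>y. \<bar>H k j y\<bar> \<partial>\<mu>)"
          unfolding re by (rule ds(1)) (assumption | rule N[OF that])+
        then have "ennreal \<bar>r n t\<bar> \<le> ennreal (B * C * C) * ennreal (\<Sum>k\<in>UNIV. \<Sum>j\<in>UNIV. \<integral>y. \<bar>H k j y\<bar> \<partial>\<mu>)"
          using B0 C_nonneg by (subst ennreal_mult[symmetric]) (auto intro!: sum_nonneg ennreal_leI)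
        also have "\<dots> \<le> ennreal (B * C * C) * (ennreal c * m t)" by (intro mult_left_mono v(9)) simp
        also have "\<dots> = ennreal (B * C * C * c) * (m t * indicator {0<..<T} t)"
          using True B0 C_nonneg c by (simp add: ennreal_mult mult.assoc)
        finally show ?thesis .
      qed
      ultimately show ?thesis by blast
    qed
  qed
  \<comment> \<open>\<open>m\<close> is not assumed measurable, so this supremum takes its place as the majorant.\<close>
  define W where "W t = (SUP n. ennreal \<bar>r (n + N) t\<bar>)" for t
  have Wm[measurable]: "W \<in> borel_measurable lborel" unfolding W_def by measurable
  \<comment> \<open>The added 1 keeps \<open>\<kappa>\<close> positive when
    \<open>B * C * C * c\<close> is zero, so that dividing by it is possible.\<close>
  define \<kappa> where "\<kappa> = B * C * C * c + 1"
  have \<kappa>: "\<kappa> > 0" using B0 C_nonneg c by (simp add: \<kappa>_def add_nonneg_pos)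
  \<comment> \<open>The constant is placed in front of the measurable \<open>W\<close>, so that the
    comparison ends with the integral of \<open>m\<close> itself.\<close>
  have "ennreal (1 / \<kappa>) * (\<integral>\<^sup>+ t. W t \<partial>lborel) = (\<integral>\<^sup>+ t. ennreal (1 / \<kappa>) * W t \<partial>lborel)"
    by (rule nn_integral_cmult[symmetric]) simp
  also have "\<dots> \<le> (\<integral>\<^sup>+ t. m t * indicator {0<..<T} t \<partial>lborel)"
  proof (rule nn_integral_mono_AE)
    show "AE t in lborel. ennreal (1 / \<kappa>) * W t \<le> m t * indicator {0<..<T} t"
      using key
    proof eventually_elim
      case (elim t)
      have "W t \<le> ennreal (B * C * C * c) * (m t * indicator {0<..<T} t)"
        unfolding W_def using elim by (intro SUP_least) auto
      also have "\<dots> \<le> ennreal \<kappa> * (m t * indicator {0<..<T} t)"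
        by (intro mult_right_mono ennreal_leI) (auto simp: \<kappa>_def)
      finally have "ennreal (1 / \<kappa>) * W t \<le> ennreal (1 / \<kappa>) * (ennreal \<kappa> * (m t * indicator {0<..<T} t))"
        by (intro mult_left_mono) auto
      also have "\<dots> = m t * indicator {0<..<T} t"
        using \<kappa> by (simp add: mult.assoc[symmetric] ennreal_mult[symmetric])
      finally show ?case .
    qed
  qed
  also have "\<dots> < \<infinity>" by (rule m)
  finally have Wfin: "(\<integral>\<^sup>+ t. W t \<partial>lborel) < \<infinity>"
    using \<kappa> by (auto simp: ennreal_mult_less_top)
  have lim: "(\<lambda>n. \<integral>\<^sup>+ t. ennreal \<bar>r (n + N) t\<bar> \<partial>lborel) \<longlonglongrightarrow> (\<integral>\<^sup>+ t. 0 \<partial>(lborel :: real measure))"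
  proof (rule nn_integral_dominated_convergence[where w=W])
    show "AE t in lborel. ennreal \<bar>r (n + N) t\<bar> \<le> W t" for n
      unfolding W_def by (intro AE_I2 SUP_upper) simp
    show "AE t in lborel. (\<lambda>n. ennreal \<bar>r (n + N) t\<bar>) \<longlonglongrightarrow> 0"
      using key
    proof eventually_elim
      case (elim t)
      then have "(\<lambda>n. \<bar>r (n + N) t\<bar>) \<longlonglongrightarrow> \<bar>0\<bar>"
        by (intro tendsto_intros LIMSEQ_ignore_initial_segment) auto
      then show ?case using tendsto_ennrealI by fastforce
    qed
  qed (use Wfin in auto)
  have bound: "ennreal \<bar>\<integral>t. r n t \<partial>lborel\<bar> \<le> (\<integral>\<^sup>+ t. ennreal \<bar>r n t\<bar> \<partial>lborel)" for n
    using integral_norm_bound_ennreal[OF r_int[of n]] by simp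
  have "(\<lambda>n. ennreal \<bar>\<integral>t. r (n + N) t \<partial>lborel\<bar>) \<longlonglongrightarrow> 0"
  proof (rule tendsto_sandwich[where f="\<lambda>_. 0"])
    show "(\<lambda>n. \<integral>\<^sup>+ t. ennreal \<bar>r (n + N) t\<bar> \<partial>lborel) \<longlonglongrightarrow> 0" using lim by simp
  qed (use bound in auto)
  then have "(\<lambda>n. \<bar>\<integral>t. r (n + N) t \<partial>lborel\<bar>) \<longlonglongrightarrow> 0"
    using tendsto_ennreal_iff[of "\<lambda>n. \<bar>\<integral>t. r (n + N) t \<partial>lborel\<bar>" sequentially 0] by simp
  then have "(\<lambda>n. \<integral>t. r (n + N) t \<partial>lborel) \<longlonglongrightarrow> 0" by (rule tendsto_rabs_zero_cancel)
  then have "(\<lambda>n. \<integral>t. r n t \<partial>lborel) \<longlonglongrightarrow> 0" by (rule LIMSEQ_offset)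
  then show ?thesis unfolding Rr .
qed

text \<open>A diagonal choice couples the scales: for each \<open>n\<close> the time scale
  \<open>\<delta> n\<close> is so small that the defect is within \<open>ls n\<close> of the one
  without mollification in time. The latter tends to zero, and every other term converges because
  the mollified fields converge in mean when both scales vanish.\<close>

lemma energy_balance:
  assumes \<psi>: "test_fun (\<Omega> \<times> {0<..<T}) \<psi>"
  shows "(\<Sum>k\<in>UNIV. \<integral>z. dt \<psi> z * (U k z * U k z) \<partial>lborel) / 2
      + (\<Sum>k\<in>UNIV. \<integral>z. dx k \<psi> z * (Q z * U k z) \<partial>lborel)
      + (\<Sum>k\<in>UNIV. \<integral>z. \<psi> z * (F k z * U k z) \<partial>lborel) = 0"
proof -
  let ?R = "\<lambda>n. \<Sum>k\<in>UNIV. \<integral>z. \<psi> z * (Sx n k z * space_conv (U k) (en n) z) \<partial>lborel"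
  let ?Rd = "\<lambda>n \<delta>. \<Sum>k\<in>UNIV. \<integral>z. \<psi> z * (S n \<delta> k z * conv (U k) (K n \<delta>) z) \<partial>lborel"
  \<comment> \<open>The index is also taken at least \<open>n\<close>, which makes the selected time
    scales tend to zero.\<close>
  have "\<forall>n. \<exists>i. n \<le> i \<and> \<bar>?Rd n (ls i) - ?R n\<bar> < ls n"
  proof
    fix n
    obtain N where "\<And>i. i \<ge> N \<Longrightarrow> norm (?Rd n (ls i) - ?R n) < ls n"
      using LIMSEQ_D[OF defect_time_limit[OF \<psi> ls_pos ls0] ls_pos[of n]] by blast
    from this[of "max n N"] show "\<exists>i. n \<le> i \<and> \<bar>?Rd n (ls i) - ?R n\<bar> < ls n"
      unfolding real_norm_def by (intro exI[of _ "max n N"] conjI) simp_all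
  qed
  from choice[OF this] obtain i where ii: "\<forall>n. n \<le> i n \<and> \<bar>?Rd n (ls (i n)) - ?R n\<bar> < ls n" by (elim exE)
  note i = spec[OF ii, THEN conjunct1] spec[OF ii, THEN conjunct2]
  define \<delta> where "\<delta> n = ls (i n)" for n
  have d: "\<delta> n > 0" for n by (simp add: \<delta>_def ls_pos)
  have d0: "\<delta> \<longlonglongrightarrow> 0"
  proof -
    have "filterlim i at_top sequentially"
      by (rule filterlim_at_top_mono[OF filterlim_ident]) (use i(1) in auto)
    from filterlim_compose[OF ls0 this] show ?thesis by (simp add: \<delta>_def[abs_def])
  qed
  have Rd0: "(\<lambda>n. ?Rd n (\<delta> n)) \<longlonglongrightarrow> 0"
  proof -
    have "(\<lambda>n. ?Rd n (\<delta> n) - ?R n) \<longlonglongrightarrow> 0"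
      unfolding \<delta>_def by (rule Lim_null_comparison[OF always_eventually ls0]) (intro allI, unfold real_norm_def, rule less_imp_le[OF i(2)])
    from tendsto_add[OF this defect_vanishes[OF \<psi>]] show ?thesis by simp
  qed
  have "open (\<Omega> \<times> {0<..<T})" using \<Omega> by (intro open_Times) auto
  then obtain e where e: "e > 0" "\<And>z. \<psi> z \<noteq> 0 \<Longrightarrow> cball z e \<subseteq> \<Omega> \<times> {0<..<T}" using test_fun_margin[OF \<psi>] by blast
  let ?L = "\<lambda>n. (\<Sum>k\<in>UNIV. \<integral>z. dt \<psi> z * (conv (U k) (K n (\<delta> n)) z * conv (U k) (K n (\<delta> n)) z) \<partial>lborel) / 2
      + (\<Sum>k\<in>UNIV. \<integral>z. dx k \<psi> z * (conv Q (K n (\<delta> n)) z * conv (U k) (K n (\<delta> n)) z) \<partial>lborel)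
      + (\<Sum>k\<in>UNIV. \<integral>z. \<psi> z * (conv (F k) (K n (\<delta> n)) z * conv (U k) (K n (\<delta> n)) z) \<partial>lborel)"
  have ev: "\<forall>\<^sub>F n in sequentially. ?Rd n (\<delta> n) = ?L n"
  proof -
    have "\<forall>\<^sub>F n in sequentially. ls n < e" "\<forall>\<^sub>F n in sequentially. \<delta> n < e"
      using order_tendstoD(2)[OF ls0 e(1)] order_tendstoD(2)[OF d0 e(1)] .
    then show ?thesis
      by eventually_elim (rule mollified_energy[OF \<psi> e(2) d, symmetric]; simp)
  qed
  have L0: "?L \<longlonglongrightarrow> 0" by (rule Lim_transform_eventually[OF Rd0 ev])
  have pr: "(\<lambda>n. \<integral>z. f z * (conv g (K n (\<delta> n)) z * conv (U k) (K n (\<delta> n)) z) \<partial>lborel) \<longlonglongrightarrow> (\<integral>z. f z * (g z * U k z) \<partial>lborel)"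
    if f: "bounded_borel f" and g: "integrable lborel g" for f g k
  proof -
    obtain B where B: "\<And>z. \<bar>f z\<bar> \<le> B" and fm: "f \<in> borel_measurable lborel" using f by (auto simp: bounded_borel_def)
    show ?thesis
      by (rule L1_tendsto_integral_mult[OF K_L1_tendsto[OF g d d0] K_L1_tendsto[OF U_int d d0] K_bd[OF d] U_bd fm B])
  qed
  have b: "bounded_borel \<psi>" "bounded_borel (dt \<psi>)" "bounded_borel (dx k \<psi>)" for k
    unfolding dt_def dx_def by (rule test_fun_facts[OF \<psi>] basis_mem)+
  have "?L \<longlonglongrightarrow> (\<Sum>k\<in>UNIV. \<integral>z. dt \<psi> z * (U k z * U k z) \<partial>lborel) / 2
      + (\<Sum>k\<in>UNIV. \<integral>z. dx k \<psi> z * (Q z * U k z) \<partial>lborel)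
      + (\<Sum>k\<in>UNIV. \<integral>z. \<psi> z * (F k z * U k z) \<partial>lborel)"
    by (intro tendsto_intros pr b U_int Q_int F_int) simp
  then show ?thesis using L0 LIMSEQ_unique by blast
qed

end

section \<open>Borel representatives and slices\<close>

text \<open>The given fields are Lebesgue measurable and enter integrals against Lebesgue measure.
  Exchanging them for Borel functions that agree almost everywhere opens the way to Fubini and
  convolution.\<close>

lemma integral_lebesgue_AE_eq:
  fixes f g :: "'a::euclidean_space \<Rightarrow> real"
  assumes g: "g \<in> borel_measurable borel" and ae: "AE z in lborel. f z = g z"
  shows "(\<integral>z. f z \<partial>lebesgue) = (\<integral>z. g z \<partial>lborel)"
proof -
  have gl: "g \<in> borel_measurable lebesgue" using g by (simp add: measurable_completion)
  have ael: "AE z in lebesgue. f z = g z" using ae by (rule AE_completion)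
  have "AE z in lebesgue. g z = f z" using ael by eventually_elim simp
  then have fl: "f \<in> borel_measurable lebesgue" by (rule borel_measurable_AE[OF gl])
  have "(\<integral>z. f z \<partial>lebesgue) = (\<integral>z. g z \<partial>lebesgue)" by (rule integral_cong_AE[OF fl gl ael])
  also have "\<dots> = (\<integral>z. g z \<partial>lborel)" by (rule integral_completion) (use g in simp)
  finally show ?thesis .
qed

text \<open>The closed support lies in \<open>W\<close>, so a point outside \<open>W\<close> has a
  whole neighbourhood on which the function is zero; the derivatives vanish with it.\<close>

lemma test_fun_zero_off:
  fixes \<phi> :: "'a::euclidean_space \<Rightarrow> real"
  assumes "test_fun W \<phi>" "z \<notin> W"
  shows "\<phi> z = 0" "dderiv v \<phi> z = 0"
proof -
  let ?c = "closure {x. \<phi> x \<noteq> 0}"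
  have z: "z \<in> - ?c" using assms by (auto simp: test_fun_def)
  have off: "\<phi> y = 0" if "y \<in> - ?c" for y using that closure_subset[of "{x. \<phi> x \<noteq> 0}"] by blast
  show "\<phi> z = 0" by (rule off[OF z])
  have "((\<lambda>z. 0) has_derivative (\<lambda>v. 0)) (at z)" by simp
  then have "(\<phi> has_derivative (\<lambda>v. 0)) (at z)"
    by (rule has_derivative_transform_within_open[OF _ open_Compl[OF closed_closure] z]) (rule off[symmetric])
  then show "dderiv v \<phi> z = 0" by (rule dderiv_eqI)
qed

lemma test_fun_mono: "test_fun W \<phi> \<Longrightarrow> W \<subseteq> W' \<Longrightarrow> test_fun W' \<phi>"
  by (auto simp: test_fun_def)

text \<open>Dilations and translations preserve null sets, so a change of representative survives
  the rescaling in a blow up.\<close>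

lemma AE_lborel_affine:
  fixes t :: "'a::euclidean_space" and c :: real
  assumes c: "c \<noteq> 0" and ae: "AE x in lborel. Q x"
  shows "AE x in lborel. Q (t + c *\<^sub>R x)"
proof -
  obtain N where N: "N \<in> null_sets (lborel :: 'a measure)" "{x. \<not> Q x} \<subseteq> N"
    using ae by (auto simp: eventually_ae_filter)
  have [measurable]: "N \<in> sets borel" using null_setsD2[OF N(1)] by simp
  have "(\<integral>\<^sup>+x. indicator N x \<partial>lborel) = ennreal (\<bar>c\<bar> ^ DIM('a)) * (\<integral>\<^sup>+x. indicator N (t + c *\<^sub>R x) \<partial>lborel)"
    by (rule nn_integral_lborel_affine[OF c]) simp
  then have "(\<integral>\<^sup>+x. indicator N (t + c *\<^sub>R x) \<partial>lborel) = 0"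
    using N(1) c by (auto simp: null_setsD1)
  then have "AE x in lborel. indicator N (t + c *\<^sub>R x) = (0::ennreal)"
    by (subst (asm) nn_integral_0_iff_AE) auto
  then show ?thesis by eventually_elim (use N(2) in \<open>auto simp: indicator_eq_0_iff\<close>)
qed

text \<open>The blow up concerns the given vector field, the mollification a bounded Borel
  representative of one component. At scales below the distance to the boundary the rescaled unit
  ball lies in \<open>\<Omega>\<close>, where the two agree almost everywhere, and a component never
  exceeds the norm.\<close>

lemma blowup_component_convergent:
  fixes w :: "real^'d::finite \<Rightarrow> real^'d" and W :: "real^'d \<Rightarrow> real"
  assumes bu: "admits_blowup w y" and y: "y \<in> \<Omega>" "open \<Omega>"
    and W[measurable]: "W \<in> borel_measurable borel" and C: "\<And>x. \<bar>W x\<bar> \<le> C"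
    and ae: "AE x in lborel. x \<in> \<Omega> \<longrightarrow> W x = w x $ j"
    and ls: "ls \<longlonglongrightarrow> 0" "\<And>n. ls n > (0::real)"
  shows "convergent (\<lambda>n. conv (conv W (eta (ls n))) (eta (ls n)) y)"
proof -
  obtain v where v: "set_integrable lborel (ball 0 1) v"
    and lim: "((\<lambda>l. \<integral>\<^sup>+ z \<in> ball 0 1. ennreal (norm (w (y + l *\<^sub>R z) - v z)) \<partial>lborel) \<longlongrightarrow> 0) (at_right 0)"
    using bu unfolding admits_blowup_def by blast
  have v1: "set_integrable lborel (ball 0 1) (\<lambda>z. v z $ j)"
    using integrable_bounded_linear[OF bounded_linear_vec_nth v[unfolded set_integrable_def], of j]
    by (simp add: set_integrable_def)
  obtain d where d: "d > 0" "ball y d \<subseteq> \<Omega>" using y open_contains_ball by blast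
  have le: "(\<integral>\<^sup>+ z \<in> ball 0 1. ennreal \<bar>W (y + l *\<^sub>R z) - v z $ j\<bar> \<partial>lborel)
     \<le> (\<integral>\<^sup>+ z \<in> ball 0 1. ennreal (norm (w (y + l *\<^sub>R z) - v z)) \<partial>lborel)" if l: "0 < l" "l < d" for l
  proof (rule nn_integral_mono_AE)
    have "AE z in lborel. y + l *\<^sub>R z \<in> \<Omega> \<longrightarrow> W (y + l *\<^sub>R z) = w (y + l *\<^sub>R z) $ j"
      using AE_lborel_affine[OF _ ae, of l y] l by simp
    then show "AE z in lborel. ennreal \<bar>W (y + l *\<^sub>R z) - v z $ j\<bar> * indicator (ball 0 1) z
       \<le> ennreal (norm (w (y + l *\<^sub>R z) - v z)) * indicator (ball 0 1) z"
    proof eventually_elim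
      case (elim z)
      show ?case
      proof (cases "z \<in> ball 0 1")
        case True
        then have "l * norm z < d" using l mult_strict_mono[of l d "norm z" 1] by simp
        then have "y + l *\<^sub>R z \<in> \<Omega>" using d(2) l by (intro subsetD[OF d(2)]) (simp add: dist_norm)
        then have "W (y + l *\<^sub>R z) - v z $ j = (w (y + l *\<^sub>R z) - v z) $ j" using elim by simp
        then have "\<bar>W (y + l *\<^sub>R z) - v z $ j\<bar> \<le> norm (w (y + l *\<^sub>R z) - v z)"
          using component_le_norm_cart by metis
        then show ?thesis by (intro mult_right_mono ennreal_leI) auto
      qed simp
    qed
  qed
  have "((\<lambda>l. \<integral>\<^sup>+ z \<in> ball 0 1. ennreal \<bar>W (y + l *\<^sub>R z) - v z $ j\<bar> \<partial>lborel) \<longlongrightarrow> 0) (at_right 0)"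
  proof (rule tendsto_sandwich[OF _ _ tendsto_const lim])
    show "\<forall>\<^sub>F l in at_right 0. (\<integral>\<^sup>+ z \<in> ball 0 1. ennreal \<bar>W (y + l *\<^sub>R z) - v z $ j\<bar> \<partial>lborel)
     \<le> (\<integral>\<^sup>+ z \<in> ball 0 1. ennreal (norm (w (y + l *\<^sub>R z) - v z)) \<partial>lborel)"
      unfolding eventually_at_right_field using d(1) le by auto
  qed simp
  from blowup_imp_convergent[OF W C v1 this ls] show ?thesis .
qed

text \<open>The density \<open>G\<close> represents the antisymmetric gradient as a distribution and
  may fail to be antisymmetric at individual points. Half its difference with the transpose
  represents the same distribution and is antisymmetric everywhere. The constant
  \<open>real CARD('d) * real CARD('d)\<close> counts the entries, each bounded by the norm of
  \<open>G\<close>.\<close>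

lemma vorticity_slice_intro:
  fixes u :: "real^'d::finite \<Rightarrow> real^'d" and w :: "'d \<Rightarrow> real^'d \<Rightarrow> real"
  assumes ls: "ls \<longlonglongrightarrow> 0" "\<And>n. ls n > (0::real)"
    and \<Omega>: "open \<Omega>" "open \<Omega>'" "\<Omega>' \<subseteq> \<Omega>"
    and w[measurable]: "\<And>j. w j \<in> borel_measurable borel" and C: "\<And>j x. \<bar>w j x\<bar> \<le> C"
    and ae: "AE x in lborel. x \<in> \<Omega>' \<longrightarrow> (\<forall>j. w j x = u x $ j)"
    and radon: "matrix_radon \<Omega> \<mu> G" and gr: "is_antisym_grad \<Omega> u \<mu> G"
    and negl: "tv_negligible \<mu> G (no_blowup_set \<Omega> u)"
  shows "vorticity_slice ls \<Omega>' C w (ennreal (real CARD('d) * real CARD('d)) * tv_measure \<mu> G UNIV)"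
proof -
  have \<mu>: "sets \<mu> = sets borel" "finite_measure \<mu>" and G: "integrable \<mu> G"
    using radon by (auto simp: matrix_radon_def)
  interpret finite_measure \<mu> by fact
  note [measurable_cong] = \<mu>(1)
  have [measurable]: "\<Omega>' \<in> sets borel" using \<Omega> by auto
  have [measurable]: "G \<in> borel_measurable \<mu>" using G by auto
  have Gij: "integrable \<mu> (\<lambda>y. G y $ i $ j)" for i j
    using integrable_bounded_linear[OF bounded_linear_vec_nth[of j] integrable_bounded_linear[OF bounded_linear_vec_nth[of i] G]] .
  \<comment> \<open>Only test functions supported in \<open>\<Omega>'\<close> matter, and \<open>w\<close> represents \<open>u\<close> only there.\<close>
  define H where "H i j y = indicator \<Omega>' y * ((G y $ i $ j - G y $ j $ i) / 2)" for i j y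
  \<comment> \<open>\<open>lim\<close> is unspecified off the set of convergence; the clipping keeps \<open>V\<close> bounded there.\<close>
  define V where "V j y = max (- C) (min C (lim (\<lambda>n. conv (conv (w j) (eta (ls n))) (eta (ls n)) y)))" for j y
  have C0: "C \<ge> 0" using C[of undefined undefined] by linarith
  note [measurable] = eta_measurable[OF ls(2), where 'a="real^'d"]
  have Hint: "integrable \<mu> (H i j)" for i j
    unfolding H_def using Gij by (intro integrable_mult_bounded(2)[where C=1]) (auto simp: indicator_def)
  have Hb: "\<bar>H i j y\<bar> \<le> norm (G y)" for i j y
  proof -
    have c: "\<bar>G y $ i $ j\<bar> \<le> norm (G y)" for i j
      by (rule order_trans[OF component_le_norm_cart Finite_Cartesian_Product.norm_nth_le])
    show ?thesis using c[of i j] c[of j i] by (auto simp: H_def indicator_def)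
  qed
  have Vm: "V j \<in> borel_measurable borel" for j unfolding V_def by measurable
  have Vb: "\<bar>V j y\<bar> \<le> C" for j y using C0 by (auto simp: V_def)
  have grad: "(\<integral>x. \<phi> x * H i j x \<partial>\<mu>) = - (\<integral>x. w i x * dsp j \<phi> x - w j x * dsp i \<phi> x \<partial>lborel)"
    if \<phi>: "test_fun \<Omega>' \<phi>" for \<phi> i j
  proof -
    have \<phi>\<Omega>: "test_fun \<Omega> \<phi>" by (rule test_fun_mono[OF \<phi> \<Omega>(3)])
    obtain B where B: "\<And>z. \<bar>\<phi> z\<bar> \<le> B" and \<phi>m[measurable]: "\<phi> \<in> borel_measurable borel"
      using test_fun_facts(2)[OF \<phi> axis_in_Basis] by (auto simp: bounded_borel_def)
    have [measurable]: "dsp j \<phi> \<in> borel_measurable borel" for j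
      using test_fun_facts(4)[OF \<phi> axis_in_Basis] by (auto simp: bounded_borel_def dsp_def)
    have i: "integrable \<mu> (\<lambda>x. \<phi> x * G x $ i $ j)" for i j
      by (rule integrable_mult_bounded(2)[OF Gij _ B]) measurable
    have I: "(\<integral>x. \<phi> x * G x $ i $ j \<partial>\<mu>) = - (\<integral>x. w i x * dsp j \<phi> x - w j x * dsp i \<phi> x \<partial>lborel)" for i j
    proof -
      have "(\<integral>x \<in> \<Omega>. u x $ i * dsp j \<phi> x - u x $ j * dsp i \<phi> x \<partial>lebesgue) = (\<integral>x. w i x * dsp j \<phi> x - w j x * dsp i \<phi> x \<partial>lborel)"
        unfolding set_lebesgue_integral_def
      proof (rule integral_lebesgue_AE_eq)
        show "AE x in lborel. indicator \<Omega> x *\<^sub>R (u x $ i * dsp j \<phi> x - u x $ j * dsp i \<phi> x) = w i x * dsp j \<phi> x - w j x * dsp i \<phi> x"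
          using ae
        proof eventually_elim
          case (elim x)
          show ?case
          proof (cases "x \<in> \<Omega>'")
            case True
            then show ?thesis using elim \<Omega>(3) by auto
          next
            case False
            then show ?thesis using test_fun_zero_off(2)[OF \<phi> False] by (simp add: dsp_def)
          qed
        qed
      qed measurable
      then show ?thesis using gr \<phi>\<Omega> by (simp add: is_antisym_grad_def)
    qed
    \<comment> \<open>Exchanging the indices changes the sign of the distributional side, so the two
      halves of \<open>H\<close> add up to the full gradient.\<close>
    have "(\<integral>x. w j x * dsp i \<phi> x - w i x * dsp j \<phi> x \<partial>lborel) = (\<integral>x. - (w i x * dsp j \<phi> x - w j x * dsp i \<phi> x) \<partial>lborel)"
      by (simp only: minus_diff_eq)
    then have anti: "(\<integral>x. w j x * dsp i \<phi> x - w i x * dsp j \<phi> x \<partial>lborel) = - (\<integral>x. w i x * dsp j \<phi> x - w j x * dsp i \<phi> x \<partial>lborel)"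
      by (simp only: Bochner_Integration.integral_minus)
    have "(\<integral>x. \<phi> x * H i j x \<partial>\<mu>) = (\<integral>x. (\<phi> x * G x $ i $ j - \<phi> x * G x $ j $ i) / 2 \<partial>\<mu>)"
    proof (rule Bochner_Integration.integral_cong[OF refl])
      fix x show "\<phi> x * H i j x = (\<phi> x * G x $ i $ j - \<phi> x * G x $ j $ i) / 2"
        using test_fun_zero_off(1)[OF \<phi>, of x] by (cases "x \<in> \<Omega>'") (auto simp: H_def algebra_simps)
    qed
    also have "\<dots> = ((\<integral>x. \<phi> x * G x $ i $ j \<partial>\<mu>) - (\<integral>x. \<phi> x * G x $ j $ i \<partial>\<mu>)) / 2"
      using i by simp
    finally show ?thesis unfolding I anti by simp
  qed
  have conv: "AE y in \<mu>. (\<forall>i j. H i j y = 0) \<or> (\<forall>j. (\<lambda>n. conv (conv (w j) (eta (ls n))) (eta (ls n)) y) \<longlonglongrightarrow> V j y)"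
  proof -
    obtain B where Bs[measurable]: "B \<in> sets borel" and B: "no_blowup_set \<Omega> u \<subseteq> B" "tv_measure \<mu> G B = 0"
      using negl unfolding tv_negligible_def by blast
    \<comment> \<open>The set \<open>B\<close> has zero total variation, so almost every point
      either lies outside \<open>B\<close> or is a zero of \<open>G\<close>.\<close>
    have "AE y in \<mu>. ennreal (norm (G y)) * indicator B y = 0"
      using B(2) unfolding tv_measure_def by (subst (asm) nn_integral_0_iff_AE) auto
    then show ?thesis
    proof eventually_elim
      case (elim y)
      show ?case
      proof (cases "y \<in> \<Omega>' \<and> G y \<noteq> 0")
        case False
        then show ?thesis by (auto simp: H_def)
      next
        case True
        then have "y \<notin> B" using elim by (auto simp: indicator_def split: if_splits)
        then have bu: "admits_blowup u y" using B(1) True \<Omega>(3) by (auto simp: no_blowup_set_def)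
        have "(\<lambda>n. conv (conv (w j) (eta (ls n))) (eta (ls n)) y) \<longlonglongrightarrow> V j y" for j
        proof -
          let ?s = "\<lambda>n. conv (conv (w j) (eta (ls n))) (eta (ls n)) y"
          have "convergent ?s"
            by (rule blowup_component_convergent[OF bu conjunct1[OF True] \<Omega>(2) w C _ ls]) (use ae in \<open>auto elim: eventually_mono\<close>)
          then have l: "?s \<longlonglongrightarrow> lim ?s" by (simp add: convergent_LIMSEQ_iff)
          have "\<bar>?s n\<bar> \<le> C" for n
            by (rule conv_bound_sup[OF conv_measurable[OF w eta_measurable[OF ls(2)]] conv_bound_sup[OF w C] eta_nonneg[OF ls(2)] eta_integrable[OF ls(2)] eta_integral[OF ls(2)]])
               (rule eta_nonneg[OF ls(2)] eta_integrable[OF ls(2)] eta_integral[OF ls(2)])+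
          then have b: "?s n \<le> C" "- C \<le> ?s n" for n by (simp_all add: abs_le_iff minus_le_iff)
          \<comment> \<open>The limit lies between \<open>- C\<close> and \<open>C\<close>, so at
            such a point the clipping in \<open>V\<close> has no effect.\<close>
          have "lim ?s \<le> C" "- C \<le> lim ?s"
            using LIMSEQ_le_const2[OF l, of C] LIMSEQ_le_const[OF l, of "- C"] b by auto
          then show ?thesis using l by (simp add: V_def max_def min_def)
        qed
        then show ?thesis by blast
      qed
    qed
  qed
  have "(\<Sum>k\<in>UNIV. \<Sum>j\<in>UNIV. \<integral>y. \<bar>H k j y\<bar> \<partial>\<mu>) \<le> (\<Sum>k\<in>(UNIV::'d set). \<Sum>j\<in>(UNIV::'d set). \<integral>y. norm (G y) \<partial>\<mu>)"
    using Hint G Hb by (intro sum_mono integral_mono) auto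
  also have "\<dots> = real CARD('d) * real CARD('d) * (\<integral>y. norm (G y) \<partial>\<mu>)" by simp
  finally have "ennreal (\<Sum>k\<in>UNIV. \<Sum>j\<in>UNIV. \<integral>y. \<bar>H k j y\<bar> \<partial>\<mu>) \<le> ennreal (real CARD('d) * real CARD('d) * (\<integral>y. norm (G y) \<partial>\<mu>))"
    by (rule ennreal_leI)
  also have "\<dots> = ennreal (real CARD('d) * real CARD('d)) * ennreal (\<integral>y. norm (G y) \<partial>\<mu>)"
    by (rule ennreal_mult) auto
  also have "ennreal (\<integral>y. norm (G y) \<partial>\<mu>) = tv_measure \<mu> G UNIV"
    unfolding tv_measure_def using nn_integral_eq_integral[of \<mu> "\<lambda>y. norm (G y)"] G by simp
  finally have tv: "ennreal (\<Sum>k\<in>UNIV. \<Sum>j\<in>UNIV. \<integral>y. \<bar>H k j y\<bar> \<partial>\<mu>) \<le> ennreal (real CARD('d) * real CARD('d)) * tv_measure \<mu> G UNIV" .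
  have anti: "H i j y + H j i y = 0" for i j y by (simp add: H_def field_simps)
  show ?thesis unfolding vorticity_slice_def
    by (intro exI[of _ \<mu>] exI[of _ H] exI[of _ V] conjI allI impI \<mu> Hint anti Vm Vb grad conv tv)
qed

lemma lebesgue_borel_representative:
  fixes g :: "'a::euclidean_space \<Rightarrow> real"
  assumes "set_borel_measurable lebesgue A g"
  obtains g' where "g' \<in> borel_measurable borel" "AE z in lborel. z \<in> A \<longrightarrow> g z = g' z"
proof -
  obtain g' where g': "g' \<in> borel_measurable lborel" "AE z in lborel. indicator A z *\<^sub>R g z = g' z"
    using completion_ex_borel_measurable_real[of "\<lambda>z. indicator A z *\<^sub>R g z" lborel] assms
    unfolding set_borel_measurable_def by blast
  have "AE z in lborel. z \<in> A \<longrightarrow> g z = g' z" using g'(2) by eventually_elim auto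
  then show ?thesis using that g'(1) by simp
qed

lemma lebesgue_L1_representative:
  fixes g :: "'a::euclidean_space \<Rightarrow> real"
  assumes g: "set_integrable lebesgue A g" and A: "B \<subseteq> A" "B \<in> sets borel"
  obtains g' where "integrable lborel g'" "AE z in lborel. z \<in> B \<longrightarrow> g z = g' z"
proof -
  let ?g = "\<lambda>z. indicator A z *\<^sub>R g z"
  have gi: "integrable lebesgue ?g" using g by (simp add: set_integrable_def)
  obtain h where h: "h \<in> borel_measurable lborel" "AE z in lborel. ?g z = h z"
    using completion_ex_borel_measurable_real[of ?g lborel] borel_measurable_integrable[OF gi] by blast
  have hl: "h \<in> borel_measurable lebesgue" using h(1) by (rule measurable_completion)
  have "integrable lebesgue h"
    using integrable_cong_AE_imp[OF gi hl] AE_completion[OF h(2)] by blast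
  then have hi: "integrable lborel h" using integrable_completion[OF h(1)] by blast
  show ?thesis
  proof (rule that[of "\<lambda>z. indicator B z * h z"])
    show "integrable lborel (\<lambda>z. indicator B z * h z)"
      by (rule integrable_mult_bounded(2)[OF hi, where C=1]) (use A(2) in \<open>auto simp: indicator_def\<close>)
    show "AE z in lborel. z \<in> B \<longrightarrow> g z = indicator B z * h z"
      using h(2) by eventually_elim (use A(1) in auto)
  qed
qed

theorem theorem4p5:
  fixes \<Omega> :: "(real^('d::finite)) set" and T :: real
    and u :: "(real^'d) \<Rightarrow> real \<Rightarrow> (real^'d)"
    and p :: "(real^'d) \<Rightarrow> real \<Rightarrow> real"
    and f :: "(real^'d) \<Rightarrow> real \<Rightarrow> (real^'d)"
    and \<mu> :: "real \<Rightarrow> (real^'d) measure"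
    and G :: "real \<Rightarrow> (real^'d) \<Rightarrow> real^'d^'d"
  assumes "open \<Omega>" and "T > 0"
    and u_meas: "set_borel_measurable lebesgue (\<Omega> \<times> {0<..<T}) (\<lambda>(x, t). u x t)"
    and u_bdd: "\<exists>C. AE z in lebesgue. z \<in> \<Omega> \<times> {0<..<T} \<longrightarrow> norm ((\<lambda>(x, t). u x t) z) \<le> C"
    and p_L1: "set_integrable lebesgue (\<Omega> \<times> {0<..<T}) (\<lambda>(x, t). p x t)"
    and f_L1: "set_integrable lebesgue (\<Omega> \<times> {0<..<T}) (\<lambda>(x, t). f x t)"
    and euler: "weak_euler \<Omega> T u p f"
    and Lam_radon: "\<And>t. t \<in> {0<..<T} \<Longrightarrow> matrix_radon \<Omega> (\<mu> t) (G t)"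
    and Lam_weak_meas: "\<And>\<phi> i j. cont_cs_fun \<Omega> \<phi> \<Longrightarrow>
          set_borel_measurable lebesgue {0<..<T} (\<lambda>t. \<integral>x. \<phi> x * G t x $ i $ j \<partial>(\<mu> t))"
    and Lam_L1: "(\<integral>\<^sup>+ t \<in> {0<..<T}. tv_measure (\<mu> t) (G t) UNIV \<partial>lborel) < \<infinity>"
    and Lam_grad: "AE t in lborel. t \<in> {0<..<T} \<longrightarrow> is_antisym_grad \<Omega> (\<lambda>x. u x t) (\<mu> t) (G t)"
    and negl: "AE t in lborel. t \<in> {0<..<T} \<longrightarrow>
                 tv_negligible (\<mu> t) (G t) (no_blowup_set \<Omega> (\<lambda>x. u x t))"
  shows "energy_equality \<Omega> T u p f"
  unfolding energy_equality_def
proof (intro allI impI)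
  fix \<psi> :: "(real^'d) \<times> real \<Rightarrow> real"
  assume t\<psi>: "test_fun (\<Omega> \<times> {0<..<T}) \<psi>"
  obtain R where R: "\<And>z. norm z > R \<Longrightarrow> \<psi> z = 0" using test_fun_bounded_support[OF t\<psi>] by blast
  \<comment> \<open>The cut is bounded, so that the bounded velocity becomes integrable on it. The
    added 1 keeps the closed ball of radius \<open>R\<close>, which contains the support, inside the
    open ball.\<close>
  define \<Omega>' where "\<Omega>' = \<Omega> \<inter> ball 0 (R + 1)"
  let ?D = "\<Omega> \<times> {0<..<T}" and ?D' = "\<Omega>' \<times> {0<..<T}"
  have \<Omega>': "open \<Omega>'" "\<Omega>' \<subseteq> \<Omega>" using \<open>open \<Omega>\<close> by (auto simp: \<Omega>'_def)
  have DD: "?D' \<subseteq> ?D" using \<Omega>'(2) by auto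
  have D'o: "open ?D'" using \<Omega>' by (intro open_Times) auto
  then have D'm[measurable]: "?D' \<in> sets borel" by auto
  have t\<psi>': "test_fun ?D' \<psi>"
  proof -
    have "closure {z. \<psi> z \<noteq> 0} \<subseteq> cball 0 R" using R by (intro closure_minimal) force+
    moreover have "closure {z. \<psi> z \<noteq> 0} \<subseteq> ?D" using t\<psi> by (simp add: test_fun_def)
    ultimately have "closure {z. \<psi> z \<noteq> 0} \<subseteq> ?D'"
    proof (intro subsetI)
      fix z assume *: "z \<in> closure {z. \<psi> z \<noteq> 0}" "closure {z. \<psi> z \<noteq> 0} \<subseteq> cball 0 R" "closure {z. \<psi> z \<noteq> 0} \<subseteq> ?D"
      have "norm z \<le> R" "z \<in> ?D" using * by auto
      moreover obtain x s where z: "z = (x, s)" by fastforce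
      ultimately show "z \<in> ?D'" using norm_fst_le[of x s] by (auto simp: \<Omega>'_def)
    qed
    then show ?thesis using t\<psi> by (simp add: test_fun_def)
  qed
  obtain C0 where C0: "AE z in lebesgue. z \<in> ?D \<longrightarrow> norm ((\<lambda>(x, t). u x t) z) \<le> C0" using u_bdd by blast
  \<comment> \<open>A non-negative bound, so that the interval from \<open>- C\<close> to
    \<open>C\<close> used for clipping is not empty.\<close>
  define C where "C = max 0 C0"
  have "\<forall>k. \<exists>g. g \<in> borel_measurable borel \<and> (AE z in lborel. z \<in> ?D \<longrightarrow> u (fst z) (snd z) $ k = g z)"
  proof
    fix k
    have "(\<lambda>z. (indicator ?D z *\<^sub>R (\<lambda>(x, t). u x t) z) $ k) \<in> borel_measurable lebesgue"
      using u_meas unfolding set_borel_measurable_def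
      by (rule measurable_compose) (intro borel_measurable_continuous_onI continuous_intros)
    then have "set_borel_measurable lebesgue ?D (\<lambda>z. u (fst z) (snd z) $ k)"
      by (simp add: set_borel_measurable_def case_prod_beta)
    then obtain g where "g \<in> borel_measurable borel" "AE z in lborel. z \<in> ?D \<longrightarrow> u (fst z) (snd z) $ k = g z"
      by (rule lebesgue_borel_representative)
    then show "\<exists>g. g \<in> borel_measurable borel \<and> (AE z in lborel. z \<in> ?D \<longrightarrow> u (fst z) (snd z) $ k = g z)"
      by (intro exI[of _ g] conjI)
  qed
  from choice[OF this] obtain u' where "\<forall>k. u' k \<in> borel_measurable borel \<and> (AE z in lborel. z \<in> ?D \<longrightarrow> u (fst z) (snd z) $ k = u' k z)"
    by (elim exE)
  then have u': "u' k \<in> borel_measurable borel" "AE z in lborel. z \<in> ?D \<longrightarrow> u (fst z) (snd z) $ k = u' k z" for k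
    by simp_all
  note [measurable] = u'(1)
  \<comment> \<open>Clipping makes the bound hold at every point instead of almost everywhere, and
    the indicator makes the function integrable; on the cut domain both leave it almost everywhere
    equal to the velocity.\<close>
  define U where "U k z = indicator ?D' z * max (- C) (min C (u' k z))" for k z
  have U_bd: "\<bar>U k z\<bar> \<le> C" for k z by (auto simp: U_def indicator_def C_def)
  have U_meas[measurable]: "U k \<in> borel_measurable borel" for k unfolding U_def by measurable
  have U_int: "integrable lborel (U k)" for k
    unfolding U_def
  proof (rule integrable_mult_bounded(1)[where C=C])
    have "bounded ?D'" unfolding \<Omega>'_def by (intro bounded_Times bounded_Int) auto
    then have "emeasure lborel ?D' < \<infinity>" by (rule emeasure_bounded_finite)
    then show "integrable lborel (indicator ?D' :: _ \<Rightarrow> real)" by (intro integrable_real_indicator) auto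
  qed (auto simp: C_def)
  have U_ae: "AE z in lborel. z \<in> ?D' \<longrightarrow> (\<forall>k. U k z = u (fst z) (snd z) $ k)"
  proof -
    have "AE z in lborel. \<forall>k. z \<in> ?D \<longrightarrow> u (fst z) (snd z) $ k = u' k z"
      unfolding AE_all_countable using u'(2) by blast
    moreover have "AE z in lborel. z \<in> ?D \<longrightarrow> norm ((\<lambda>(x, t). u x t) z) \<le> C0"
      using C0 by (simp only: AE_completion_iff)
    ultimately show ?thesis
    proof eventually_elim
      case (elim z)
      show ?case
      proof (intro impI allI)
        fix k assume z: "z \<in> ?D'"
        then have "\<bar>u (fst z) (snd z) $ k\<bar> \<le> C"
          using elim DD order_trans[OF component_le_norm_cart[of "u (fst z) (snd z)" k], of C]
          by (auto simp: C_def case_prod_beta le_max_iff_disj)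
        then show "U k z = u (fst z) (snd z) $ k" using elim z DD by (auto simp: U_def)
      qed
    qed
  qed
  obtain P where P: "integrable lborel P" "AE z in lborel. z \<in> ?D' \<longrightarrow> (\<lambda>(x, t). p x t) z = P z"
    by (rule lebesgue_L1_representative[OF p_L1 DD D'm])
  have "\<forall>k. \<exists>g. integrable lborel g \<and> (AE z in lborel. z \<in> ?D' \<longrightarrow> f (fst z) (snd z) $ k = g z)"
  proof
    fix k
    have "integrable lebesgue (\<lambda>z. (indicator ?D z *\<^sub>R (\<lambda>(x, t). f x t) z) $ k)"
      using integrable_bounded_linear[OF bounded_linear_vec_nth[of k] f_L1[unfolded set_integrable_def]] .
    then have "set_integrable lebesgue ?D (\<lambda>z. f (fst z) (snd z) $ k)"
      by (simp add: set_integrable_def case_prod_beta)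
    then obtain g where "integrable lborel g" "AE z in lborel. z \<in> ?D' \<longrightarrow> f (fst z) (snd z) $ k = g z"
      by (rule lebesgue_L1_representative[OF _ DD D'm])
    then show "\<exists>g. integrable lborel g \<and> (AE z in lborel. z \<in> ?D' \<longrightarrow> f (fst z) (snd z) $ k = g z)"
      by (intro exI[of _ g] conjI)
  qed
  from choice[OF this] obtain F where "\<forall>k. integrable lborel (F k) \<and> (AE z in lborel. z \<in> ?D' \<longrightarrow> f (fst z) (snd z) $ k = F k z)"
    by (elim exE)
  then have F: "integrable lborel (F k)" "AE z in lborel. z \<in> ?D' \<longrightarrow> f (fst z) (snd z) $ k = F k z" for k
    by simp_all
  have ae: "AE z in lborel. z \<in> ?D' \<longrightarrow> (\<forall>k. u (fst z) (snd z) $ k = U k z) \<and> p (fst z) (snd z) = P z \<and> (\<forall>k. f (fst z) (snd z) $ k = F k z)"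
  proof -
    have "AE z in lborel. \<forall>k. z \<in> ?D' \<longrightarrow> f (fst z) (snd z) $ k = F k z"
      unfolding AE_all_countable using F(2) by blast
    with U_ae P(2) show ?thesis by eventually_elim (auto simp: case_prod_beta)
  qed
  have [measurable]: "P \<in> borel_measurable borel" "F k \<in> borel_measurable borel" for k using P(1) F(1)[of k] by auto
  have tm: "dt \<xi> \<in> borel_measurable borel" "dx j \<xi> \<in> borel_measurable borel" "\<xi> \<in> borel_measurable borel"
    if "test_fun ?D' \<xi>" for \<xi> j
  proof -
    have "((0::real^'d), (1::real)) \<in> Basis" "(axis j (1::real), (0::real)) \<in> Basis"
      using axis_in_Basis[of j] by (auto simp: Basis_prod_def)
    then show "dt \<xi> \<in> borel_measurable borel" "dx j \<xi> \<in> borel_measurable borel" "\<xi> \<in> borel_measurable borel"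
      using test_fun_facts(4)[OF that] test_fun_facts(2)[OF that] by (auto simp: dt_def dx_def bounded_borel_def)
  qed
  have t0: "\<xi> z = 0" "dt \<xi> z = 0" "dx j \<xi> z = 0" if "test_fun ?D' \<xi>" "z \<notin> ?D'" for \<xi> j z
    using test_fun_zero_off[OF that] by (auto simp: dt_def dx_def)
  define ls where "ls n = inverse (real (Suc n))" for n
  have ls: "ls \<longlonglongrightarrow> 0" "\<And>n. ls n > 0" unfolding ls_def by (rule LIMSEQ_inverse_real_of_nat) simp
  \<comment> \<open>A test function on the cut domain is also one on the original domain, so the
    weak equations are inherited; outside the cut domain it vanishes together with its derivatives,
    which permits the exchange of the fields for their representatives.\<close>
  interpret spacetime_vorticity ls \<Omega>' T C U P F "\<lambda>t. tv_measure (\<mu> t) (G t) UNIV" "real CARD('d) * real CARD('d)"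
  proof (intro spacetime_vorticity.intro spacetime.intro moll_seq.intro spacetime_axioms.intro spacetime_vorticity_axioms.intro)
    fix \<xi> k assume \<xi>: "test_fun ?D' \<xi>"
    note [measurable] = tm[OF \<xi>]
    have "(\<integral>z \<in> ?D. (case z of (x, t) \<Rightarrow> u x t $ k * dt \<xi> (x, t) + (\<Sum>j\<in>UNIV. u x t $ k * u x t $ j * dx j \<xi> (x, t))
        + p x t * dx k \<xi> (x, t) + f x t $ k * \<xi> (x, t)) \<partial>lebesgue)
      = (\<integral>z. U k z * dt \<xi> z + (\<Sum>j\<in>UNIV. U k z * U j z * dx j \<xi> z) + P z * dx k \<xi> z + F k z * \<xi> z \<partial>lborel)"
      unfolding set_lebesgue_integral_def
    proof (rule integral_lebesgue_AE_eq)
      show "AE z in lborel. indicator ?D z *\<^sub>R (case z of (x, t) \<Rightarrow> u x t $ k * dt \<xi> (x, t) + (\<Sum>j\<in>UNIV. u x t $ k * u x t $ j * dx j \<xi> (x, t))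
        + p x t * dx k \<xi> (x, t) + f x t $ k * \<xi> (x, t)) = U k z * dt \<xi> z + (\<Sum>j\<in>UNIV. U k z * U j z * dx j \<xi> z) + P z * dx k \<xi> z + F k z * \<xi> z"
        using ae
      proof eventually_elim
        case (elim z)
        show ?case
        proof (cases "z \<in> ?D'")
          case True
          then show ?thesis using elim \<Omega>'(2) by (cases z) (auto simp: indicator_def)
        next
          case False
          then show ?thesis using t0[OF \<xi> False] by (cases z) auto
        qed
      qed
    qed measurable
    then show "(\<integral>z. U k z * dt \<xi> z + (\<Sum>j\<in>UNIV. U k z * U j z * dx j \<xi> z) + P z * dx k \<xi> z + F k z * \<xi> z \<partial>lborel) = 0"
      using euler test_fun_mono[OF \<xi> DD] by (simp add: weak_euler_def)
  next
    fix \<xi> assume \<xi>: "test_fun ?D' \<xi>"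
    note [measurable] = tm[OF \<xi>]
    have "(\<integral>z \<in> ?D. (case z of (x, t) \<Rightarrow> (\<Sum>j\<in>UNIV. u x t $ j * dx j \<xi> (x, t))) \<partial>lebesgue)
      = (\<integral>z. (\<Sum>j\<in>UNIV. U j z * dx j \<xi> z) \<partial>lborel)"
      unfolding set_lebesgue_integral_def
    proof (rule integral_lebesgue_AE_eq)
      show "AE z in lborel. indicator ?D z *\<^sub>R (case z of (x, t) \<Rightarrow> (\<Sum>j\<in>UNIV. u x t $ j * dx j \<xi> (x, t))) = (\<Sum>j\<in>UNIV. U j z * dx j \<xi> z)"
        using ae
      proof eventually_elim
        case (elim z)
        show ?case
        proof (cases "z \<in> ?D'")
          case True
          then show ?thesis using elim \<Omega>'(2) by (cases z) (auto simp: indicator_def)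
        next
          case False
          then show ?thesis using t0[OF \<xi> False] by (cases z) auto
        qed
      qed
    qed measurable
    then show "(\<integral>z. (\<Sum>j\<in>UNIV. U j z * dx j \<xi> z) \<partial>lborel) = 0"
      using euler test_fun_mono[OF \<xi> DD] by (simp add: weak_euler_def)
  next
    show "AE t in lborel. t \<in> {0<..<T} \<longrightarrow> vorticity_slice ls \<Omega>' C (\<lambda>j x. U j (x, t)) (ennreal (real CARD('d) * real CARD('d)) * tv_measure (\<mu> t) (G t) UNIV)"
      using AE_lborel_swap[OF U_ae] Lam_grad negl
    proof eventually_elim
      case (elim t)
      show ?case
      proof
        assume t: "t \<in> {0<..<T}"
        show "vorticity_slice ls \<Omega>' C (\<lambda>j x. U j (x, t)) (ennreal (real CARD('d) * real CARD('d)) * tv_measure (\<mu> t) (G t) UNIV)"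
        proof (rule vorticity_slice_intro[OF ls \<open>open \<Omega>\<close> \<Omega>' _ U_bd _ Lam_radon[OF t] mp[OF elim(2) t] mp[OF elim(3) t]])
          show "(\<lambda>x. U j (x, t)) \<in> borel_measurable borel" for j by measurable
          show "AE x in lborel. x \<in> \<Omega>' \<longrightarrow> (\<forall>j. U j (x, t) = u x t $ j)"
            using elim(1) by eventually_elim (use t in auto)
        qed
      qed
    qed
  qed (use ls \<Omega>'(1) U_bd U_int P(1) F(1) Lam_L1 in auto)
  note [measurable] = tm[OF t\<psi>']
  have b: "bounded_borel \<psi>" "bounded_borel (dt \<psi>)" "bounded_borel (dx k \<psi>)" for k
    unfolding dt_def dx_def by (rule test_fun_facts[OF t\<psi>'] basis_mem)+
  have i: "integrable lborel (\<lambda>z. g z * (h z * U k z))" if "bounded_borel g" "integrable lborel h" for g h k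
    using integrable_bounded_borel[OF integrable_mult_bounded(1)[OF that(2) _ U_bd] that(1)] U_meas
    by (simp add: mult.commute)
  have "(\<integral>z \<in> ?D. (case z of (x, t) \<Rightarrow> (norm (u x t))\<^sup>2 / 2 * dt \<psi> (x, t)
            + (\<Sum>j\<in>UNIV. u x t $ j * ((norm (u x t))\<^sup>2 / 2 + p x t) * dx j \<psi> (x, t))
            + (f x t \<bullet> u x t) * \<psi> (x, t)) \<partial>lebesgue)
      = (\<integral>z. (\<Sum>k\<in>UNIV. dt \<psi> z * (U k z * U k z)) / 2 + (\<Sum>k\<in>UNIV. dx k \<psi> z * (Q z * U k z)) + (\<Sum>k\<in>UNIV. \<psi> z * (F k z * U k z)) \<partial>lborel)"
    unfolding set_lebesgue_integral_def
  proof (rule integral_lebesgue_AE_eq)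
    show "AE z in lborel. indicator ?D z *\<^sub>R (case z of (x, t) \<Rightarrow> (norm (u x t))\<^sup>2 / 2 * dt \<psi> (x, t)
            + (\<Sum>j\<in>UNIV. u x t $ j * ((norm (u x t))\<^sup>2 / 2 + p x t) * dx j \<psi> (x, t))
            + (f x t \<bullet> u x t) * \<psi> (x, t)) = (\<Sum>k\<in>UNIV. dt \<psi> z * (U k z * U k z)) / 2 + (\<Sum>k\<in>UNIV. dx k \<psi> z * (Q z * U k z)) + (\<Sum>k\<in>UNIV. \<psi> z * (F k z * U k z))"
      using ae
    proof eventually_elim
      case (elim z)
      obtain x t where z: "z = (x, t)" by fastforce
      show ?case
      proof (cases "z \<in> ?D'")
        case True
        then have e: "u x t $ k = U k z" "p x t = P z" "f x t $ k = F k z" for k using elim by (auto simp: z)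
        have n: "(norm (u x t))\<^sup>2 = (\<Sum>k\<in>UNIV. (U k z)\<^sup>2)"
          unfolding power2_norm_eq_inner inner_vec_def by (simp add: e power2_eq_square)
        have fu: "f x t \<bullet> u x t = (\<Sum>k\<in>UNIV. F k z * U k z)"
          unfolding inner_vec_def by (simp add: e)
        have "(norm (u x t))\<^sup>2 / 2 * dt \<psi> z = (\<Sum>k\<in>UNIV. dt \<psi> z * (U k z * U k z)) / 2"
          unfolding n by (simp add: sum_distrib_left[symmetric] power2_eq_square)
        moreover have "(\<Sum>j\<in>UNIV. u x t $ j * ((norm (u x t))\<^sup>2 / 2 + p x t) * dx j \<psi> z) = (\<Sum>k\<in>UNIV. dx k \<psi> z * (Q z * U k z))"
          unfolding n e by (intro sum.cong) (auto simp: mult_ac add.commute)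
        moreover have "(f x t \<bullet> u x t) * \<psi> z = (\<Sum>k\<in>UNIV. \<psi> z * (F k z * U k z))"
          unfolding fu by (simp add: sum_distrib_left[symmetric])
        ultimately show ?thesis using True \<Omega>'(2) by (auto simp: z indicator_def)
      next
        case False
        then show ?thesis using t0[OF t\<psi>' False] by (simp add: z)
      qed
    qed
  qed measurable
  also have "\<dots> = (\<Sum>k\<in>UNIV. \<integral>z. dt \<psi> z * (U k z * U k z) \<partial>lborel) / 2
      + (\<Sum>k\<in>UNIV. \<integral>z. dx k \<psi> z * (Q z * U k z) \<partial>lborel)
      + (\<Sum>k\<in>UNIV. \<integral>z. \<psi> z * (F k z * U k z) \<partial>lborel)"
  proof -
    note j = i[OF b(2) U_int] i[OF b(3) Q_int] i[OF b(1) F_int]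
    show ?thesis
      using j by (subst Bochner_Integration.integral_add; (intro Bochner_Integration.integrable_add Bochner_Integration.integrable_sum integrable_divide)?; simp?)+
  qed
  also have "\<dots> = 0" by (rule energy_balance[OF t\<psi>'])
  finally show "(\<integral>z \<in> ?D. (case z of (x, t) \<Rightarrow> (norm (u x t))\<^sup>2 / 2 * dt \<psi> (x, t)
            + (\<Sum>j\<in>UNIV. u x t $ j * ((norm (u x t))\<^sup>2 / 2 + p x t) * dx j \<psi> (x, t))
            + (f x t \<bullet> u x t) * \<psi> (x, t)) \<partial>lebesgue) = 0" .
qed

end
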